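(* Let $M=\prod_{n\ge 2}^{\ell^\infty} M_n(\mathbb{C})$ be the von Neumann algebra of bounded sequences of matrices and $D\subset M$ the subalgebra of sequences of diagonal matrices. The following statements are equivalent. (1) Every non-compact projection in $M$ with compact diagonal is weakly paveable. (2) Every non-compact projection in $M$ is weakly paveable. (3) Pure states of $D$ have unique pure state extensions to $M$; that is, for every pure state of $D$ there is exactly one pure state of $M$ extending it.
   Context: For $n\ge 2$ let $M_n$ be the $n\times n$ complex matrices with the operator norm and $D_n\subset M_n$ the diagonal matrices. $M$ is the $\ell^\infty$-direct sum of the $M_n$, $n\ge 2$: its elements are sequences $a=\{a_n\}_{n\ge 2}$ with $a_n\in M_n$ and $\|a\|=\sup_n\|a_n\|<\infty$, with coordinatewise operations. $D\subset M$ is the subalgebra of those $a$ with $a_n\in D_n$ for all $n$. $\mathcal{P}:M\to D$ is the conditional expectation which replaces each $a_n$ by its diagonal part. Let $x_n\in M$ be the unit of $M_n$ viewed as a summand of $M$. An element $a\in M$ is compact if $\lim_{n\to\infty}\|x_na\|=0$; $K$ is the closed ideal of compact elements, and $\pi:M\to M/K$ is the quotient map (with the quotient $C^*$-norm on $M/K$). An element $a\in M$ has compact diagonal if $\mathcal{P}(a)\in K$. Projections are self-adjoint idempotents. $M^+$ is the set of positive elements of $M$. A non-compact element $x\in M^+$ is weakly paveable if there exist a natural number $m$ and projections $p_1,\dots,p_m\in D$ such that $\sum_j p_j=1$ and $\|\pi(p_j(x-\mathcal{P}(x))p_j)\|<\|\pi(x)\|$ for all $j=1,\dots,m$. *)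

theory Defs
  imports "HOL-Analysis.L2_Norm" "Jordan_Normal_Form.Schur_Decomposition"
begin

section \<open>The operator norm of a complex matrix\<close>

definition vnorm :: "complex vec \<Rightarrow> real" where
  "vnorm v = L2_set (\<lambda>i. cmod (v $ i)) {0..<dim_vec v}"

definition opnorm :: "complex mat \<Rightarrow> real" where
  "opnorm A = (SUP v\<in>{v \<in> carrier_vec (dim_col A). vnorm v \<le> 1}. vnorm (A *\<^sub>v v))"

lemma vnorm_nonneg [simp]: "0 \<le> vnorm v"
  by (simp add: vnorm_def L2_set_nonneg)

lemma vnorm_zero [simp]: "vnorm (0\<^sub>v n) = 0"
  by (simp add: vnorm_def L2_set_def)

lemma vnorm_eq_0: "vnorm v = 0 \<longleftrightarrow> v = 0\<^sub>v (dim_vec v)"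
proof -
  have "vnorm v = 0 \<longleftrightarrow> (\<forall>i<dim_vec v. v $ i = 0)"
    by (auto simp: vnorm_def L2_set_eq_0_iff)
  also have "\<dots> \<longleftrightarrow> v = 0\<^sub>v (dim_vec v)"
    by (metis eq_vecI index_zero_vec(1) index_zero_vec(2))
  finally show ?thesis .
qed

lemma vnorm_smult: "vnorm (c \<cdot>\<^sub>v v) = cmod c * vnorm v"
proof -
  have "vnorm (c \<cdot>\<^sub>v v) = L2_set (\<lambda>i. cmod c * cmod (v $ i)) {0..<dim_vec v}"
    unfolding vnorm_def by (auto intro!: L2_set_cong simp: norm_mult)
  then show ?thesis by (simp add: vnorm_def L2_set_right_distrib)
qed

lemma vnorm_add:
  assumes "u \<in> carrier_vec n" "v \<in> carrier_vec n"
  shows "vnorm (u + v) \<le> vnorm u + vnorm v"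
proof -
  have "vnorm (u + v) \<le> L2_set (\<lambda>i. cmod (u $ i) + cmod (v $ i)) {0..<n}"
    using assms unfolding vnorm_def by (auto intro!: L2_set_mono norm_triangle_ineq)
  also have "\<dots> \<le> vnorm u + vnorm v"
    using assms unfolding vnorm_def by (auto intro: L2_set_triangle_ineq)
  finally show ?thesis .
qed

lemma entry_le_vnorm: "i < dim_vec v \<Longrightarrow> cmod (v $ i) \<le> vnorm v"
  unfolding vnorm_def by (rule member_le_L2_set) auto

lemma vnorm_le_sum: "vnorm v \<le> (\<Sum>i<dim_vec v. cmod (v $ i))"
  unfolding vnorm_def by (simp add: L2_set_le_sum atLeast0LessThan)

lemma vnorm_unit: "i < n \<Longrightarrow> vnorm (unit_vec n i) = 1"
proof -
  assume i: "i < n"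
  have "(\<Sum>j = 0..<n. (cmod (unit_vec n i $ j))\<^sup>2) = (\<Sum>j\<in>{0..<n}. if j = i then 1 else 0)"
    using i by (intro sum.cong) (auto simp: unit_vec_def)
  then show ?thesis using i by (simp add: vnorm_def L2_set_def)
qed

lemma vnorm_sq: "complex_of_real ((vnorm v)\<^sup>2) = v \<bullet>c v"
  by (simp add: vnorm_def L2_set_def sum_nonneg scalar_prod_def complex_norm_square
      del: of_real_power)

lemma vnorm_mult_bound:
  assumes "A \<in> carrier_mat n m" "v \<in> carrier_vec m"
  shows "vnorm (A *\<^sub>v v) \<le> (\<Sum>i<n. \<Sum>j<m. cmod (A $$ (i,j))) * vnorm v"
proof -
  have "vnorm (A *\<^sub>v v) \<le> (\<Sum>i<n. cmod ((A *\<^sub>v v) $ i))"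
    using vnorm_le_sum[of "A *\<^sub>v v"] assms by simp
  also have "\<dots> \<le> (\<Sum>i<n. \<Sum>j<m. cmod (A $$ (i,j)) * vnorm v)"
  proof (rule sum_mono)
    fix i assume "i \<in> {..<n}"
    then have "(A *\<^sub>v v) $ i = (\<Sum>j<m. A $$ (i,j) * v $ j)"
      using assms by (auto simp: scalar_prod_def atLeast0LessThan intro!: sum.cong)
    also have "cmod \<dots> \<le> (\<Sum>j<m. cmod (A $$ (i,j)) * vnorm v)"
      using assms
      by (intro order.trans[OF norm_sum] sum_mono)
         (auto simp: norm_mult intro!: mult_left_mono entry_le_vnorm)
    finally show "cmod ((A *\<^sub>v v) $ i) \<le> (\<Sum>j<m. cmod (A $$ (i,j)) * vnorm v)" .
  qed
  finally show ?thesis by (simp add: sum_distrib_right)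
qed

lemma opnorm_bdd:
  "bdd_above ((\<lambda>v. vnorm (A *\<^sub>v v)) ` {v \<in> carrier_vec (dim_col A). vnorm v \<le> 1})"
proof (rule bdd_aboveI2)
  fix v assume v: "v \<in> {v \<in> carrier_vec (dim_col A). vnorm v \<le> 1}"
  let ?S = "\<Sum>i<dim_row A. \<Sum>j<dim_col A. cmod (A $$ (i,j))"
  have "vnorm (A *\<^sub>v v) \<le> ?S * vnorm v" using v by (intro vnorm_mult_bound) auto
  also have "\<dots> \<le> ?S * 1" using v by (intro mult_left_mono) (auto intro!: sum_nonneg)
  finally show "vnorm (A *\<^sub>v v) \<le> ?S * 1" .
qed

lemma opnorm_upper1:
  assumes "v \<in> carrier_vec (dim_col A)" "vnorm v \<le> 1"
  shows "vnorm (A *\<^sub>v v) \<le> opnorm A"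
  unfolding opnorm_def by (rule cSUP_upper[OF _ opnorm_bdd]) (use assms in auto)

lemma opnorm_nonneg [simp]: "0 \<le> opnorm A"
  by (rule order.trans[OF vnorm_nonneg opnorm_upper1[of "0\<^sub>v (dim_col A)"]]) auto

lemma vnorm_mult_le:
  assumes "v \<in> carrier_vec (dim_col A)"
  shows "vnorm (A *\<^sub>v v) \<le> opnorm A * vnorm v"
proof (cases "vnorm v = 0")
  case True
  then have "v = 0\<^sub>v (dim_col A)" using assms vnorm_eq_0 by auto
  moreover have "A *\<^sub>v 0\<^sub>v (dim_col A) = 0\<^sub>v (dim_row A)" by (intro eq_vecI) auto
  ultimately show ?thesis by simp
next
  case False
  then have pos: "vnorm v > 0" using vnorm_nonneg[of v] by linarith
  define w where "w = complex_of_real (1 / vnorm v) \<cdot>\<^sub>v v"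
  have w: "w \<in> carrier_vec (dim_col A)" "vnorm w = 1"
    using assms pos by (auto simp: w_def vnorm_smult norm_divide)
  have "A *\<^sub>v w = complex_of_real (1 / vnorm v) \<cdot>\<^sub>v (A *\<^sub>v v)"
    unfolding w_def using assms by (intro mult_mat_vec) auto
  then have "vnorm (A *\<^sub>v w) = vnorm (A *\<^sub>v v) / vnorm v"
    using pos by (simp add: vnorm_smult norm_divide)
  with opnorm_upper1[OF w(1)] w(2) pos show ?thesis by (simp add: field_simps)
qed

lemma opnorm_least:
  assumes "\<And>v. v \<in> carrier_vec (dim_col A) \<Longrightarrow> vnorm (A *\<^sub>v v) \<le> c * vnorm v" "0 \<le> c"
  shows "opnorm A \<le> c"
  unfolding opnorm_def
proof (rule cSUP_least)
  have "0\<^sub>v (dim_col A) \<in> {v \<in> carrier_vec (dim_col A). vnorm v \<le> 1}" by simp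
  then show "{v \<in> carrier_vec (dim_col A). vnorm v \<le> 1} \<noteq> {}" by blast
  fix v assume v: "v \<in> {v \<in> carrier_vec (dim_col A). vnorm v \<le> 1}"
  then have "vnorm (A *\<^sub>v v) \<le> c * vnorm v" using assms by auto
  also have "\<dots> \<le> c * 1" using v assms by (intro mult_left_mono) auto
  finally show "vnorm (A *\<^sub>v v) \<le> c" by simp
qed

lemma opnorm_zero [simp]: "opnorm (0\<^sub>m n m) = 0"
proof (rule antisym[OF opnorm_least opnorm_nonneg])
  fix v :: "complex vec" assume v: "v \<in> carrier_vec (dim_col (0\<^sub>m n m :: complex mat))"
  have "0\<^sub>m n m *\<^sub>v v = 0\<^sub>v n" using v by (intro eq_vecI) auto
  then show "vnorm (0\<^sub>m n m *\<^sub>v v) \<le> 0 * vnorm v" by simp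
qed simp

lemma opnorm_entry:
  assumes "i < dim_row A" "j < dim_col A"
  shows "cmod (A $$ (i,j)) \<le> opnorm A"
proof -
  have "A *\<^sub>v unit_vec (dim_col A) j = col A j"
    using assms by (intro eq_vecI) (auto simp: scalar_prod_right_unit)
  then have "cmod (A $$ (i,j)) \<le> vnorm (A *\<^sub>v unit_vec (dim_col A) j)"
    using assms entry_le_vnorm[of i "col A j"] by simp
  also have "\<dots> \<le> opnorm A" using assms by (intro opnorm_upper1) (auto simp: vnorm_unit)
  finally show ?thesis .
qed

lemma opnorm_eq_0: "opnorm A = 0 \<Longrightarrow> A = 0\<^sub>m (dim_row A) (dim_col A)"
  by (intro eq_matI) (auto dest: opnorm_entry)

lemma opnorm_add:
  assumes "A \<in> carrier_mat n m" "B \<in> carrier_mat n m"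
  shows "opnorm (A + B) \<le> opnorm A + opnorm B"
proof (rule opnorm_least)
  fix v :: "complex vec" assume "v \<in> carrier_vec (dim_col (A + B))"
  then have v: "v \<in> carrier_vec m" using assms by simp
  have "vnorm ((A + B) *\<^sub>v v) = vnorm (A *\<^sub>v v + B *\<^sub>v v)"
    using assms v by (simp add: add_mult_distrib_mat_vec)
  also have "\<dots> \<le> vnorm (A *\<^sub>v v) + vnorm (B *\<^sub>v v)"
    using assms v by (intro vnorm_add[of _ n]) auto
  also have "\<dots> \<le> opnorm A * vnorm v + opnorm B * vnorm v"
    using assms v by (intro add_mono vnorm_mult_le) auto
  finally show "vnorm ((A + B) *\<^sub>v v) \<le> (opnorm A + opnorm B) * vnorm v"
    by (simp add: algebra_simps)
qed simp

lemma opnorm_mult: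
  assumes "A \<in> carrier_mat n m" "B \<in> carrier_mat m k"
  shows "opnorm (A * B) \<le> opnorm A * opnorm B"
proof (rule opnorm_least)
  fix v :: "complex vec" assume "v \<in> carrier_vec (dim_col (A * B))"
  then have v: "v \<in> carrier_vec k" using assms by simp
  have "vnorm ((A * B) *\<^sub>v v) = vnorm (A *\<^sub>v (B *\<^sub>v v))"
    using assms v by simp
  also have "\<dots> \<le> opnorm A * vnorm (B *\<^sub>v v)"
    using assms v by (intro vnorm_mult_le) auto
  also have "\<dots> \<le> opnorm A * (opnorm B * vnorm v)"
    using assms v by (intro mult_left_mono vnorm_mult_le) auto
  finally show "vnorm ((A * B) *\<^sub>v v) \<le> (opnorm A * opnorm B) * vnorm v"
    by (simp add: algebra_simps)
qed simp

lemma opnorm_smult_le: "opnorm (c \<cdot>\<^sub>m A) \<le> cmod c * opnorm A"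
proof (rule opnorm_least)
  fix v :: "complex vec" assume "v \<in> carrier_vec (dim_col (c \<cdot>\<^sub>m A))"
  then have v: "v \<in> carrier_vec (dim_col A)" by simp
  have "(c \<cdot>\<^sub>m A) *\<^sub>v v = c \<cdot>\<^sub>v (A *\<^sub>v v)" using v by (intro eq_vecI) auto
  then show "vnorm ((c \<cdot>\<^sub>m A) *\<^sub>v v) \<le> (cmod c * opnorm A) * vnorm v"
    using vnorm_mult_le[OF v] by (simp add: vnorm_smult mult.assoc mult_left_mono)
qed simp

lemma opnorm_smult: "opnorm (c \<cdot>\<^sub>m A) = cmod c * opnorm A"
proof (cases "c = 0")
  case True
  then have "c \<cdot>\<^sub>m A = 0\<^sub>m (dim_row A) (dim_col A)" by auto
  with True show ?thesis by simp
next
  case False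
  have "A = inverse c \<cdot>\<^sub>m (c \<cdot>\<^sub>m A)" using False by auto
  then have "opnorm A \<le> cmod (inverse c) * opnorm (c \<cdot>\<^sub>m A)"
    by (metis opnorm_smult_le)
  then have "cmod c * opnorm A \<le> opnorm (c \<cdot>\<^sub>m A)"
    using False by (simp add: norm_inverse norm_divide field_simps)
  with opnorm_smult_le[of c A] show ?thesis by simp
qed

lemma opnorm_one: "0 < n \<Longrightarrow> opnorm (1\<^sub>m n) = 1"
proof (rule antisym)
  show "opnorm (1\<^sub>m n) \<le> 1" by (rule opnorm_least) auto
  assume "0 < n"
  then show "1 \<le> opnorm (1\<^sub>m n)" using opnorm_entry[of 0 "1\<^sub>m n" 0] by simp
qed

lemma dim_mat_adjoint [simp]:
  "dim_row (mat_adjoint A) = dim_col A" "dim_col (mat_adjoint A) = dim_row A"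
  by (auto simp: mat_adjoint_def)

lemma mat_adjoint_index:
  fixes A :: "complex mat"
  shows "i < dim_col A \<Longrightarrow> j < dim_row A \<Longrightarrow> mat_adjoint A $$ (i,j) = cnj (A $$ (j,i))"
  by (simp add: mat_adjoint_def mat_of_rows_def)

lemma mat_adjoint_carrier: "A \<in> carrier_mat n m \<Longrightarrow> mat_adjoint A \<in> carrier_mat m n"
  by auto

lemma mat_adjoint_inner:
  fixes A :: "complex mat"
  assumes "A \<in> carrier_mat n m" "u \<in> carrier_vec m" "v \<in> carrier_vec n"
  shows "(A *\<^sub>v u) \<bullet>c v = u \<bullet>c (mat_adjoint A *\<^sub>v v)"
proof -
  have "(A *\<^sub>v u) \<bullet>c v = (\<Sum>i<n. \<Sum>j<m. A $$ (i,j) * u $ j * cnj (v $ i))"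
    using assms by (auto simp: scalar_prod_def atLeast0LessThan sum_distrib_right intro!: sum.cong)
  also have "\<dots> = (\<Sum>j<m. \<Sum>i<n. A $$ (i,j) * u $ j * cnj (v $ i))"
    by (rule sum.swap)
  also have "\<dots> = u \<bullet>c (mat_adjoint A *\<^sub>v v)"
    using assms by (auto simp: scalar_prod_def atLeast0LessThan sum_distrib_left
        mat_adjoint_index cnj_sum intro!: sum.cong)
  finally show ?thesis .
qed

lemma cmod_inner_le:
  assumes "u \<in> carrier_vec n" "v \<in> carrier_vec n"
  shows "cmod (u \<bullet>c v) \<le> vnorm u * vnorm v"
proof -
  have "cmod (u \<bullet>c v) \<le> (\<Sum>i\<in>{0..<n}. \<bar>cmod (u $ i)\<bar> * \<bar>cmod (v $ i)\<bar>)"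
    using assms unfolding scalar_prod_def
    by (auto intro!: order.trans[OF norm_sum] sum_mono simp: norm_mult)
  also have "\<dots> \<le> vnorm u * vnorm v"
    using assms L2_set_mult_ineq[of "\<lambda>i. cmod (u $ i)" "\<lambda>i. cmod (v $ i)" "{0..<n}"]
    by (simp add: vnorm_def)
  finally show ?thesis .
qed

lemma opnorm_adjoint_le:
  fixes A :: "complex mat"
  shows "opnorm (mat_adjoint A) \<le> opnorm A"
proof (rule opnorm_least)
  fix v :: "complex vec" assume "v \<in> carrier_vec (dim_col (mat_adjoint A))"
  then have v: "v \<in> carrier_vec (dim_row A)" by simp
  define w where "w = mat_adjoint A *\<^sub>v v"
  have w: "w \<in> carrier_vec (dim_col A)" 
    unfolding w_def using v by (intro mult_mat_vec_carrier[of _ _ "dim_row A"]) auto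
  have "complex_of_real ((vnorm w)\<^sup>2) = (A *\<^sub>v w) \<bullet>c v"
    unfolding vnorm_sq
    using mat_adjoint_inner[of A "dim_row A" "dim_col A" w v] v w by (simp add: w_def)
  then have "(vnorm w)\<^sup>2 = cmod ((A *\<^sub>v w) \<bullet>c v)"
    by (metis abs_of_nonneg norm_of_real zero_le_power2)
  also have "\<dots> \<le> vnorm (A *\<^sub>v w) * vnorm v"
    using v w by (intro cmod_inner_le mult_mat_vec_carrier[of _ _ "dim_col A"]) auto
  also have "\<dots> \<le> opnorm A * vnorm w * vnorm v"
    using w by (intro mult_right_mono vnorm_mult_le) auto
  finally have *: "vnorm w * vnorm w \<le> vnorm w * (opnorm A * vnorm v)"
    by (simp add: power2_eq_square mult_ac)
  show "vnorm w \<le> opnorm A * vnorm v"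
  proof (cases "vnorm w = 0")
    case False
    then have "vnorm w > 0" using vnorm_nonneg[of w] by linarith
    with * show ?thesis by simp
  qed simp
qed simp

definition diag_part :: "complex mat \<Rightarrow> complex mat" where
  "diag_part A = mat_diag (dim_row A) (\<lambda>i. A $$ (i,i))"

lemma opnorm_diag_part_le:
  assumes "A \<in> carrier_mat n n"
  shows "opnorm (diag_part A) \<le> opnorm A"
proof (rule opnorm_least)
  fix v :: "complex vec" assume "v \<in> carrier_vec (dim_col (diag_part A))"
  then have v: "v \<in> carrier_vec n" using assms by (simp add: diag_part_def mat_diag_def)
  have idx: "(diag_part A *\<^sub>v v) $ i = A $$ (i,i) * v $ i" if "i < n" for i
  proof -
    have "(diag_part A *\<^sub>v v) $ i = (\<Sum>j\<in>{0..<n}. diag_part A $$ (i,j) * v $ j)"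
      using that v assms by (simp add: diag_part_def mat_diag_def scalar_prod_def)
    also have "\<dots> = (\<Sum>j\<in>{0..<n}. if i = j then A $$ (i,i) * v $ i else 0)"
      using that assms by (intro sum.cong) (auto simp: diag_part_def mat_diag_def)
    finally show ?thesis using that by simp
  qed
  have "vnorm (diag_part A *\<^sub>v v) = L2_set (\<lambda>i. cmod (A $$ (i,i) * v $ i)) {0..<n}"
    unfolding vnorm_def using assms idx
    by (auto simp: diag_part_def mat_diag_def intro!: L2_set_cong)
  also have "\<dots> \<le> L2_set (\<lambda>i. opnorm A * cmod (v $ i)) {0..<n}"
    using assms by (auto intro!: L2_set_mono mult_right_mono opnorm_entry simp: norm_mult)
  also have "\<dots> = opnorm A * vnorm v"
    using v by (simp add: L2_set_right_distrib vnorm_def)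
  finally show "vnorm (diag_part A *\<^sub>v v) \<le> opnorm A * vnorm v" .
qed simp


section \<open>The algebra $M$\<close>

text \<open>The index \<open>n\<close> of a coordinate is the size of the matrix. There are no summands
  of size 0 and 1: the entries of the underlying sequence at these two indices are fixed to
  be zero matrices, and they do not enter the norm.\<close>

typedef mseq =
  "{a :: nat \<Rightarrow> complex mat.
      (\<forall>n\<ge>2. a n \<in> carrier_mat n n) \<and> (\<forall>n<2. a n = 0\<^sub>m n n) \<and>
      bdd_above ((\<lambda>n. opnorm (a n)) ` {2..})}"
  morphisms coord Abs_mseq
  by (rule exI[of _ "\<lambda>n. 0\<^sub>m n n"]) auto

setup_lifting type_definition_mseq

lemma mseq_carrier:
  assumes "(\<forall>n\<ge>2. a n \<in> carrier_mat n n) \<and> (\<forall>n<2. a n = 0\<^sub>m n n) \<and> X"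
  shows "a n \<in> carrier_mat n n"
  using assms by (cases "n < 2") auto

lemma coord_carrier [simp]: "coord a n \<in> carrier_mat n n"
  using coord[of a] by (auto intro: mseq_carrier)

lemma coord_dim [simp]: "dim_row (coord a n) = n" "dim_col (coord a n) = n"
  using coord_carrier[of a n] by (auto simp del: coord_carrier)

lemma coord_small: "n < 2 \<Longrightarrow> coord a n = 0\<^sub>m n n"
  using coord[of a] by auto

lemma coord_bdd: "bdd_above ((\<lambda>n. opnorm (coord a n)) ` {2..})"
  using coord[of a] by auto

lemma mseq_eqI: "(\<And>n. n \<ge> 2 \<Longrightarrow> coord a n = coord b n) \<Longrightarrow> a = b"
  by (metis coord_inject coord_small ext not_le)

lemma bdd_aboveE_real:
  fixes f :: "nat \<Rightarrow> real"
  assumes "bdd_above (f ` S)"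
  obtains C where "0 \<le> C" "\<And>n. n \<in> S \<Longrightarrow> f n \<le> C"
proof -
  obtain C where "\<And>n. n \<in> S \<Longrightarrow> f n \<le> C" using assms by (auto simp: bdd_above_def)
  then show ?thesis by (intro that[of "max 0 C"]) (auto intro: max.coboundedI2)
qed

instantiation mseq :: "{ring_1, real_normed_algebra_1}"
begin

lift_definition zero_mseq :: mseq is "\<lambda>n. 0\<^sub>m n n"
  by auto

lift_definition one_mseq :: mseq is "\<lambda>n. if n < 2 then 0\<^sub>m n n else 1\<^sub>m n"
  by (auto intro!: bdd_aboveI2[where M = 1] simp: opnorm_one)

lift_definition plus_mseq :: "mseq \<Rightarrow> mseq \<Rightarrow> mseq" is "\<lambda>a b n. a n + b n"
proof (intro conjI allI impI)
  fix a b :: "nat \<Rightarrow> complex mat"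
  assume a: "(\<forall>n\<ge>2. a n \<in> carrier_mat n n) \<and> (\<forall>n<2. a n = 0\<^sub>m n n) \<and>
      bdd_above ((\<lambda>n. opnorm (a n)) ` {2..})"
    and b: "(\<forall>n\<ge>2. b n \<in> carrier_mat n n) \<and> (\<forall>n<2. b n = 0\<^sub>m n n) \<and>
      bdd_above ((\<lambda>n. opnorm (b n)) ` {2..})"
  show "a n + b n \<in> carrier_mat n n" for n
    using mseq_carrier[OF b] by simp
  show "n < 2 \<Longrightarrow> a n + b n = 0\<^sub>m n n" for n using a b by simp
  obtain C D where "\<And>n. n \<in> {2..} \<Longrightarrow> opnorm (a n) \<le> C" "\<And>n. n \<in> {2..} \<Longrightarrow> opnorm (b n) \<le> D"
    using a b by (metis bdd_aboveE_real)
  then show "bdd_above ((\<lambda>n. opnorm (a n + b n)) ` {2..})"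
    by (intro bdd_aboveI2[where M = "C + D"]
        order.trans[OF opnorm_add[OF mseq_carrier[OF a] mseq_carrier[OF b]]] add_mono)
qed

lift_definition times_mseq :: "mseq \<Rightarrow> mseq \<Rightarrow> mseq" is "\<lambda>a b n. a n * b n"
proof (intro conjI allI impI)
  fix a b :: "nat \<Rightarrow> complex mat"
  assume a: "(\<forall>n\<ge>2. a n \<in> carrier_mat n n) \<and> (\<forall>n<2. a n = 0\<^sub>m n n) \<and>
      bdd_above ((\<lambda>n. opnorm (a n)) ` {2..})"
    and b: "(\<forall>n\<ge>2. b n \<in> carrier_mat n n) \<and> (\<forall>n<2. b n = 0\<^sub>m n n) \<and>
      bdd_above ((\<lambda>n. opnorm (b n)) ` {2..})"
  show "a n * b n \<in> carrier_mat n n" for n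
    using mult_carrier_mat[OF mseq_carrier[OF a] mseq_carrier[OF b]] .
  show "n < 2 \<Longrightarrow> a n * b n = 0\<^sub>m n n" for n using a b by simp
  obtain C D where "0 \<le> C" "\<And>n. n \<in> {2..} \<Longrightarrow> opnorm (a n) \<le> C"
      "\<And>n. n \<in> {2..} \<Longrightarrow> opnorm (b n) \<le> D"
    using a b by (metis bdd_aboveE_real)
  then show "bdd_above ((\<lambda>n. opnorm (a n * b n)) ` {2..})"
    by (intro bdd_aboveI2[where M = "C * D"]
        order.trans[OF opnorm_mult[OF mseq_carrier[OF a] mseq_carrier[OF b]]] mult_mono) auto
qed

lift_definition uminus_mseq :: "mseq \<Rightarrow> mseq" is "\<lambda>a n. (-1) \<cdot>\<^sub>m a n"
  by (auto simp: opnorm_smult)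

definition minus_mseq :: "mseq \<Rightarrow> mseq \<Rightarrow> mseq" where
  "minus_mseq a b = a + - b"

lift_definition scaleR_mseq :: "real \<Rightarrow> mseq \<Rightarrow> mseq" is "\<lambda>r a n. complex_of_real r \<cdot>\<^sub>m a n"
proof (intro conjI allI impI)
  fix r :: real and a :: "nat \<Rightarrow> complex mat"
  assume a: "(\<forall>n\<ge>2. a n \<in> carrier_mat n n) \<and> (\<forall>n<2. a n = 0\<^sub>m n n) \<and>
      bdd_above ((\<lambda>n. opnorm (a n)) ` {2..})"
  show "complex_of_real r \<cdot>\<^sub>m a n \<in> carrier_mat n n" for n
    using mseq_carrier[OF a] by simp
  show "n < 2 \<Longrightarrow> complex_of_real r \<cdot>\<^sub>m a n = 0\<^sub>m n n" for n using a by auto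
  obtain C where "\<And>n. n \<in> {2..} \<Longrightarrow> opnorm (a n) \<le> C"
    using a by (metis bdd_aboveE_real)
  then show "bdd_above ((\<lambda>n. opnorm (complex_of_real r \<cdot>\<^sub>m a n)) ` {2..})"
    by (intro bdd_aboveI2[where M = "\<bar>r\<bar> * C"]) (auto simp: opnorm_smult intro!: mult_left_mono)
qed

definition norm_mseq :: "mseq \<Rightarrow> real" where
  "norm_mseq a = (SUP n\<in>{2..}. opnorm (coord a n))"

definition sgn_mseq :: "mseq \<Rightarrow> mseq" where
  "sgn_mseq a = inverse (norm a) *\<^sub>R a"

definition dist_mseq :: "mseq \<Rightarrow> mseq \<Rightarrow> real" where
  "dist_mseq a b = norm (a - b)"

definition uniformity_mseq :: "(mseq \<times> mseq) filter" where
  "uniformity_mseq = (INF e\<in>{0 <..}. principal {(x, y). dist x y < e})"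

definition open_mseq :: "mseq set \<Rightarrow> bool" where
  "open_mseq U = (\<forall>x\<in>U. eventually (\<lambda>(x', y). x' = x \<longrightarrow> y \<in> U) uniformity)"

lemma coord_le_norm: "n \<ge> 2 \<Longrightarrow> opnorm (coord a n) \<le> norm a" for a :: mseq
  unfolding norm_mseq_def by (rule cSUP_upper[OF _ coord_bdd]) simp

lemma norm_mseq_least: "(\<And>n. n \<ge> 2 \<Longrightarrow> opnorm (coord a n) \<le> c) \<Longrightarrow> norm a \<le> c" for a :: mseq
  unfolding norm_mseq_def by (rule cSUP_least) auto

lemma norm_mseq_nonneg: "0 \<le> norm a" for a :: mseq
  using order.trans[OF opnorm_nonneg coord_le_norm[of 2]] by simp

lemma scaleR_mseq_le: "norm (r *\<^sub>R a) \<le> \<bar>r\<bar> * norm a" for a :: mseq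
  by (rule norm_mseq_least)
     (auto simp: scaleR_mseq.rep_eq opnorm_smult intro!: mult_left_mono coord_le_norm)

instance
proof
  fix a b c :: mseq and r s :: real
  note rep = zero_mseq.rep_eq one_mseq.rep_eq plus_mseq.rep_eq times_mseq.rep_eq
    uminus_mseq.rep_eq scaleR_mseq.rep_eq
  note crep = coord_carrier
  show "a + b + c = a + (b + c)"
    by (rule mseq_eqI) (auto simp: rep intro!: assoc_add_mat[of _ n n for n])
  show "a + b = b + a"
    by (rule mseq_eqI) (auto simp: rep intro!: comm_add_mat[of _ n n for n])
  show "0 + a = a" by (rule mseq_eqI) (auto simp: rep)
  show "- a + a = 0" by (rule mseq_eqI) (auto simp: rep)
  show "a - b = a + - b" by (simp add: minus_mseq_def)
  show "a * b * c = a * (b * c)"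
    by (rule mseq_eqI) (auto simp: rep intro!: assoc_mult_mat[of _ n n _ n _ n for n])
  show "1 * a = a" by (rule mseq_eqI) (auto simp: rep)
  show "a * 1 = a" by (rule mseq_eqI) (auto simp: rep)
  show "(a + b) * c = a * c + b * c"
    by (rule mseq_eqI) (auto simp: rep intro!: add_mult_distrib_mat[of _ n n _ _ n for n])
  show "a * (b + c) = a * b + a * c"
    by (rule mseq_eqI) (auto simp: rep intro!: mult_add_distrib_mat[of _ n n _ n for n])
  have n1: "norm (1::mseq) = 1"
    by (auto simp: norm_mseq_def rep opnorm_one)
  then show "norm (1::mseq) = 1" .
  have n0: "norm (0::mseq) = 0" by (auto simp: norm_mseq_def rep)
  show "(0::mseq) \<noteq> 1" using n0 n1 by (metis zero_neq_one)
  show "r *\<^sub>R (a + b) = r *\<^sub>R a + r *\<^sub>R b"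
    by (rule mseq_eqI) (auto simp: rep intro!: add_smult_distrib_left_mat[of _ n n for n])
  show "(r + s) *\<^sub>R a = r *\<^sub>R a + s *\<^sub>R a"
    by (rule mseq_eqI) (auto simp: rep intro!: add_smult_distrib_right_mat[of _ n n for n])
  show "r *\<^sub>R s *\<^sub>R a = (r * s) *\<^sub>R a" by (rule mseq_eqI) (auto simp: rep)
  show "1 *\<^sub>R a = a" by (rule mseq_eqI) (auto simp: rep)
  show "r *\<^sub>R a * b = r *\<^sub>R (a * b)"
    by (rule mseq_eqI) (auto simp: rep intro!: mult_smult_assoc_mat[of _ n n _ n for n])
  show "a * r *\<^sub>R b = r *\<^sub>R (a * b)"
    by (rule mseq_eqI) (auto simp: rep intro!: mult_smult_distrib[of _ n n _ n for n])
  show "dist a b = norm (a - b)" by (simp add: dist_mseq_def)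
  show "sgn a = inverse (norm a) *\<^sub>R a" by (simp add: sgn_mseq_def)
  show "uniformity = (INF e\<in>{0 <..}. principal {(x, y). dist x (y::mseq) < e})"
    by (rule uniformity_mseq_def)
  show "open U = (\<forall>x\<in>U. eventually (\<lambda>(x', y). x' = x \<longrightarrow> y \<in> U) uniformity)" for U :: "mseq set"
    by (rule open_mseq_def)
  show "norm a = 0 \<longleftrightarrow> a = 0"
  proof
    assume "norm a = 0"
    then have "opnorm (coord a n) = 0" if "n \<ge> 2" for n
      using coord_le_norm[OF that, of a] opnorm_nonneg[of "coord a n"] by linarith
    then show "a = 0" by (intro mseq_eqI) (metis coord_dim opnorm_eq_0 zero_mseq.rep_eq)
  qed (simp add: n0)
  show "norm (a + b) \<le> norm a + norm b"
    by (intro norm_mseq_least, unfold rep, rule order.trans[OF opnorm_add[of _ n n for n]])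
       (auto intro!: add_mono coord_le_norm)
  show "norm (a * b) \<le> norm a * norm b"
    by (intro norm_mseq_least, unfold rep, rule order.trans[OF opnorm_mult[of _ n n _ n for n]])
       (auto intro!: mult_mono coord_le_norm norm_mseq_nonneg)
  show "norm (r *\<^sub>R a) = \<bar>r\<bar> * norm a"
  proof (cases "r = 0")
    case True
    then have "r *\<^sub>R a = 0" by (intro mseq_eqI) (auto simp: rep)
    with True n0 show ?thesis by simp
  next
    case False
    have "a = inverse r *\<^sub>R (r *\<^sub>R a)" using False by (intro mseq_eqI) (auto simp: rep)
    then have "norm a \<le> \<bar>inverse r\<bar> * norm (r *\<^sub>R a)" by (metis scaleR_mseq_le)
    then have "\<bar>r\<bar> * norm a \<le> norm (r *\<^sub>R a)" using False by (simp add: field_simps)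
    with scaleR_mseq_le[of r a] show ?thesis by simp
  qed
qed

end

lift_definition cscale :: "complex \<Rightarrow> mseq \<Rightarrow> mseq" is "\<lambda>c a n. c \<cdot>\<^sub>m a n"
proof (intro conjI allI impI)
  fix c :: complex and a :: "nat \<Rightarrow> complex mat"
  assume a: "(\<forall>n\<ge>2. a n \<in> carrier_mat n n) \<and> (\<forall>n<2. a n = 0\<^sub>m n n) \<and>
      bdd_above ((\<lambda>n. opnorm (a n)) ` {2..})"
  show "c \<cdot>\<^sub>m a n \<in> carrier_mat n n" for n
    using mseq_carrier[OF a] by simp
  show "n < 2 \<Longrightarrow> c \<cdot>\<^sub>m a n = 0\<^sub>m n n" for n using a by auto
  obtain C where "\<And>n. n \<in> {2..} \<Longrightarrow> opnorm (a n) \<le> C"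
    using a by (metis bdd_aboveE_real)
  then show "bdd_above ((\<lambda>n. opnorm (c \<cdot>\<^sub>m a n)) ` {2..})"
    by (intro bdd_aboveI2[where M = "cmod c * C"]) (auto simp: opnorm_smult intro!: mult_left_mono)
qed

lift_definition adj :: "mseq \<Rightarrow> mseq" is "\<lambda>a n. mat_adjoint (a n)"
proof (intro conjI allI impI)
  fix a :: "nat \<Rightarrow> complex mat"
  assume a: "(\<forall>n\<ge>2. a n \<in> carrier_mat n n) \<and> (\<forall>n<2. a n = 0\<^sub>m n n) \<and>
      bdd_above ((\<lambda>n. opnorm (a n)) ` {2..})"
  show "mat_adjoint (a n) \<in> carrier_mat n n" for n
    using mseq_carrier[OF a] by (rule mat_adjoint_carrier)
  show "n < 2 \<Longrightarrow> mat_adjoint (a n) = 0\<^sub>m n n" for n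
    using a by (auto simp: mat_adjoint_index intro!: eq_matI)
  obtain C where "\<And>n. n \<in> {2..} \<Longrightarrow> opnorm (a n) \<le> C"
    using a by (metis bdd_aboveE_real)
  then show "bdd_above ((\<lambda>n. opnorm (mat_adjoint (a n))) ` {2..})"
    by (intro bdd_aboveI2[where M = C] order.trans[OF opnorm_adjoint_le])
qed

definition positive :: "mseq set" where
  "positive = {adj b * b | b. True}"

definition is_projection :: "mseq \<Rightarrow> bool" where
  "is_projection p \<longleftrightarrow> adj p = p \<and> p * p = p"


section \<open>The diagonal subalgebra and the conditional expectation\<close>

definition diagonals :: "mseq set" where
  "diagonals = {a. \<forall>n\<ge>2. diagonal_mat (coord a n)}"

lift_definition cond_exp :: "mseq \<Rightarrow> mseq" is "\<lambda>a n. diag_part (a n)"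
proof (intro conjI allI impI)
  fix a :: "nat \<Rightarrow> complex mat"
  assume a: "(\<forall>n\<ge>2. a n \<in> carrier_mat n n) \<and> (\<forall>n<2. a n = 0\<^sub>m n n) \<and>
      bdd_above ((\<lambda>n. opnorm (a n)) ` {2..})"
  show "diag_part (a n) \<in> carrier_mat n n" for n
    using mseq_carrier[OF a, of n] by (simp add: diag_part_def mat_diag_def)
  show "n < 2 \<Longrightarrow> diag_part (a n) = 0\<^sub>m n n" for n
    using a by (auto simp: diag_part_def mat_diag_def intro!: eq_matI)
  obtain C where "\<And>n. n \<in> {2..} \<Longrightarrow> opnorm (a n) \<le> C"
    using a by (metis bdd_aboveE_real)
  then show "bdd_above ((\<lambda>n. opnorm (diag_part (a n))) ` {2..})"
    by (intro bdd_aboveI2[where M = C] order.trans[OF opnorm_diag_part_le[OF mseq_carrier[OF a]]])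
qed


section \<open>Compact elements and the quotient by them\<close>

lift_definition summand_unit :: "nat \<Rightarrow> mseq" is
  "\<lambda>n k. if k = n \<and> 2 \<le> n then 1\<^sub>m k else 0\<^sub>m k k"
  by (auto intro!: bdd_aboveI2[where M = 1] simp: opnorm_one)

definition compacts :: "mseq set" where
  "compacts = {a. (\<lambda>n. norm (summand_unit n * a)) \<longlonglongrightarrow> 0}"

definition quotient_map :: "mseq \<Rightarrow> mseq set" where
  "quotient_map a = {a + k | k. k \<in> compacts}"

definition quotient_norm :: "mseq set \<Rightarrow> real" where
  "quotient_norm S = (INF b\<in>S. norm b)"

definition weakly_paveable :: "mseq \<Rightarrow> bool" where
  "weakly_paveable x \<longleftrightarrow> x \<in> positive \<and> x \<notin> compacts \<and>
     (\<exists>(m::nat) p.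
        (\<forall>j\<in>{1..m}. p j \<in> diagonals \<and> is_projection (p j)) \<and>
        (\<Sum>j=1..m. p j) = 1 \<and>
        (\<forall>j\<in>{1..m}. quotient_norm (quotient_map (p j * (x - cond_exp x) * p j))
                      < quotient_norm (quotient_map x)))"


section \<open>States\<close>

text \<open>A functional on a unital *-subalgebra \<open>A\<close> of $M$ is represented by a function which is
  \<^const>\<open>undefined\<close> outside \<open>A\<close>, so that equality of functionals on \<open>A\<close> is equality of
  functions. Boundedness is not required, as it follows from positivity. The order on the
  complex numbers is that of \<^theory>\<open>HOL-Library.Complex_Order\<close>: in particular \<open>0 \<le> z\<close>
  says that \<open>z\<close> is real and non-negative.\<close>

definition state :: "mseq set \<Rightarrow> (mseq \<Rightarrow> complex) \<Rightarrow> bool" where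
  "state A f \<longleftrightarrow> f \<in> extensional A \<and>
     (\<forall>a\<in>A. \<forall>b\<in>A. f (a + b) = f a + f b) \<and>
     (\<forall>c. \<forall>a\<in>A. f (cscale c a) = c * f a) \<and>
     (\<forall>a\<in>A. 0 \<le> f (adj a * a)) \<and>
     f 1 = 1"

definition pure_state :: "mseq set \<Rightarrow> (mseq \<Rightarrow> complex) \<Rightarrow> bool" where
  "pure_state A f \<longleftrightarrow> state A f \<and>
     (\<forall>g h t. state A g \<and> state A h \<and> 0 < t \<and> t < 1 \<and>
        (\<forall>a\<in>A. f a = complex_of_real t * g a + complex_of_real (1 - t) * h a)
        \<longrightarrow> g = f \<and> h = f)"

end

theory Submission
  imports "HOL-Analysis.Function_Topology" "HOL-Analysis.Topology_Euclidean_Space" Defs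
begin

text \<open>If every projection with compact diagonal is weakly paveable, then for some \<open>k\<close> every finite
  projection matrix with diagonal at most \<open>1 / k\<close> can be paved by \<open>k\<close> diagonal projections to norm
  at most \<open>1 - 1 / k\<close>: otherwise counterexamples for all \<open>k\<close> could be assembled into one projection
  with compact diagonal. Dilating contractions to projections and rescaling repeatedly, one obtains
  that positive matrices with diagonal at most 1 can be paved to norm at most \<open>k\<close>, with a number of
  pieces that depends only on the norm. The tensor square of a positive matrix which cannot be paved
  to norm \<open>c\<close> yields one which cannot be paved to norm \<open>c\<^sup>2\<close>; hence \<open>k\<close> may be replaced by
  \<open>1 + \<eta>\<close> for each \<open>\<eta> > 0\<close>. Applied to \<open>1 + H\<close> and \<open>1 - H\<close>, this paves self-adjoint \<open>H\<close>
  with zero diagonal to norm \<open>\<eta>\<close>, and a pure state of $D$, which takes the value 1 on some piece of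
  each paving, extends only through the conditional expectation.

  Conversely, if a self-adjoint \<open>x\<close> with zero diagonal cannot be paved to norm \<open>c\<close>, then by
  compactness some pure state of $D$ is 0 on all diagonal projections that compress \<open>x\<close> to norm at
  most \<open>c\<close>, and it has an extension that does not vanish at \<open>x\<close>. Since the composition with the
  conditional expectation vanishes at \<open>x\<close>, the face of extensions contains two different pure
  states.\<close>

section \<open>Bessel bounds and colourings\<close>

text \<open>A positive matrix is carried as the Gram matrix of a family of rows. Its diagonal
  entries are the squared row norms, its norm is the best Bessel bound, and compressing it by a
  diagonal projection means selecting rows; so a paving is a colouring of the rows.

  The obstacle is that weak paveability gives only one strict inequality for each projection. Tying
  the size of the diagonal, the number of pieces and the gain to a single integer \<open>k\<close>
  makes a failure for every \<open>k\<close> a sequence of finite counterexamples, and a success for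
  one \<open>k\<close> a step that can be iterated: selecting rows leaves their norms alone, while
  rescaling the Bessel bound to 1 shrinks them as long as that bound exceeds \<open>k\<close>.

  In the tensor step row norms and Bessel bounds both multiply. Rows of norm at most 1 stay so, but
  the Bessel bound is squared, hence the quantification over all bounds in
  \<open>uniformly_colourable\<close>. The limit 1 cannot be improved, since a compression of a
  matrix with unit diagonal has norm at least 1; it suffices because norm \<open>1 + \<eta>\<close>
  for a block of \<open>1 + H\<close> is the upper bound \<eta> for that block of
  \<open>H\<close>.\<close>

definition psd_on :: "'a set \<Rightarrow> ('a \<Rightarrow> 'a \<Rightarrow> complex) \<Rightarrow> bool" where
  "psd_on D K \<longleftrightarrow> (\<forall>i\<in>D. \<forall>j\<in>D. K j i = cnj (K i j)) \<and>
     (\<forall>y. 0 \<le> Re (\<Sum>i\<in>D. \<Sum>j\<in>D. cnj (y i) * K i j * y j))"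

text \<open>Cholesky factorisation: one index is eliminated at a time and the Schur complement of
  its pivot is factored by induction.\<close>

lemma psd_on_factor:
  assumes "finite D" "psd_on D K"
  shows "\<exists>b. \<forall>i\<in>D. \<forall>j\<in>D. K i j = (\<Sum>e\<in>D. cnj (b e i) * b e j)"
  using assms
proof (induction D arbitrary: K rule: finite_induct)
  case (insert x F)
  have herm: "K j i = cnj (K i j)" if "i \<in> insert x F" "j \<in> insert x F" for i j
    using insert.prems that unfolding psd_on_def by blast
  have psd: "0 \<le> Re (\<Sum>i\<in>insert x F. \<Sum>j\<in>insert x F. cnj (y i) * K i j * y j)" for y
    using insert.prems unfolding psd_on_def by blast
  define k where "k = Re (K x x)"
  have Kxx: "K x x = of_real k"
    using herm[of x x] by (simp add: k_def complex_eq_iff)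
  define s where "s y = (\<Sum>j\<in>F. K x j * y j)" for y
  define Q where "Q y = (\<Sum>i\<in>F. \<Sum>j\<in>F. cnj (y i) * K i j * y j)" for y
  \<comment> \<open>The test vector is \<open>y\<close> with the value \<open>- t * s y\<close> at
    \<open>x\<close>, which turns positivity into a quadratic inequality in the real number
    \<open>t\<close>.\<close>
  have quad: "0 \<le> Re (Q y) - 2 * t * (cmod (s y))\<^sup>2 + t\<^sup>2 * (cmod (s y))\<^sup>2 * k" for y t
  proof -
    define z where "z = y(x := - of_real t * s y)"
    have zF: "z i = y i" if "i \<in> F" for i using that insert.hyps by (auto simp: z_def)
    have zx: "z x = - of_real t * s y" by (simp add: z_def)
    have "(\<Sum>i\<in>insert x F. \<Sum>j\<in>insert x F. cnj (z i) * K i j * z j)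
        = cnj (z x) * K x x * z x + cnj (z x) * (\<Sum>j\<in>F. K x j * z j)
          + ((\<Sum>i\<in>F. cnj (z i) * K i x) * z x + (\<Sum>i\<in>F. \<Sum>j\<in>F. cnj (z i) * K i j * z j))"
      using insert.hyps by (simp add: sum.distrib sum_distrib_left sum_distrib_right mult.assoc)
    also have "(\<Sum>j\<in>F. K x j * z j) = s y" by (simp add: s_def zF)
    also have "(\<Sum>i\<in>F. cnj (z i) * K i x) = cnj (s y)"
      unfolding s_def cnj_sum by (intro sum.cong) (auto simp: zF herm[of x])
    also have "(\<Sum>i\<in>F. \<Sum>j\<in>F. cnj (z i) * K i j * z j) = Q y" by (simp add: Q_def zF)
    finally have "0 \<le> Re (cnj (z x) * K x x * z x + cnj (z x) * s y + (cnj (s y) * z x + Q y))"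
      using psd[of z] by simp
    then show ?thesis unfolding zx Kxx cmod_power2
      by (simp add: power2_eq_square algebra_simps)
  qed
  \<comment> \<open>For a zero pivot the expression is affine in \<open>t\<close>, so a nonzero
    \<open>s y\<close> would make it negative for large \<open>t\<close>.\<close>
  have k0: "s y = 0" if "k = 0" for y
  proof (rule ccontr)
    assume "s y \<noteq> 0"
    then have pos: "(cmod (s y))\<^sup>2 > 0" by simp
    have "0 \<le> Re (Q y) - 2 * ((\<bar>Re (Q y)\<bar> + 1) / (cmod (s y))\<^sup>2) * (cmod (s y))\<^sup>2"
      using quad[of y "(\<bar>Re (Q y)\<bar> + 1) / (cmod (s y))\<^sup>2"] that by simp
    then show False using pos by simp
  qed
  have knn: "0 \<le> k"
  proof -
    define z :: "'a \<Rightarrow> complex" where "z = (\<lambda>i. if i = x then 1 else 0)"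
    have "z x = 1" "\<And>i. i \<in> F \<Longrightarrow> z i = 0" using insert.hyps by (auto simp: z_def)
    then have "(\<Sum>i\<in>insert x F. \<Sum>j\<in>insert x F. cnj (z i) * K i j * z j) = K x x"
      using insert.hyps by simp
    then show ?thesis
      using psd[of z] Kxx by simp
  qed
  \<comment> \<open>The Schur complement. For \<open>k = 0\<close> division by zero leaves
    \<open>K\<close> itself, which is correct because the pivot row then vanishes.\<close>
  define K' where "K' i j = K i j - cnj (K x i) * K x j / of_real k" for i j
  have "psd_on F K'"
    unfolding psd_on_def
  proof (intro conjI ballI allI)
    fix i j assume "i \<in> F" "j \<in> F"
    then show "K' j i = cnj (K' i j)" using herm[of i j] by (simp add: K'_def)
  next
    fix y
    have "(\<Sum>i\<in>F. \<Sum>j\<in>F. cnj (y i) * K' i j * y j)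
        = Q y - (\<Sum>i\<in>F. \<Sum>j\<in>F. cnj (K x i * y i) * (K x j * y j)) / of_real k"
      unfolding Q_def K'_def
      by (simp add: algebra_simps sum_subtractf sum_divide_distrib)
    also have "(\<Sum>i\<in>F. \<Sum>j\<in>F. cnj (K x i * y i) * (K x j * y j)) = of_real ((cmod (s y))\<^sup>2)"
      unfolding complex_norm_square mult.commute[of "s y"]
      unfolding s_def cnj_sum sum_product ..
    finally have eq: "Re (\<Sum>i\<in>F. \<Sum>j\<in>F. cnj (y i) * K' i j * y j) = Re (Q y) - (cmod (s y))\<^sup>2 / k"
      by (simp flip: of_real_divide)
    show "0 \<le> Re (\<Sum>i\<in>F. \<Sum>j\<in>F. cnj (y i) * K' i j * y j)"
    proof (cases "k = 0")
      case True
      then show ?thesis using quad[of y 0] eq by simp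
    next
      case False
      have "(1 / k)\<^sup>2 * (cmod (s y))\<^sup>2 * k = (cmod (s y))\<^sup>2 / k"
        using False by (simp add: power2_eq_square)
      then show ?thesis using quad[of y "1 / k"] eq by simp
    qed
  qed
  then obtain b where b: "\<forall>i\<in>F. \<forall>j\<in>F. K' i j = (\<Sum>e\<in>F. cnj (b e i) * b e j)"
    using insert.IH by blast
  \<comment> \<open>The factor is triangular: row \<open>x\<close> is the pivot row over the root of
    the pivot, and the other rows vanish at \<open>x\<close>.\<close>
  define b' where "b' e i = (if e = x then K x i / of_real (sqrt k) else if i = x then 0 else b e i)" for e i
  have sq: "complex_of_real (sqrt k) * of_real (sqrt k) = of_real k"
    using knn by (simp flip: of_real_mult)
  show ?case
  proof (intro exI[of _ b'] ballI)
    fix i j assume ij: "i \<in> insert x F" "j \<in> insert x F"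
    have "(\<Sum>e\<in>insert x F. cnj (b' e i) * b' e j)
        = cnj (K x i) * K x j / of_real k + (\<Sum>e\<in>F. cnj (b' e i) * b' e j)"
      using insert.hyps by (simp add: b'_def sq)
    also have "(\<Sum>e\<in>F. cnj (b' e i) * b' e j) = (if i = x \<or> j = x then 0 else K' i j)"
      using insert.hyps ij b by (auto simp: b'_def intro!: sum.neutral sum.cong)
    finally have eq: "(\<Sum>e\<in>insert x F. cnj (b' e i) * b' e j) =
        cnj (K x i) * K x j / of_real k + (if i = x \<or> j = x then 0 else K' i j)" .
    have K0: "K x j = 0" if "k = 0" "j \<in> insert x F" for j
    proof (cases "j = x")
      case False
      have "s (\<lambda>i. if i = j then 1 else 0) = (\<Sum>i\<in>F. if i = j then K x i else 0)"
        unfolding s_def by (intro sum.cong) auto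
      then have "s (\<lambda>i. if i = j then 1 else 0) = K x j"
        using that False insert.hyps by simp
      then show ?thesis using k0[OF that(1)] by metis
    qed (use that Kxx in auto)
    show "K i j = (\<Sum>e\<in>insert x F. cnj (b' e i) * b' e j)"
    proof (cases "k = 0")
      case True
      then have "K x i = 0" "K x j = 0" using K0 ij by auto
      moreover have "K i x = 0" using \<open>K x i = 0\<close> herm[of x i] ij by simp
      ultimately show ?thesis unfolding eq K'_def by auto
    next
      case False
      then show ?thesis unfolding eq K'_def using herm[of x i] ij Kxx by (auto simp: herm[of x i])
    qed
  qed
qed simp

section \<open>Gram matrices and Bessel bounds\<close>

lemma gram_quadratic_form:
  "(\<Sum>d\<in>D. \<Sum>d'\<in>D. cnj (y d) * (\<Sum>e\<in>S. cnj (b e d) * b e d') * y d')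
     = complex_of_real (\<Sum>e\<in>S. (cmod (\<Sum>d\<in>D. b e d * y d))\<^sup>2)"
proof -
  have "(\<Sum>d\<in>D. \<Sum>d'\<in>D. cnj (y d) * (\<Sum>e\<in>S. cnj (b e d) * b e d') * y d')
      = (\<Sum>d\<in>D. \<Sum>d'\<in>D. \<Sum>e\<in>S. cnj (b e d * y d) * (b e d' * y d'))"
    by (simp add: sum_distrib_left sum_distrib_right mult_ac)
  also have "\<dots> = (\<Sum>d\<in>D. \<Sum>e\<in>S. \<Sum>d'\<in>D. cnj (b e d * y d) * (b e d' * y d'))"
    by (intro sum.cong refl sum.swap)
  also have "\<dots> = (\<Sum>e\<in>S. \<Sum>d\<in>D. \<Sum>d'\<in>D. cnj (b e d * y d) * (b e d' * y d'))"
    by (rule sum.swap)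
  also have "\<dots> = (\<Sum>e\<in>S. cnj (\<Sum>d\<in>D. b e d * y d) * (\<Sum>d\<in>D. b e d * y d))"
    by (simp only: cnj_sum sum_product)
  finally show ?thesis
    by (simp only: of_real_sum complex_norm_square mult.commute[of "cnj (sum _ _)"])
qed

text \<open>\<open>bessel D S a c\<close> says that the matrix with rows \<open>a i\<close>, \<open>i \<in> S\<close>, and columns indexed by
  \<open>D\<close> has operator norm at most \<open>sqrt c\<close>. Functions on finite sets replace matrices here because
  the tensor product argument changes the index sets.\<close>

definition bessel :: "'b set \<Rightarrow> 'a set \<Rightarrow> ('a \<Rightarrow> 'b \<Rightarrow> complex) \<Rightarrow> real \<Rightarrow> bool" where
  "bessel D S a c \<longleftrightarrow>
     (\<forall>y. (\<Sum>i\<in>S. (cmod (\<Sum>d\<in>D. a i d * y d))\<^sup>2) \<le> c * (\<Sum>d\<in>D. (cmod (y d))\<^sup>2))"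

lemma besselD:
  "bessel D S a c \<Longrightarrow> (\<Sum>i\<in>S. (cmod (\<Sum>d\<in>D. a i d * y d))\<^sup>2) \<le> c * (\<Sum>d\<in>D. (cmod (y d))\<^sup>2)"
  unfolding bessel_def by blast

lemma bessel_cong:
  "(\<And>i d. i \<in> S \<Longrightarrow> d \<in> D \<Longrightarrow> a i d = b i d) \<Longrightarrow> bessel D S a c \<longleftrightarrow> bessel D S b c"
  unfolding bessel_def by (intro iff_allI) simp

lemma bessel_mono: "bessel D S a c \<Longrightarrow> c \<le> c' \<Longrightarrow> bessel D S a c'"
  unfolding bessel_def by (meson mult_right_mono order_trans sum_nonneg zero_le_power2)

lemma bessel_subset:
  assumes "bessel D S a c" "T \<subseteq> S" "finite S"
  shows "bessel D T a c"
  unfolding bessel_def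
proof
  fix y
  have "(\<Sum>i\<in>T. (cmod (\<Sum>d\<in>D. a i d * y d))\<^sup>2) \<le> (\<Sum>i\<in>S. (cmod (\<Sum>d\<in>D. a i d * y d))\<^sup>2)"
    using assms by (intro sum_mono2) auto
  with besselD[OF assms(1), of y]
  show "(\<Sum>i\<in>T. (cmod (\<Sum>d\<in>D. a i d * y d))\<^sup>2) \<le> c * (\<Sum>d\<in>D. (cmod (y d))\<^sup>2)"
    by simp
qed

text \<open>Let \<open>y\<close> be the adjoint applied to \<open>x\<close>, and \<open>z\<close>
  the matrix applied to \<open>y\<close>. The squared norm \<open>N\<close> of \<open>y\<close> is
  the inner product of \<open>z\<close> and \<open>x\<close>, so Cauchy-Schwarz bounds it by
  \<open>sqrt (c * N) * sqrt X\<close>. Squaring and cancelling \<open>N\<close> leaves the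
  claim.\<close>

lemma bessel_dual:
  assumes "bessel D S a c" "0 \<le> c"
  shows "bessel S D (\<lambda>d i. cnj (a i d)) c"
  unfolding bessel_def
proof
  fix x
  define y where "y d = (\<Sum>i\<in>S. cnj (a i d) * x i)" for d
  define z where "z i = (\<Sum>d\<in>D. a i d * y d)" for i
  define N where "N = (\<Sum>d\<in>D. (cmod (y d))\<^sup>2)"
  define X where "X = (\<Sum>i\<in>S. (cmod (x i))\<^sup>2)"
  have N0: "0 \<le> N" and X0: "0 \<le> X" by (simp_all add: N_def X_def sum_nonneg)
  have "complex_of_real N = (\<Sum>d\<in>D. y d * cnj (y d))"
    by (simp only: N_def of_real_sum complex_norm_square)
  also have "\<dots> = (\<Sum>d\<in>D. \<Sum>i\<in>S. y d * (a i d * cnj (x i)))"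
    by (intro sum.cong refl, subst (2) y_def) (simp add: cnj_sum sum_distrib_left)
  also have "\<dots> = (\<Sum>i\<in>S. z i * cnj (x i))"
    by (subst sum.swap) (simp add: z_def sum_distrib_left sum_distrib_right mult_ac)
  finally have "N = cmod (\<Sum>i\<in>S. z i * cnj (x i))"
    using N0 by (metis abs_of_nonneg norm_of_real)
  also have "\<dots> \<le> (\<Sum>i\<in>S. \<bar>cmod (z i)\<bar> * \<bar>cmod (x i)\<bar>)"
    by (intro order.trans[OF norm_sum] sum_mono) (simp add: norm_mult)
  also have "\<dots> \<le> L2_set (\<lambda>i. cmod (z i)) S * L2_set (\<lambda>i. cmod (x i)) S"
    by (rule L2_set_mult_ineq)
  also have "L2_set (\<lambda>i. cmod (x i)) S = sqrt X" by (simp add: L2_set_def X_def)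
  also have "L2_set (\<lambda>i. cmod (z i)) S \<le> sqrt (c * N)"
    using besselD[OF assms(1), of y] by (simp add: L2_set_def z_def N_def)
  finally have "N \<le> sqrt (c * N) * sqrt X" using X0 by (simp add: mult_right_mono)
  then have "N\<^sup>2 \<le> (c * N) * X"
    using N0 X0 assms(2) by (metis real_sqrt_mult real_sqrt_pow2 mult_nonneg_nonneg power_mono)
  then have "N * N \<le> N * (c * X)" by (simp add: power2_eq_square mult_ac)
  then have "N \<le> c * X"
    using N0 X0 assms(2) by (cases "N = 0") auto
  then show "(\<Sum>d\<in>D. (cmod (\<Sum>i\<in>S. cnj (a i d) * x i))\<^sup>2) \<le> c * (\<Sum>i\<in>S. (cmod (x i))\<^sup>2)"
    by (simp add: N_def X_def y_def)
qed

text \<open>Up to conjugation, row \<open>i\<close> is the dual matrix applied to the unit vector at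
  \<open>i\<close>.\<close>

lemma bessel_row:
  assumes "bessel D S a c" "0 \<le> c" "finite S" "i \<in> S"
  shows "(\<Sum>d\<in>D. (cmod (a i d))\<^sup>2) \<le> c"
proof -
  let ?x = "\<lambda>j. if j = i then 1 else 0 :: complex"
  have "(\<Sum>j\<in>S. cnj (a j d) * ?x j) = (\<Sum>j\<in>S. if j = i then cnj (a j d) else 0)" for d
    by (intro sum.cong) auto
  then have "(\<Sum>j\<in>S. cnj (a j d) * ?x j) = cnj (a i d)" for d using assms by simp
  moreover have "(\<Sum>j\<in>S. (cmod (?x j))\<^sup>2) = (\<Sum>j\<in>S. if j = i then 1 else 0)"
    by (intro sum.cong) auto
  then have "(\<Sum>j\<in>S. (cmod (?x j))\<^sup>2) = 1" using assms by simp
  ultimately show ?thesis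
    using besselD[OF bessel_dual[OF assms(1,2)], of ?x] by simp
qed

lemma bessel_scale:
  assumes "bessel D S a c"
  shows "bessel D S (\<lambda>i d. of_real t * a i d) (t\<^sup>2 * c)"
  unfolding bessel_def
proof
  fix y
  have "(\<Sum>i\<in>S. (cmod (\<Sum>d\<in>D. of_real t * a i d * y d))\<^sup>2)
      = t\<^sup>2 * (\<Sum>i\<in>S. (cmod (\<Sum>d\<in>D. a i d * y d))\<^sup>2)"
    by (simp add: mult.assoc norm_mult power_mult_distrib flip: sum_distrib_left)
  also have "\<dots> \<le> t\<^sup>2 * (c * (\<Sum>d\<in>D. (cmod (y d))\<^sup>2))"
    using besselD[OF assms] by (intro mult_left_mono) auto
  finally show "(\<Sum>i\<in>S. (cmod (\<Sum>d\<in>D. of_real t * a i d * y d))\<^sup>2) \<le> t\<^sup>2 * c * (\<Sum>d\<in>D. (cmod (y d))\<^sup>2)"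
    by (simp add: mult.assoc)
qed

section \<open>Colourings, their refinement and transport\<close>

definition colourable :: "nat \<Rightarrow> 'b set \<Rightarrow> 'a set \<Rightarrow> ('a \<Rightarrow> 'b \<Rightarrow> complex) \<Rightarrow> real \<Rightarrow> bool" where
  "colourable r D I a c \<longleftrightarrow>
     (\<exists>\<kappa>::'a \<Rightarrow> nat. (\<forall>i\<in>I. \<kappa> i < r) \<and> (\<forall>j<r. bessel D {i\<in>I. \<kappa> i = j} a c))"

lemma colourable_refine:
  assumes "\<forall>i\<in>I. \<kappa> i < r" "\<And>j. j < r \<Longrightarrow> colourable s D {i\<in>I. \<kappa> i = j} a c"
  shows "colourable (r * s) D I a c"
proof -
  have "\<forall>j. \<exists>\<psi>::'a \<Rightarrow> nat. j < r \<longrightarrow> (\<forall>i\<in>{i\<in>I. \<kappa> i = j}. \<psi> i < s) \<and>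
      (\<forall>u<s. bessel D {i\<in>{i\<in>I. \<kappa> i = j}. \<psi> i = u} a c)"
    using assms(2) unfolding colourable_def by blast
  from choice[OF this] obtain \<psi> :: "nat \<Rightarrow> 'a \<Rightarrow> nat" where
    "\<forall>j. j < r \<longrightarrow> (\<forall>i\<in>{i\<in>I. \<kappa> i = j}. \<psi> j i < s) \<and>
      (\<forall>u<s. bessel D {i\<in>{i\<in>I. \<kappa> i = j}. \<psi> j i = u} a c)" by blast
  then have \<psi>: "\<And>j i. j < r \<Longrightarrow> i \<in> I \<Longrightarrow> \<kappa> i = j \<Longrightarrow> \<psi> j i < s"
      "\<And>j u. j < r \<Longrightarrow> u < s \<Longrightarrow> bessel D {i\<in>{i\<in>I. \<kappa> i = j}. \<psi> j i = u} a c"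
    by simp_all
  \<comment> \<open>Both colours are stored as digits: \<open>div s\<close> recovers the outer one
    and \<open>mod s\<close> the inner one.\<close>
  define \<phi> where "\<phi> i = \<kappa> i * s + \<psi> (\<kappa> i) i" for i
  have dm: "\<phi> i div s = \<kappa> i" "\<phi> i mod s = \<psi> (\<kappa> i) i" "\<phi> i < r * s" if "i \<in> I" for i
  proof -
    have l: "\<psi> (\<kappa> i) i < s" "\<kappa> i < r" using \<psi>(1) that assms(1) by auto
    then show "\<phi> i div s = \<kappa> i" "\<phi> i mod s = \<psi> (\<kappa> i) i" by (auto simp: \<phi>_def)
    have "\<phi> i < (\<kappa> i + 1) * s" using l by (simp add: \<phi>_def)
    also have "\<dots> \<le> r * s" using l by (intro mult_right_mono) auto
    finally show "\<phi> i < r * s" .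
  qed
  have "bessel D {i\<in>I. \<phi> i = t} a c" if t: "t < r * s" for t
  proof -
    have "s > 0" using t by (cases s) auto
    then have ts: "t div s < r" "t mod s < s" using t by (auto simp: less_mult_imp_div_less)
    have "{i\<in>I. \<phi> i = t} = {i\<in>{i\<in>I. \<kappa> i = t div s}. \<psi> (t div s) i = t mod s}"
      using dm by (auto simp: \<phi>_def)
    then show ?thesis using \<psi>(2)[OF ts] by simp
  qed
  then show ?thesis unfolding colourable_def using dm(3) by blast
qed

lemma colourable_scale:
  assumes "colourable r D I a c"
  shows "colourable r D I (\<lambda>i d. of_real t * a i d) (t\<^sup>2 * c)"
  using assms bessel_scale unfolding colourable_def by blast

lemma colourable_subset:
  assumes "colourable r D I a c" "J \<subseteq> I" "finite I"
  shows "colourable r D J a c"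
proof -
  obtain \<kappa> where \<kappa>: "\<forall>i\<in>I. \<kappa> i < r" "\<forall>j<r. bessel D {i\<in>I. \<kappa> i = j} a c"
    using assms unfolding colourable_def by blast
  then have "\<forall>j<r. bessel D {i\<in>J. \<kappa> i = j} a c"
    using assms by (auto intro: bessel_subset)
  with \<kappa> assms show ?thesis unfolding colourable_def by blast
qed

lemma bessel_reindex:
  assumes "bij_betw h D' D" "inj_on g S'"
  shows "bessel D' S' (\<lambda>i d. a (g i) (h d)) c \<longleftrightarrow> bessel D (g ` S') a c"
proof -
  have row: "(\<Sum>d\<in>D'. a i (h d) * y (h d)) = (\<Sum>d\<in>D. a i d * y d)" for i y
    by (rule sum.reindex_bij_betw[OF assms(1), of "\<lambda>d. a i d * y d"])
  have nrm: "(\<Sum>d\<in>D'. (cmod (y (h d)))\<^sup>2) = (\<Sum>d\<in>D. (cmod (y d))\<^sup>2)" for y :: "_ \<Rightarrow> complex"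
    by (rule sum.reindex_bij_betw[OF assms(1), of "\<lambda>d. (cmod (y d))\<^sup>2"])
  define k where "k = inv_into D' h"
  have k: "k (h d) = d" if "d \<in> D'" for d
    using assms(1) that by (auto simp: k_def bij_betw_def)
  show ?thesis
  proof
    assume L: "bessel D' S' (\<lambda>i d. a (g i) (h d)) c"
    show "bessel D (g ` S') a c"
      unfolding bessel_def sum.reindex[OF assms(2)] o_def
    proof
      fix y
      show "(\<Sum>i\<in>S'. (cmod (\<Sum>d\<in>D. a (g i) d * y d))\<^sup>2) \<le> c * (\<Sum>d\<in>D. (cmod (y d))\<^sup>2)"
        using besselD[OF L, of "\<lambda>d. y (h d)"] by (simp only: row nrm)
    qed
  next
    assume R: "bessel D (g ` S') a c"
    show "bessel D' S' (\<lambda>i d. a (g i) (h d)) c"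
      unfolding bessel_def
    proof
      fix y :: "_ \<Rightarrow> complex"
      have 1: "(\<Sum>d\<in>D'. a (g i) (h d) * y d) = (\<Sum>d\<in>D. a (g i) d * y (k d))" for i
        unfolding row[symmetric] by (intro sum.cong) (auto simp: k)
      have 2: "(\<Sum>d\<in>D'. (cmod (y d))\<^sup>2) = (\<Sum>d\<in>D. (cmod (y (k d)))\<^sup>2)"
        unfolding nrm[of "\<lambda>d. y (k d)", symmetric] by (intro sum.cong) (auto simp: k)
      show "(\<Sum>i\<in>S'. (cmod (\<Sum>d\<in>D'. a (g i) (h d) * y d))\<^sup>2) \<le> c * (\<Sum>d\<in>D'. (cmod (y d))\<^sup>2)"
        using besselD[OF R, of "\<lambda>d. y (k d)"]
        by (simp only: 1 2 sum.reindex[OF assms(2)] o_def)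
    qed
  qed
qed

lemma colourable_reindex:
  assumes "bij_betw h D' D" "bij_betw g I' I" "colourable r D' I' (\<lambda>i d. a (g i) (h d)) c"
  shows "colourable r D I a c"
proof -
  obtain \<kappa> where \<kappa>: "\<forall>i\<in>I'. \<kappa> i < r" "\<forall>j<r. bessel D' {i\<in>I'. \<kappa> i = j} (\<lambda>i d. a (g i) (h d)) c"
    using assms(3) unfolding colourable_def by blast
  define \<phi> where "\<phi> i = \<kappa> (inv_into I' g i)" for i
  have inj: "inj_on g I'" and im: "g ` I' = I" using assms(2) by (auto simp: bij_betw_def)
  have \<phi>: "\<phi> (g i) = \<kappa> i" if "i \<in> I'" for i
    using inj that by (simp add: \<phi>_def)
  show ?thesis
    unfolding colourable_def
  proof (intro exI[of _ \<phi>] conjI ballI allI impI)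
    fix i assume "i \<in> I"
    then show "\<phi> i < r" using \<kappa>(1) \<phi> im by force
  next
    fix j assume "j < r"
    have "g ` {i\<in>I'. \<kappa> i = j} = {i\<in>I. \<phi> i = j}" using \<phi> im by force
    moreover have "inj_on g {i\<in>I'. \<kappa> i = j}" using inj by (auto simp: inj_on_def)
    ultimately show "bessel D {i\<in>I. \<phi> i = j} a c"
      using bessel_reindex[OF assms(1), of g "{i\<in>I'. \<kappa> i = j}" a c] \<kappa>(2) \<open>j < r\<close> by simp
  qed
qed

section \<open>Dilation to isometries\<close>

lemma gram_complement:
  assumes "finite D" "bessel D I a 1"
  shows "\<exists>b. \<forall>y. (\<Sum>i\<in>I. (cmod (\<Sum>d\<in>D. a i d * y d))\<^sup>2)
           + (\<Sum>e\<in>D. (cmod (\<Sum>d\<in>D. b e d * y d))\<^sup>2) = (\<Sum>d\<in>D. (cmod (y d))\<^sup>2)"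
proof -
  \<comment> \<open>This is the identity minus the Gram matrix of the columns, positive because
    \<open>a\<close> is a contraction. A factor \<open>b\<close> of it, stacked under
    \<open>a\<close>, gives an isometry.\<close>
  define K where "K d d' = (if d = d' then 1 else 0) - (\<Sum>i\<in>I. cnj (a i d) * a i d')" for d d'
  have Kq: "(\<Sum>d\<in>D. \<Sum>d'\<in>D. cnj (y d) * K d d' * y d')
      = of_real ((\<Sum>d\<in>D. (cmod (y d))\<^sup>2) - (\<Sum>i\<in>I. (cmod (\<Sum>d\<in>D. a i d * y d))\<^sup>2))" for y
  proof -
    have "(\<Sum>d'\<in>D. cnj (y d) * (if d = d' then 1 else 0) * y d') = cnj (y d) * y d" if "d \<in> D" for d
    proof -
      have "(\<Sum>d'\<in>D. cnj (y d) * (if d = d' then 1 else 0) * y d') = (\<Sum>d'\<in>D. if d = d' then cnj (y d) * y d' else 0)"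
        by (intro sum.cong) auto
      then show ?thesis using that assms by simp
    qed
    then have "(\<Sum>d\<in>D. \<Sum>d'\<in>D. cnj (y d) * (if d = d' then 1 else 0) * y d') = of_real (\<Sum>d\<in>D. (cmod (y d))\<^sup>2)"
      by (simp only: of_real_sum complex_norm_square mult.commute[of "y _"] cong: sum.cong)
    then show ?thesis
      unfolding of_real_diff gram_quadratic_form[symmetric] K_def
      by (simp add: right_diff_distrib left_diff_distrib sum_subtractf)
  qed
  have "psd_on D K"
    unfolding psd_on_def
  proof (intro conjI ballI allI)
    fix i j show "K j i = cnj (K i j)" by (simp add: K_def mult.commute)
    fix y
    show "0 \<le> Re (\<Sum>d\<in>D. \<Sum>d'\<in>D. cnj (y d) * K d d' * y d')"
      unfolding Kq using besselD[OF assms(2), of y] by simp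
  qed
  from psd_on_factor[OF assms(1) this] obtain b
    where b: "\<forall>i\<in>D. \<forall>j\<in>D. K i j = (\<Sum>e\<in>D. cnj (b e i) * b e j)" by blast
  show ?thesis
  proof (intro exI[of _ b] allI)
    fix y
    have "(\<Sum>d\<in>D. \<Sum>d'\<in>D. cnj (y d) * K d d' * y d')
        = (\<Sum>d\<in>D. \<Sum>d'\<in>D. cnj (y d) * (\<Sum>e\<in>D. cnj (b e d) * b e d') * y d')"
      using b by (intro sum.cong) auto
    then have "complex_of_real (\<Sum>e\<in>D. (cmod (\<Sum>d\<in>D. b e d * y d))\<^sup>2)
       = of_real ((\<Sum>d\<in>D. (cmod (y d))\<^sup>2) - (\<Sum>i\<in>I. (cmod (\<Sum>d\<in>D. a i d * y d))\<^sup>2))"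
      unfolding gram_quadratic_form Kq by simp
    then have "(\<Sum>e\<in>D. (cmod (\<Sum>d\<in>D. b e d * y d))\<^sup>2)
       = (\<Sum>d\<in>D. (cmod (y d))\<^sup>2) - (\<Sum>i\<in>I. (cmod (\<Sum>d\<in>D. a i d * y d))\<^sup>2)"
      by (simp only: of_real_eq_iff)
    then show "(\<Sum>i\<in>I. (cmod (\<Sum>d\<in>D. a i d * y d))\<^sup>2)
           + (\<Sum>e\<in>D. (cmod (\<Sum>d\<in>D. b e d * y d))\<^sup>2) = (\<Sum>d\<in>D. (cmod (y d))\<^sup>2)" by simp
  qed
qed

definition isometric :: "'b set \<Rightarrow> 'a set \<Rightarrow> ('a \<Rightarrow> 'b \<Rightarrow> complex) \<Rightarrow> bool" where
  "isometric D I w \<longleftrightarrow>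
     (\<forall>y. (\<Sum>i\<in>I. (cmod (\<Sum>d\<in>D. w i d * y d))\<^sup>2) = (\<Sum>d\<in>D. (cmod (y d))\<^sup>2))"

text \<open>An isometry times its adjoint is a projection with the squared row norms on its
  diagonal, so this is the finite statement extracted from weak paveability. Indices are natural
  numbers so that a counterexample is a single matrix; \<open>small_rows_colourableD\<close> moves
  the property to arbitrary finite index sets.\<close>

definition small_rows_colourable :: "nat \<Rightarrow> bool" where
  "small_rows_colourable k \<longleftrightarrow>
     (\<forall>n m (w :: nat \<Rightarrow> nat \<Rightarrow> complex). isometric {..<m} {..<n} w \<longrightarrow>
        (\<forall>i<n. (\<Sum>d<m. (cmod (w i d))\<^sup>2) \<le> 1 / real k) \<longrightarrow>
        colourable k {..<m} {..<n} w (1 - 1 / real k))"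

lemma small_rows_colourableD:
  fixes w :: "'a \<Rightarrow> 'b \<Rightarrow> complex"
  assumes "small_rows_colourable k" "finite D" "finite I" "isometric D I w"
    "\<And>i. i \<in> I \<Longrightarrow> (\<Sum>d\<in>D. (cmod (w i d))\<^sup>2) \<le> 1 / real k"
  shows "colourable k D I w (1 - 1 / real k)"
proof -
  obtain h where h: "bij_betw h {..<card D} D"
    using ex_bij_betw_nat_finite[OF assms(2)] by (auto simp: atLeast0LessThan)
  obtain g where g: "bij_betw g {..<card I} I"
    using ex_bij_betw_nat_finite[OF assms(3)] by (auto simp: atLeast0LessThan)
  define w' where "w' i d = w (g i) (h d)" for i d
  have "isometric {..<card D} {..<card I} w'"
    unfolding isometric_def
  proof
    fix y :: "nat \<Rightarrow> complex"
    define k where "k = inv_into {..<card D} h"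
    have k: "k (h d) = d" if "d < card D" for d
      using h that by (auto simp: k_def bij_betw_def)
    have 1: "(\<Sum>d<card D. w' i d * y d) = (\<Sum>d\<in>D. w (g i) d * y (k d))" for i
      unfolding w'_def sum.reindex_bij_betw[OF h, symmetric] by (intro sum.cong) (auto simp: k)
    have 2: "(\<Sum>d<card D. (cmod (y d))\<^sup>2) = (\<Sum>d\<in>D. (cmod (y (k d)))\<^sup>2)"
      unfolding sum.reindex_bij_betw[OF h, symmetric] by (intro sum.cong) (auto simp: k)
    show "(\<Sum>i<card I. (cmod (\<Sum>d<card D. w' i d * y d))\<^sup>2) = (\<Sum>d<card D. (cmod (y d))\<^sup>2)"
      unfolding 1 2 using assms(4) 
        sum.reindex_bij_betw[OF g, of "\<lambda>i. (cmod (\<Sum>d\<in>D. w i d * y (k d)))\<^sup>2"]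
      by (simp add: isometric_def)
  qed
  moreover have "(\<Sum>d<card D. (cmod (w' i d))\<^sup>2) \<le> 1 / real k" if "i < card I" for i
    using assms(5)[of "g i"] that g sum.reindex_bij_betw[OF h, of "\<lambda>d. (cmod (w (g i) d))\<^sup>2"]
    by (auto simp: w'_def bij_betw_def)
  ultimately have "colourable k {..<card D} {..<card I} w' (1 - 1 / real k)"
    using assms(1) unfolding small_rows_colourable_def by blast
  then show ?thesis unfolding w'_def by (rule colourable_reindex[OF h g])
qed

text \<open>Completing \<open>a\<close> to an isometry by \<open>k\<close> copies of a defect operator, each scaled by
  \<open>1 / sqrt k\<close>, keeps the rows small.\<close>

lemma small_rows_contraction:
  fixes a :: "'a \<Rightarrow> 'b \<Rightarrow> complex"
  assumes "small_rows_colourable k" "0 < k" "finite D" "finite I" "bessel D I a 1"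
    "\<And>i. i \<in> I \<Longrightarrow> (\<Sum>d\<in>D. (cmod (a i d))\<^sup>2) \<le> 1 / real k"
  shows "colourable k D I a (1 - 1 / real k)"
proof -
  obtain b where b: "\<And>y. (\<Sum>i\<in>I. (cmod (\<Sum>d\<in>D. a i d * y d))\<^sup>2)
           + (\<Sum>e\<in>D. (cmod (\<Sum>d\<in>D. b e d * y d))\<^sup>2) = (\<Sum>d\<in>D. (cmod (y d))\<^sup>2)"
    using gram_complement[OF assms(3,5)] by blast
  define t where "t = 1 / sqrt (real k)"
  have t2: "real k * t\<^sup>2 = 1" "t\<^sup>2 = 1 / real k" using assms(2) by (auto simp: t_def power_divide)
  have "bessel D D b 1"
    unfolding bessel_def
  proof
    fix y show "(\<Sum>e\<in>D. (cmod (\<Sum>d\<in>D. b e d * y d))\<^sup>2) \<le> 1 * (\<Sum>d\<in>D. (cmod (y d))\<^sup>2)"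
      unfolding b[of y, symmetric] by (simp add: sum_nonneg)
  qed
  then have brow: "(\<Sum>d\<in>D. (cmod (b e d))\<^sup>2) \<le> 1" if "e \<in> D" for e
    using bessel_row[of D D b 1 e] assms that by simp
  define w where "w = case_sum a (\<lambda>(e, l::nat) d. of_real t * b e d)"
  define J where "J = D \<times> {..<k}"
  have fin: "finite (Inl ` I \<union> Inr ` J)" using assms by (simp add: J_def)
  have "isometric D (Inl ` I \<union> Inr ` J) w"
    unfolding isometric_def
  proof
    fix y
    have "(\<Sum>i\<in>Inl ` I \<union> Inr ` J. (cmod (\<Sum>d\<in>D. w i d * y d))\<^sup>2)
       = (\<Sum>i\<in>I. (cmod (\<Sum>d\<in>D. a i d * y d))\<^sup>2)
        + (\<Sum>(e, l)\<in>J. (cmod (\<Sum>d\<in>D. of_real t * b e d * y d))\<^sup>2)"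
      using assms by (subst sum.union_disjoint)
        (auto simp: J_def sum.reindex w_def split_def o_def)
    also have "(\<Sum>(e, l)\<in>J. (cmod (\<Sum>d\<in>D. of_real t * b e d * y d))\<^sup>2)
       = (\<Sum>e\<in>D. real k * (t\<^sup>2 * (cmod (\<Sum>d\<in>D. b e d * y d))\<^sup>2))"
      unfolding J_def sum.cartesian_product[symmetric]
      by (simp add: mult.assoc norm_mult power_mult_distrib flip: sum_distrib_left)
    also have "\<dots> = (\<Sum>e\<in>D. (cmod (\<Sum>d\<in>D. b e d * y d))\<^sup>2)"
      using t2(1) by (simp flip: mult.assoc)
    finally show "(\<Sum>i\<in>Inl ` I \<union> Inr ` J. (cmod (\<Sum>d\<in>D. w i d * y d))\<^sup>2) = (\<Sum>d\<in>D. (cmod (y d))\<^sup>2)"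
      using b[of y] by simp
  qed
  moreover have "(\<Sum>d\<in>D. (cmod (w i d))\<^sup>2) \<le> 1 / real k" if "i \<in> Inl ` I \<union> Inr ` J" for i
    using that
  proof
    assume "i \<in> Inr ` J"
    then obtain e l where i: "i = Inr (e, l)" "e \<in> D" by (auto simp: J_def)
    have "(\<Sum>d\<in>D. (cmod (w i d))\<^sup>2) = t\<^sup>2 * (\<Sum>d\<in>D. (cmod (b e d))\<^sup>2)"
      by (simp add: i w_def norm_mult power_mult_distrib sum_distrib_left)
    also have "\<dots> \<le> t\<^sup>2 * 1" using brow[OF i(2)] by (intro mult_left_mono) auto
    finally show ?thesis using t2 by simp
  qed (use assms(6) in \<open>auto simp: w_def\<close>)
  ultimately have "colourable k D (Inl ` I \<union> Inr ` J) w (1 - 1 / real k)"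
    using small_rows_colourableD[OF assms(1,3) fin] by blast
  then have "colourable k D (Inl ` I) w (1 - 1 / real k)"
    by (rule colourable_subset) (use fin in auto)
  then obtain \<kappa> where \<kappa>: "\<forall>i\<in>Inl ` I. \<kappa> i < k"
      "\<forall>j<k. bessel D {i\<in>Inl ` I. \<kappa> i = j} w (1 - 1 / real k)"
    unfolding colourable_def by blast
  have "bessel D {i\<in>I. \<kappa> (Inl i) = j} a (1 - 1 / real k)" if "j < k" for j
  proof -
    have "Inl ` {i\<in>I. \<kappa> (Inl i) = j} = {i\<in>Inl ` I. \<kappa> i = j}" by auto
    then show ?thesis
      using \<kappa>(2) that bessel_reindex[of id D D Inl "{i\<in>I. \<kappa> (Inl i) = j}" w "1 - 1 / real k"]
      by (simp add: w_def)
  qed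
  with \<kappa>(1) show ?thesis unfolding colourable_def by (intro exI[of _ "\<lambda>i. \<kappa> (Inl i)"]) auto
qed

text \<open>As long as the Bessel bound exceeds \<open>k\<close>, rescaling makes the rows small, so that the bound
  drops by a factor \<open>1 - 1 / k\<close>.\<close>

lemma colourable_power:
  fixes a :: "'a \<Rightarrow> 'b \<Rightarrow> complex"
  assumes "small_rows_colourable k" "2 \<le> k" "finite D" "finite I" "bessel D I a B"
    "B * (1 - 1 / real k) ^ m \<le> real k"
    "\<And>i. i \<in> I \<Longrightarrow> (\<Sum>d\<in>D. (cmod (a i d))\<^sup>2) \<le> 1"
  shows "colourable (k ^ m) D I a (real k)"
  using assms(4-7)
proof (induction m arbitrary: B I)
  case 0
  have "{i\<in>I. (0::nat) = 0} = I" by simp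
  then show ?case using bessel_mono[OF "0.prems"(2), of "real k"] 0
    unfolding colourable_def by (intro exI[of _ "\<lambda>_. 0::nat"]) auto
next
  case (Suc m)
  show ?case
  proof (cases "B \<le> real k")
    case True
    have "{i\<in>I. (0::nat) = j} = (if j = 0 then I else {})" for j by auto
    moreover have "bessel D I a k" "bessel D {} a k"
      using bessel_mono[OF Suc.prems(2) True] bessel_subset[OF _ _ Suc.prems(1)] by auto
    ultimately show ?thesis using assms(2)
      unfolding colourable_def by (intro exI[of _ "\<lambda>_. 0::nat"]) auto
  next
    case False
    then have B: "B > real k" "B > 0" using assms(2) by auto
    define t where "t = 1 / sqrt B"
    have t2: "t\<^sup>2 = 1 / B" using B by (simp add: t_def power_divide)
    have "bessel D I (\<lambda>i d. of_real t * a i d) 1"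
      using bessel_scale[OF Suc.prems(2), of t] t2 B by simp
    moreover have "(\<Sum>d\<in>D. (cmod (of_real t * a i d))\<^sup>2) \<le> 1 / real k" if "i \<in> I" for i
    proof -
      have "(\<Sum>d\<in>D. (cmod (of_real t * a i d))\<^sup>2) = t\<^sup>2 * (\<Sum>d\<in>D. (cmod (a i d))\<^sup>2)"
        by (simp add: norm_mult power_mult_distrib sum_distrib_left)
      also have "\<dots> \<le> t\<^sup>2 * 1" using Suc.prems(4)[OF that] by (intro mult_left_mono) auto
      also have "\<dots> \<le> 1 / real k" using t2 B assms(2) by (simp add: frac_le)
      finally show ?thesis .
    qed
    ultimately have "colourable k D I (\<lambda>i d. of_real t * a i d) (1 - 1 / real k)"
      using small_rows_contraction[of k D I "\<lambda>i d. of_real t * a i d"] assms Suc.prems by auto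
    from colourable_scale[OF this, of "sqrt B"]
    have "colourable k D I a (B * (1 - 1 / real k))"
      using B by (simp add: t_def flip: mult.assoc of_real_mult)
    then obtain \<kappa> where \<kappa>: "\<forall>i\<in>I. \<kappa> i < k" "\<And>j. j < k \<Longrightarrow> bessel D {i\<in>I. \<kappa> i = j} a (B * (1 - 1 / real k))"
      unfolding colourable_def by blast
    have "colourable (k ^ m) D {i\<in>I. \<kappa> i = j} a (real k)" if "j < k" for j
      using \<kappa>(2)[OF that] Suc.prems by (intro Suc.IH[of _ "B * (1 - 1 / real k)"]) (auto simp: mult_ac)
    from colourable_refine[OF \<kappa>(1) this] show ?thesis by simp
  qed
qed

text \<open>The number \<open>r\<close> may depend on \<open>B\<close>, but not on the sizes of the
  index sets. This independence is what later allows pavings of all coordinates to be glued.\<close>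

definition uniformly_colourable :: "real \<Rightarrow> bool" where
  "uniformly_colourable c \<longleftrightarrow>
     (\<forall>B. \<exists>r. \<forall>(I :: nat set) (D :: nat set) a. finite I \<longrightarrow> finite D \<longrightarrow> bessel D I a B \<longrightarrow>
        (\<forall>i\<in>I. (\<Sum>d\<in>D. (cmod (a i d))\<^sup>2) \<le> 1) \<longrightarrow> colourable r D I a c)"

lemma small_rows_imp_uniformly_colourable:
  assumes "small_rows_colourable k" "2 \<le> k"
  shows "uniformly_colourable (real k)"
  unfolding uniformly_colourable_def
proof
  fix B
  \<comment> \<open>The number \<open>m\<close> of rounds is read off from this geometric decay and
    depends on \<open>B\<close> and \<open>k\<close> alone.\<close>
  have "(\<lambda>m. B * (1 - 1 / real k) ^ m) \<longlonglongrightarrow> B * 0"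
    using assms(2) by (intro tendsto_mult tendsto_const LIMSEQ_power_zero) auto
  moreover have "B * 0 < real k" using assms(2) by simp
  ultimately have "eventually (\<lambda>m. B * (1 - 1 / real k) ^ m < real k) sequentially"
    using order_tendstoD(2) by blast
  then obtain m where "B * (1 - 1 / real k) ^ m \<le> real k"
    using eventually_happens' sequentially_bot less_imp_le by blast
  then show "\<exists>r. \<forall>(I :: nat set) (D :: nat set) a. finite I \<longrightarrow> finite D \<longrightarrow> bessel D I a B \<longrightarrow>
        (\<forall>i\<in>I. (\<Sum>d\<in>D. (cmod (a i d))\<^sup>2) \<le> 1) \<longrightarrow> colourable r D I a (real k)"
    using colourable_power[OF assms] by blast
qed

text \<open>The tensor argument uses pairs as indices, so the property is transported along
  bijections with initial segments.\<close>

lemma uniformly_colourableD: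
  assumes "uniformly_colourable c"
  shows "\<exists>r. \<forall>(I :: 'a set) (D :: 'b set) a. finite I \<longrightarrow> finite D \<longrightarrow> bessel D I a B \<longrightarrow>
        (\<forall>i\<in>I. (\<Sum>d\<in>D. (cmod (a i d))\<^sup>2) \<le> 1) \<longrightarrow> colourable r D I a c"
proof -
  obtain r where r: "\<And>(I :: nat set) (D :: nat set) a. finite I \<Longrightarrow> finite D \<Longrightarrow> bessel D I a B \<Longrightarrow>
        (\<forall>i\<in>I. (\<Sum>d\<in>D. (cmod (a i d))\<^sup>2) \<le> 1) \<Longrightarrow> colourable r D I a c"
    using assms unfolding uniformly_colourable_def by blast
  show ?thesis
  proof (intro exI[of _ r] allI impI)
    fix I :: "'a set" and D :: "'b set" and a
    assume fin: "finite I" "finite D" and a: "bessel D I a B" "\<forall>i\<in>I. (\<Sum>d\<in>D. (cmod (a i d))\<^sup>2) \<le> 1"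
    obtain h where h: "bij_betw h {..<card D} D"
      using ex_bij_betw_nat_finite[OF fin(2)] by (auto simp: atLeast0LessThan)
    obtain g where g: "bij_betw g {..<card I} I"
      using ex_bij_betw_nat_finite[OF fin(1)] by (auto simp: atLeast0LessThan)
    have "colourable r {..<card D} {..<card I} (\<lambda>i d. a (g i) (h d)) c"
    proof (rule r)
      show "bessel {..<card D} {..<card I} (\<lambda>i d. a (g i) (h d)) B"
        using bessel_reindex[OF h, of g "{..<card I}" a B] g a(1) by (auto simp: bij_betw_def)
      show "\<forall>i\<in>{..<card I}. (\<Sum>d<card D. (cmod (a (g i) (h d)))\<^sup>2) \<le> 1"
        using a(2) g sum.reindex_bij_betw[OF h, of "\<lambda>d. (cmod (a (g _) d))\<^sup>2"] by (auto simp: bij_betw_def)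
    qed auto
    then show "colourable r D I a c" by (rule colourable_reindex[OF h g])
  qed
qed

section \<open>Tensor products and paving\<close>

text \<open>The tensor product acts in one coordinate at a time: \<open>a\<close> on the first gives
  \<open>z\<close>, then \<open>b\<close> acts on the second, and each bound is applied
  separately.\<close>

lemma bessel_tensor:
  assumes "bessel D I a A" "bessel E J b B" "0 \<le> B"
  shows "bessel (D \<times> E) (I \<times> J) (\<lambda>(i, j) (d, e). a i d * b j e) (A * B)"
  unfolding bessel_def
proof
  fix y :: "'a \<times> 'c \<Rightarrow> complex"
  define z where "z i e = (\<Sum>d\<in>D. a i d * y (d, e))" for i e
  have row: "(\<Sum>x\<in>D \<times> E. (case (i, j) of (i, j) \<Rightarrow> \<lambda>(d, e). a i d * b j e) x * y x)
      = (\<Sum>e\<in>E. b j e * z i e)" for i j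
  proof -
    have "(\<Sum>x\<in>D \<times> E. (case (i, j) of (i, j) \<Rightarrow> \<lambda>(d, e). a i d * b j e) x * y x)
        = (\<Sum>d\<in>D. \<Sum>e\<in>E. a i d * b j e * y (d, e))"
      by (subst sum.cartesian_product) (simp add: split_def)
    also have "\<dots> = (\<Sum>e\<in>E. \<Sum>d\<in>D. a i d * b j e * y (d, e))" by (rule sum.swap)
    finally show ?thesis by (simp add: z_def sum_distrib_left mult_ac)
  qed
  have "(\<Sum>p\<in>I \<times> J. (cmod (\<Sum>x\<in>D \<times> E. (case p of (i, j) \<Rightarrow> \<lambda>(d, e). a i d * b j e) x * y x))\<^sup>2)
      = (\<Sum>(i, j)\<in>I \<times> J. (cmod (\<Sum>e\<in>E. b j e * z i e))\<^sup>2)"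
    by (intro sum.cong refl) (auto simp: row[simplified])
  also have "\<dots> = (\<Sum>i\<in>I. \<Sum>j\<in>J. (cmod (\<Sum>e\<in>E. b j e * z i e))\<^sup>2)"
    by (rule sum.cartesian_product[symmetric])
  also have "\<dots> \<le> (\<Sum>i\<in>I. B * (\<Sum>e\<in>E. (cmod (z i e))\<^sup>2))"
    by (intro sum_mono besselD[OF assms(2)])
  also have "\<dots> = B * (\<Sum>e\<in>E. \<Sum>i\<in>I. (cmod (z i e))\<^sup>2)"
    by (subst sum.swap) (simp add: sum_distrib_left)
  also have "\<dots> \<le> B * (\<Sum>e\<in>E. A * (\<Sum>d\<in>D. (cmod (y (d, e)))\<^sup>2))"
    unfolding z_def by (intro mult_left_mono sum_mono besselD[OF assms(1)] assms(3))
  also have "(\<Sum>e\<in>E. A * (\<Sum>d\<in>D. (cmod (y (d, e)))\<^sup>2)) = A * (\<Sum>d\<in>D. \<Sum>e\<in>E. (cmod (y (d, e)))\<^sup>2)"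
    by (subst sum_distrib_left[symmetric], subst sum.swap, rule refl)
  also have "(\<Sum>d\<in>D. \<Sum>e\<in>E. (cmod (y (d, e)))\<^sup>2) = (\<Sum>x\<in>D \<times> E. (cmod (y x))\<^sup>2)"
    by (subst sum.cartesian_product) (simp add: split_def)
  finally show "(\<Sum>p\<in>I \<times> J. (cmod (\<Sum>x\<in>D \<times> E. (case p of (i, j) \<Rightarrow> \<lambda>(d, e). a i d * b j e) x * y x))\<^sup>2)
      \<le> A * B * (\<Sum>x\<in>D \<times> E. (cmod (y x))\<^sup>2)"
    by (simp add: mult_ac)
qed

text \<open>Bad examples multiply: if \<open>b\<close> admits no good colouring with \<open>s\<close> colours and \<open>a\<close> none with as
  many colours as there are \<open>s\<close>-colourings of \<open>J\<close>, then an \<open>s\<close>-colouring of \<open>I \<times> J\<close> colours each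
  fibre over \<open>i\<close> by a colouring of \<open>J\<close>, which in turn is a colour of \<open>i\<close>.\<close>

lemma not_colourable_tensor:
  assumes fin: "finite I" "finite J" and c: "0 \<le> c"
    and a: "\<not> colourable (card (J \<rightarrow>\<^sub>E {..<s})) D I a c" and b: "\<not> colourable s E J b c"
  shows "\<not> colourable s (D \<times> E) (I \<times> J) (\<lambda>(i, j) (d, e). a i d * b j e) (c\<^sup>2)"
proof
  define R where "R = card (J \<rightarrow>\<^sub>E {..<s})"
  assume "colourable s (D \<times> E) (I \<times> J) (\<lambda>(i, j) (d, e). a i d * b j e) (c\<^sup>2)"
  then obtain \<kappa> where \<kappa>: "\<forall>p\<in>I \<times> J. \<kappa> p < s"
    "\<forall>t<s. bessel (D \<times> E) {p\<in>I \<times> J. \<kappa> p = t} (\<lambda>(i, j) (d, e). a i d * b j e) (c\<^sup>2)"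
    unfolding colourable_def by blast
  have "finite (J \<rightarrow>\<^sub>E {..<s})" using fin by (intro finite_PiE) auto
  then obtain enc where enc: "bij_betw enc (J \<rightarrow>\<^sub>E {..<s}) {..<R}"
    using ex_bij_betw_finite_nat by (auto simp: R_def atLeast0LessThan)
  define \<psi> where "\<psi> i = enc (\<lambda>j\<in>J. \<kappa> (i, j))" for i
  have mem: "(\<lambda>j\<in>J. \<kappa> (i, j)) \<in> J \<rightarrow>\<^sub>E {..<s}" if "i \<in> I" for i using that \<kappa>(1) by auto
  then have "\<forall>i\<in>I. \<psi> i < R" using enc by (force simp: \<psi>_def bij_betw_def)
  then obtain u where u: "\<not> bessel D {i\<in>I. \<psi> i = u} a c"
    using a unfolding colourable_def R_def by blast
  define I' where "I' = {i\<in>I. \<psi> i = u}"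
  obtain y where y: "(\<Sum>i\<in>I'. (cmod (\<Sum>d\<in>D. a i d * y d))\<^sup>2) > c * (\<Sum>d\<in>D. (cmod (y d))\<^sup>2)"
    using u unfolding bessel_def I'_def by (auto simp: not_le)
  have y0: "0 \<le> c * (\<Sum>d\<in>D. (cmod (y d))\<^sup>2)" using c by (simp add: sum_nonneg)
  then have "I' \<noteq> {}" using y by auto
  then obtain i0 where i0: "i0 \<in> I'" by blast
  define \<phi> where "\<phi> j = \<kappa> (i0, j)" for j
  have same: "\<kappa> (i, j) = \<phi> j" if "i \<in> I'" "j \<in> J" for i j
  proof -
    have "enc (\<lambda>j\<in>J. \<kappa> (i, j)) = enc (\<lambda>j\<in>J. \<kappa> (i0, j))"
      using that(1) i0 by (simp add: I'_def \<psi>_def)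
    then have "(\<lambda>j\<in>J. \<kappa> (i, j)) = (\<lambda>j\<in>J. \<kappa> (i0, j))"
      using that(1) i0 by (intro inj_onD[OF bij_betw_imp_inj_on[OF enc]] mem) (auto simp: I'_def)
    then show ?thesis using that(2) by (metis \<phi>_def restrict_apply)
  qed
  have "\<forall>j\<in>J. \<phi> j < s" using \<kappa>(1) i0 by (auto simp: \<phi>_def I'_def)
  then obtain t where t: "t < s" "\<not> bessel E {j\<in>J. \<phi> j = t} b c"
    using b unfolding colourable_def by blast
  define J' where "J' = {j\<in>J. \<phi> j = t}"
  obtain z where z: "(\<Sum>j\<in>J'. (cmod (\<Sum>e\<in>E. b j e * z e))\<^sup>2) > c * (\<Sum>e\<in>E. (cmod (z e))\<^sup>2)"
    using t(2) unfolding bessel_def J'_def by (auto simp: not_le)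
  have z0: "0 \<le> c * (\<Sum>e\<in>E. (cmod (z e))\<^sup>2)" using c by (simp add: sum_nonneg)
  have "I' \<times> J' \<subseteq> {p\<in>I \<times> J. \<kappa> p = t}" using same by (auto simp: I'_def J'_def)
  then have "bessel (D \<times> E) (I' \<times> J') (\<lambda>(i, j) (d, e). a i d * b j e) (c\<^sup>2)"
    by (rule bessel_subset[OF \<kappa>(2)[rule_format, OF t(1)]]) (use fin in simp)
  \<comment> \<open>The elementary tensor of the two violating vectors tests the block; both sides
    factor, and the product of two strict violations of \<open>c\<close> violates
    \<open>c\<^sup>2\<close>.\<close>
  from besselD[OF this, of "\<lambda>(d, e). y d * z e"]
  have "(\<Sum>p\<in>I' \<times> J'. (cmod (\<Sum>x\<in>D \<times> E. (case p of (i, j) \<Rightarrow> \<lambda>(d, e). a i d * b j e) x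
            * (case x of (d, e) \<Rightarrow> y d * z e)))\<^sup>2)
      \<le> c\<^sup>2 * (\<Sum>x\<in>D \<times> E. (cmod (case x of (d, e) \<Rightarrow> y d * z e))\<^sup>2)" .
  also have "(\<Sum>x\<in>D \<times> E. (cmod (case x of (d, e) \<Rightarrow> y d * z e))\<^sup>2)
      = (\<Sum>d\<in>D. (cmod (y d))\<^sup>2) * (\<Sum>e\<in>E. (cmod (z e))\<^sup>2)"
    unfolding sum_product sum.cartesian_product
    by (intro sum.cong) (auto simp: norm_mult power_mult_distrib)
  also have "(\<Sum>p\<in>I' \<times> J'. (cmod (\<Sum>x\<in>D \<times> E. (case p of (i, j) \<Rightarrow> \<lambda>(d, e). a i d * b j e) x
            * (case x of (d, e) \<Rightarrow> y d * z e)))\<^sup>2)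
     = (\<Sum>i\<in>I'. (cmod (\<Sum>d\<in>D. a i d * y d))\<^sup>2) * (\<Sum>j\<in>J'. (cmod (\<Sum>e\<in>E. b j e * z e))\<^sup>2)"
  proof -
    have row: "(\<Sum>x\<in>D \<times> E. (case x of (d, e) \<Rightarrow> a i d * b j e) * (case x of (d, e) \<Rightarrow> y d * z e))
       = (\<Sum>d\<in>D. a i d * y d) * (\<Sum>e\<in>E. b j e * z e)" for i j
      unfolding sum_product sum.cartesian_product by (intro sum.cong) auto
    have "(\<Sum>p\<in>I' \<times> J'. (cmod (\<Sum>x\<in>D \<times> E. (case p of (i, j) \<Rightarrow> \<lambda>(d, e). a i d * b j e) x
            * (case x of (d, e) \<Rightarrow> y d * z e)))\<^sup>2)
       = (\<Sum>(i, j)\<in>I' \<times> J'. (cmod (\<Sum>d\<in>D. a i d * y d))\<^sup>2 * (cmod (\<Sum>e\<in>E. b j e * z e))\<^sup>2)"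
      by (intro sum.cong refl) (clarsimp simp: row norm_mult power_mult_distrib)
    then show ?thesis by (simp only: sum_product sum.cartesian_product)
  qed
  finally have "(\<Sum>i\<in>I'. (cmod (\<Sum>d\<in>D. a i d * y d))\<^sup>2) * (\<Sum>j\<in>J'. (cmod (\<Sum>e\<in>E. b j e * z e))\<^sup>2)
      \<le> (c * (\<Sum>d\<in>D. (cmod (y d))\<^sup>2)) * (c * (\<Sum>e\<in>E. (cmod (z e))\<^sup>2))"
    by (simp only: power2_eq_square mult_ac)
  moreover have "(c * (\<Sum>d\<in>D. (cmod (y d))\<^sup>2)) * (c * (\<Sum>e\<in>E. (cmod (z e))\<^sup>2))
     < (\<Sum>i\<in>I'. (cmod (\<Sum>d\<in>D. a i d * y d))\<^sup>2) * (\<Sum>j\<in>J'. (cmod (\<Sum>e\<in>E. b j e * z e))\<^sup>2)"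
    using y z y0 z0 by (intro mult_strict_mono') auto
  ultimately show False by linarith
qed

text \<open>The failing bound \<open>B0\<close> works for every number of colours. Hence
  \<open>r\<close> can be fixed first for the squared bound, then \<open>b\<close> chosen bad for
  \<open>r\<close> colours, and finally \<open>a\<close> bad for as many colours as \<open>b\<close>
  has colourings.\<close>

lemma uniformly_colourable_sqrt:
  assumes "uniformly_colourable c" "0 \<le> c"
  shows "uniformly_colourable (sqrt c)"
proof (rule ccontr)
  assume "\<not> uniformly_colourable (sqrt c)"
  then obtain B0 where B0: "\<And>r. \<exists>(I :: nat set) (D :: nat set) a. finite I \<and> finite D \<and> bessel D I a B0 \<and>
        (\<forall>i\<in>I. (\<Sum>d\<in>D. (cmod (a i d))\<^sup>2) \<le> 1) \<and> \<not> colourable r D I a (sqrt c)"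
    unfolding uniformly_colourable_def not_all not_ex not_imp by iprover
  \<comment> \<open>The bound is made nonnegative for \<open>bessel_tensor\<close>.\<close>
  define B where "B = max B0 0"
  obtain r where r: "\<And>(I :: (nat \<times> nat) set) (D :: (nat \<times> nat) set) a. finite I \<Longrightarrow> finite D \<Longrightarrow>
      bessel D I a (B * B) \<Longrightarrow> (\<forall>i\<in>I. (\<Sum>d\<in>D. (cmod (a i d))\<^sup>2) \<le> 1) \<Longrightarrow> colourable r D I a c"
    using uniformly_colourableD[OF assms(1), of "B * B"] by blast
  obtain J E :: "nat set" and b where b: "finite J" "finite E" "bessel E J b B0"
      "\<forall>i\<in>J. (\<Sum>d\<in>E. (cmod (b i d))\<^sup>2) \<le> 1" "\<not> colourable r E J b (sqrt c)"
    using B0[of r] by (elim exE conjE) (rule that; assumption)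
  obtain I D :: "nat set" and a where a: "finite I" "finite D" "bessel D I a B0"
      "\<forall>i\<in>I. (\<Sum>d\<in>D. (cmod (a i d))\<^sup>2) \<le> 1"
      "\<not> colourable (card (J \<rightarrow>\<^sub>E {..<r})) D I a (sqrt c)"
    using B0[of "card (J \<rightarrow>\<^sub>E {..<r})"] by (elim exE conjE) (rule that; assumption)
  have "colourable r (D \<times> E) (I \<times> J) (\<lambda>(i, j) (d, e). a i d * b j e) c"
  proof (rule r)
    show "bessel (D \<times> E) (I \<times> J) (\<lambda>(i, j) (d, e). a i d * b j e) (B * B)"
      by (rule bessel_tensor) (auto intro: bessel_mono a b simp: B_def)
    show "\<forall>p\<in>I \<times> J. (\<Sum>x\<in>D \<times> E. (cmod ((case p of (i, j) \<Rightarrow> \<lambda>(d, e). a i d * b j e) x))\<^sup>2) \<le> 1"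
    proof clarify
      fix i j assume ij: "i \<in> I" "j \<in> J"
      have "(\<Sum>x\<in>D \<times> E. (cmod (case x of (d, e) \<Rightarrow> a i d * b j e))\<^sup>2)
         = (\<Sum>d\<in>D. (cmod (a i d))\<^sup>2) * (\<Sum>e\<in>E. (cmod (b j e))\<^sup>2)"
        unfolding sum_product sum.cartesian_product
        by (intro sum.cong) (auto simp: norm_mult power_mult_distrib)
      also have "\<dots> \<le> 1 * 1" using a(4) b(4) ij by (intro mult_mono) (auto simp: sum_nonneg)
      finally show "(\<Sum>x\<in>D \<times> E. (cmod (case x of (d, e) \<Rightarrow> a i d * b j e))\<^sup>2) \<le> 1" by simp
    qed
  qed (use a b in auto)
  moreover have "\<not> colourable r (D \<times> E) (I \<times> J) (\<lambda>(i, j) (d, e). a i d * b j e) ((sqrt c)\<^sup>2)"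
    using a b assms(2) by (intro not_colourable_tensor) auto
  ultimately show False using assms(2) by simp
qed

lemma uniformly_colourable_mono:
  assumes "uniformly_colourable c" "c \<le> c'"
  shows "uniformly_colourable c'"
proof -
  have "colourable r D I a c \<Longrightarrow> colourable r D I a c'" for r and D I :: "nat set" and a
    unfolding colourable_def using bessel_mono[OF _ assms(2)] by metis
  then show ?thesis using assms(1) unfolding uniformly_colourable_def by meson
qed

text \<open>Repeated square roots send the exponent of \<open>c\<close> to 0.\<close>

lemma uniformly_colourable_near_1:
  assumes "uniformly_colourable c" "1 \<le> c" "0 < \<eta>"
  shows "uniformly_colourable (1 + \<eta>)"
proof -
  have *: "uniformly_colourable (c powr (1 / 2 ^ m))" for m
  proof (induction m)
    case (Suc m)
    have "c powr (1 / 2 ^ Suc m) = sqrt (c powr (1 / 2 ^ m))"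
      using assms(2) by (simp add: powr_half_sqrt[symmetric] powr_powr mult.commute)
    then show ?case using uniformly_colourable_sqrt[OF Suc] by simp
  qed (use assms in simp)
  have "(\<lambda>m. c powr ((1 / 2) ^ m)) \<longlonglongrightarrow> c powr 0"
    using assms(2) by (intro tendsto_intros LIMSEQ_power_zero) auto
  moreover have "c powr 0 < 1 + \<eta>" using assms by simp
  ultimately have "eventually (\<lambda>m. c powr ((1 / 2) ^ m) < 1 + \<eta>) sequentially"
    using order_tendstoD(2) by blast
  then obtain m where "c powr ((1 / 2) ^ m) \<le> 1 + \<eta>"
    using eventually_happens' sequentially_bot less_imp_le by blast
  then show ?thesis using uniformly_colourable_mono[OF *[of m]] by (simp add: power_divide)
qed

section \<open>Paving Hermitian forms with zero diagonal\<close>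

definition quad_form :: "'a set \<Rightarrow> ('a \<Rightarrow> 'a \<Rightarrow> complex) \<Rightarrow> ('a \<Rightarrow> complex) \<Rightarrow> complex" where
  "quad_form S K y = (\<Sum>i\<in>S. \<Sum>j\<in>S. cnj (y i) * K i j * y j)"

lemma psd_on_iff_quad_form:
  "psd_on S K \<longleftrightarrow> (\<forall>i\<in>S. \<forall>j\<in>S. K j i = cnj (K i j)) \<and> (\<forall>y. 0 \<le> Re (quad_form S K y))"
  by (simp only: psd_on_def quad_form_def)

lemma quad_form_subset:
  assumes "finite S" "T \<subseteq> S"
  shows "quad_form T K y = quad_form S K (\<lambda>i. if i \<in> T then y i else 0)"
proof -
  have "quad_form S K (\<lambda>i. if i \<in> T then y i else 0)
      = (\<Sum>i\<in>S. if i \<in> T then (\<Sum>j\<in>S. if j \<in> T then cnj (y i) * K i j * y j else 0) else 0)"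
    unfolding quad_form_def by (auto intro!: sum.cong)
  also have "\<dots> = (\<Sum>i\<in>T. \<Sum>j\<in>T. cnj (y i) * K i j * y j)"
    using assms by (simp add: Int_absorb1 flip: sum.inter_restrict)
  finally show ?thesis by (simp add: quad_form_def)
qed

lemma sum_norm_subset:
  assumes "finite S" "T \<subseteq> S"
  shows "(\<Sum>i\<in>S. (cmod (if i \<in> T then y i else 0))\<^sup>2) = (\<Sum>i\<in>T. (cmod (y i))\<^sup>2)"
proof -
  have "(\<Sum>i\<in>S. (cmod (if i \<in> T then y i else 0))\<^sup>2) = (\<Sum>i\<in>S. if i \<in> T then (cmod (y i))\<^sup>2 else 0)"
    by (intro sum.cong) auto
  then show ?thesis using assms by (simp add: Int_absorb1 flip: sum.inter_restrict)
qed

text \<open>For Hermitian matrices the condition on the form is operator norm at most 1. Forms are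
  convenient here because a bound restricts to a subset by extending test vectors with
  zeros.\<close>

definition zero_diag_contraction :: "'a set \<Rightarrow> ('a \<Rightarrow> 'a \<Rightarrow> complex) \<Rightarrow> bool" where
  "zero_diag_contraction S K \<longleftrightarrow> finite S \<and> (\<forall>i\<in>S. \<forall>j\<in>S. K j i = cnj (K i j)) \<and> (\<forall>i\<in>S. K i i = 0) \<and>
     (\<forall>y. \<bar>Re (quad_form S K y)\<bar> \<le> (\<Sum>i\<in>S. (cmod (y i))\<^sup>2))"

definition paved_above :: "nat \<Rightarrow> 'a set \<Rightarrow> ('a \<Rightarrow> 'a \<Rightarrow> complex) \<Rightarrow> real \<Rightarrow> bool" where
  "paved_above r S K \<eta> \<longleftrightarrow> (\<exists>\<kappa>::'a \<Rightarrow> nat. (\<forall>i\<in>S. \<kappa> i < r) \<and>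
     (\<forall>j<r. \<forall>y. Re (quad_form {i\<in>S. \<kappa> i = j} K y) \<le> \<eta> * (\<Sum>i\<in>{i\<in>S. \<kappa> i = j}. (cmod (y i))\<^sup>2)))"

definition paved :: "nat \<Rightarrow> 'a set \<Rightarrow> ('a \<Rightarrow> 'a \<Rightarrow> complex) \<Rightarrow> real \<Rightarrow> bool" where
  "paved r S K \<eta> \<longleftrightarrow> (\<exists>\<kappa>::'a \<Rightarrow> nat. (\<forall>i\<in>S. \<kappa> i < r) \<and>
     (\<forall>j<r. \<forall>y. \<bar>Re (quad_form {i\<in>S. \<kappa> i = j} K y)\<bar> \<le> \<eta> * (\<Sum>i\<in>{i\<in>S. \<kappa> i = j}. (cmod (y i))\<^sup>2)))"

text \<open>The matrix \<open>P = 1 + K\<close> is positive with unit diagonal and norm at most 2.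
  Writing it as a Gram matrix makes the columns of \<open>b\<close> vectors of norm 1 with Bessel
  bound 2; a bound \<open>1 + \<eta>\<close> on a class of them bounds \<open>K\<close> there by
  \<eta> from above.\<close>

lemma quad_form_one_sided_paving:
  assumes "uniformly_colourable (1 + \<eta>)" "0 < \<eta>"
  shows "\<exists>r. \<forall>(S :: 'a set) K. zero_diag_contraction S K \<longrightarrow> paved_above r S K \<eta>"
proof -
  obtain r where r: "\<And>(I :: 'a set) (D :: 'a set) a. finite I \<Longrightarrow> finite D \<Longrightarrow> bessel D I a 2 \<Longrightarrow>
        (\<forall>i\<in>I. (\<Sum>d\<in>D. (cmod (a i d))\<^sup>2) \<le> 1) \<Longrightarrow> colourable r D I a (1 + \<eta>)"
    using uniformly_colourableD[OF assms(1), of 2] by blast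
  show ?thesis
  proof (intro exI[of _ r] allI impI)
    fix S :: "'a set" and K
    assume K: "zero_diag_contraction S K"
    then have fin: "finite S" and herm: "\<forall>i\<in>S. \<forall>j\<in>S. K j i = cnj (K i j)" and diag: "\<forall>i\<in>S. K i i = 0"
      and bd: "\<forall>y. \<bar>Re (quad_form S K y)\<bar> \<le> (\<Sum>i\<in>S. (cmod (y i))\<^sup>2)"
      unfolding zero_diag_contraction_def by iprover+
    define P where "P i j = (if i = j then 1 else 0) + K i j" for i j
    have Pq: "quad_form T P y = of_real (\<Sum>i\<in>T. (cmod (y i))\<^sup>2) + quad_form T K y" if "T \<subseteq> S" for T y
    proof -
      have finT: "finite T" using that fin finite_subset by blast
      have "quad_form T P y = (\<Sum>i\<in>T. \<Sum>j\<in>T. (if i = j then y i * cnj (y j) else 0) + cnj (y i) * K i j * y j)"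
        unfolding quad_form_def P_def by (intro sum.cong) (auto simp: algebra_simps)
      also have "\<dots> = of_real (\<Sum>i\<in>T. (cmod (y i))\<^sup>2) + quad_form T K y"
        using finT unfolding quad_form_def by (simp add: sum.distrib complex_norm_square del: of_real_power)
      finally show ?thesis .
    qed
    have "psd_on S P"
      unfolding psd_on_iff_quad_form
    proof (intro conjI ballI allI)
      fix i j assume "i \<in> S" "j \<in> S"
      then have "cnj (K i j) = K j i" using herm by metis
      then show "P j i = cnj (P i j)" by (simp add: P_def)
    next
      fix y show "0 \<le> Re (quad_form S P y)" using bd[rule_format, of y] by (simp add: Pq)
    qed
    from psd_on_factor[OF fin this] obtain b
      where b: "\<And>i j. i \<in> S \<Longrightarrow> j \<in> S \<Longrightarrow> P i j = (\<Sum>e\<in>S. cnj (b e i) * b e j)" by blast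
    have bq: "(\<Sum>e\<in>S. (cmod (\<Sum>i\<in>T. b e i * y i))\<^sup>2) = (\<Sum>i\<in>T. (cmod (y i))\<^sup>2) + Re (quad_form T K y)"
      if "T \<subseteq> S" for T y
    proof -
      have "quad_form T P y = (\<Sum>i\<in>T. \<Sum>j\<in>T. cnj (y i) * (\<Sum>e\<in>S. cnj (b e i) * b e j) * y j)"
        unfolding quad_form_def using that b by (intro sum.cong) auto
      then have "complex_of_real (\<Sum>e\<in>S. (cmod (\<Sum>i\<in>T. b e i * y i))\<^sup>2)
          = of_real (\<Sum>i\<in>T. (cmod (y i))\<^sup>2) + quad_form T K y"
        unfolding gram_quadratic_form using Pq[OF that] by simp
      from arg_cong[OF this, of Re] show ?thesis by simp
    qed
    have "bessel S S b 2"
      unfolding bessel_def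
    proof
      fix y show "(\<Sum>e\<in>S. (cmod (\<Sum>i\<in>S. b e i * y i))\<^sup>2) \<le> 2 * (\<Sum>i\<in>S. (cmod (y i))\<^sup>2)"
        using bd[rule_format, of y] by (simp add: bq)
    qed
    then have "bessel S S (\<lambda>i e. cnj (b e i)) 2" by (rule bessel_dual) simp
    moreover have "(\<Sum>e\<in>S. (cmod (cnj (b e i)))\<^sup>2) \<le> 1" if "i \<in> S" for i
    proof -
      have "complex_of_real (\<Sum>e\<in>S. (cmod (b e i))\<^sup>2) = P i i"
        by (simp only: b[OF that that] of_real_sum complex_norm_square mult.commute[of "cnj _"])
      also have "P i i = of_real 1" using diag that by (simp add: P_def)
      finally show ?thesis by (simp only: of_real_eq_iff complex_mod_cnj)
    qed
    ultimately have "colourable r S S (\<lambda>i e. cnj (b e i)) (1 + \<eta>)" using r[OF fin fin] by blast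
    then obtain \<kappa> where \<kappa>: "\<forall>i\<in>S. \<kappa> i < r" "\<forall>j<r. bessel S {i\<in>S. \<kappa> i = j} (\<lambda>i e. cnj (b e i)) (1 + \<eta>)"
      unfolding colourable_def by blast
    show "paved_above r S K \<eta>"
      unfolding paved_above_def
    proof (intro exI[of _ \<kappa>] conjI allI impI)
      fix j y assume "j < r"
      let ?T = "{i\<in>S. \<kappa> i = j}"
      have "bessel ?T S (\<lambda>e i. cnj (cnj (b e i))) (1 + \<eta>)"
        by (rule bessel_dual[OF \<kappa>(2)[rule_format, OF \<open>j < r\<close>]]) (use assms(2) in simp)
      from besselD[OF this, of y]
      show "Re (quad_form ?T K y) \<le> \<eta> * (\<Sum>i\<in>?T. (cmod (y i))\<^sup>2)"
        using bq[of ?T y] by (simp add: algebra_simps)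
    qed (use \<kappa> in auto)
  qed
qed

text \<open>Pavings of \<open>K\<close> and \<open>- K\<close> from above have a common refinement,
  and both bounds survive on its smaller classes.\<close>

lemma quad_form_paving:
  assumes "uniformly_colourable (1 + \<eta>)" "0 < \<eta>"
  shows "\<exists>r. \<forall>(S :: 'a set) K. zero_diag_contraction S K \<longrightarrow> paved r S K \<eta>"
proof -
  obtain r where r: "\<And>(S :: 'a set) K. zero_diag_contraction S K \<Longrightarrow> paved_above r S K \<eta>"
    using quad_form_one_sided_paving[OF assms] by blast
  show ?thesis
  proof (intro exI[of _ "r * r"] allI impI)
    fix S :: "'a set" and K
    assume K: "zero_diag_contraction S K"
    then have fin: "finite S" and herm: "\<forall>i\<in>S. \<forall>j\<in>S. K j i = cnj (K i j)" and diag: "\<forall>i\<in>S. K i i = 0"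
      and bd: "\<forall>y. \<bar>Re (quad_form S K y)\<bar> \<le> (\<Sum>i\<in>S. (cmod (y i))\<^sup>2)"
      unfolding zero_diag_contraction_def by iprover+
    have neg: "quad_form T (\<lambda>i j. - K i j) y = - quad_form T K y" for T y
      by (simp add: quad_form_def sum_negf)
    obtain \<kappa> :: "'a \<Rightarrow> nat" where \<kappa>: "\<forall>i\<in>S. \<kappa> i < r"
        "\<forall>j<r. \<forall>y. Re (quad_form {i\<in>S. \<kappa> i = j} K y) \<le> \<eta> * (\<Sum>i\<in>{i\<in>S. \<kappa> i = j}. (cmod (y i))\<^sup>2)"
      using r[OF K] unfolding paved_above_def by iprover
    have "zero_diag_contraction S (\<lambda>i j. - K i j)"
      unfolding zero_diag_contraction_def
    proof (intro conjI)
      show "\<forall>i\<in>S. \<forall>j\<in>S. - K j i = cnj (- K i j)" using herm by (metis complex_cnj_minus)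
    qed (use fin diag bd in \<open>simp_all add: neg\<close>)
    from r[OF this] obtain \<psi> :: "'a \<Rightarrow> nat" where \<psi>: "\<forall>i\<in>S. \<psi> i < r"
        "\<forall>j<r. \<forall>y. Re (quad_form {i\<in>S. \<psi> i = j} (\<lambda>i j. - K i j) y) \<le> \<eta> * (\<Sum>i\<in>{i\<in>S. \<psi> i = j}. (cmod (y i))\<^sup>2)"
      unfolding paved_above_def by iprover
    define \<phi> where "\<phi> i = \<kappa> i * r + \<psi> i" for i
    have dm: "\<phi> i div r = \<kappa> i" "\<phi> i mod r = \<psi> i" "\<phi> i < r * r" if "i \<in> S" for i
    proof -
      have l: "\<psi> i < r" "\<kappa> i < r" using \<psi>(1) \<kappa>(1) that by auto
      then show "\<phi> i div r = \<kappa> i" "\<phi> i mod r = \<psi> i" by (auto simp: \<phi>_def)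
      have "\<phi> i < (\<kappa> i + 1) * r" using l by (simp add: \<phi>_def)
      also have "\<dots> \<le> r * r" using l by (intro mult_right_mono) auto
      finally show "\<phi> i < r * r" .
    qed
    show "paved (r * r) S K \<eta>"
      unfolding paved_def
    proof (intro exI[of _ \<phi>] conjI allI impI)
      fix t and y :: "'a \<Rightarrow> complex" assume t: "t < r * r"
      let ?T = "{i\<in>S. \<phi> i = t}"
      have "r > 0" using t by (cases r) auto
      then have tr: "t div r < r" "t mod r < r" using t by (auto simp: less_mult_imp_div_less)
      let ?y = "\<lambda>i. if i \<in> ?T then y i else 0"
      have s1: "?T \<subseteq> {i\<in>S. \<kappa> i = t div r}" and s2: "?T \<subseteq> {i\<in>S. \<psi> i = t mod r}" using dm by auto
      have f: "finite {i\<in>S. \<kappa> i = t div r}" "finite {i\<in>S. \<psi> i = t mod r}" using fin by auto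
      have "Re (quad_form ?T K y) \<le> \<eta> * (\<Sum>i\<in>?T. (cmod (y i))\<^sup>2)"
        using \<kappa>(2)[rule_format, OF tr(1), of ?y]
        unfolding quad_form_subset[OF f(1) s1, symmetric] sum_norm_subset[OF f(1) s1] .
      moreover have "- Re (quad_form ?T K y) \<le> \<eta> * (\<Sum>i\<in>?T. (cmod (y i))\<^sup>2)"
        using \<psi>(2)[rule_format, OF tr(2), of ?y]
        unfolding quad_form_subset[OF f(2) s2, symmetric] sum_norm_subset[OF f(2) s2] neg by simp
      ultimately show "\<bar>Re (quad_form ?T K y)\<bar> \<le> \<eta> * (\<Sum>i\<in>?T. (cmod (y i))\<^sup>2)" by simp
    qed (use dm in auto)
  qed
qed

section \<open>Matrix entries and positivity\<close>

definition entry :: "mseq \<Rightarrow> nat \<Rightarrow> nat \<Rightarrow> nat \<Rightarrow> complex" where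
  "entry a n i j = coord a n $$ (i, j)"

lemma mseq_entryI:
  "(\<And>n i j. 2 \<le> n \<Longrightarrow> i < n \<Longrightarrow> j < n \<Longrightarrow> entry a n i j = entry b n i j) \<Longrightarrow> a = b"
  by (intro mseq_eqI eq_matI) (auto simp: entry_def)

lemma entry_zero [simp]: "i < n \<Longrightarrow> j < n \<Longrightarrow> entry 0 n i j = 0"
  by (simp add: entry_def zero_mseq.rep_eq)

lemma entry_one [simp]: "2 \<le> n \<Longrightarrow> i < n \<Longrightarrow> j < n \<Longrightarrow> entry 1 n i j = (if i = j then 1 else 0)"
  by (simp add: entry_def one_mseq.rep_eq)

lemma entry_add [simp]: "i < n \<Longrightarrow> j < n \<Longrightarrow> entry (a + b) n i j = entry a n i j + entry b n i j"
  by (simp add: entry_def plus_mseq.rep_eq)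

lemma entry_uminus [simp]: "i < n \<Longrightarrow> j < n \<Longrightarrow> entry (- a) n i j = - entry a n i j"
  by (simp add: entry_def uminus_mseq.rep_eq)

lemma entry_diff [simp]: "i < n \<Longrightarrow> j < n \<Longrightarrow> entry (a - b) n i j = entry a n i j - entry b n i j"
  by (simp add: minus_mseq_def del: add_uminus_conv_diff)

lemma entry_mult [simp]:
  "i < n \<Longrightarrow> j < n \<Longrightarrow> entry (a * b) n i j = (\<Sum>k<n. entry a n i k * entry b n k j)"
  by (simp add: entry_def times_mseq.rep_eq scalar_prod_def atLeast0LessThan)

lemma entry_cscale [simp]: "i < n \<Longrightarrow> j < n \<Longrightarrow> entry (cscale c a) n i j = c * entry a n i j"
  by (simp add: entry_def cscale.rep_eq)

lemma entry_adj [simp]: "i < n \<Longrightarrow> j < n \<Longrightarrow> entry (adj a) n i j = cnj (entry a n j i)"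
  by (simp add: entry_def adj.rep_eq mat_adjoint_index)

lemma entry_cond_exp [simp]:
  "i < n \<Longrightarrow> j < n \<Longrightarrow> entry (cond_exp a) n i j = (if i = j then entry a n i i else 0)"
  by (simp add: entry_def cond_exp.rep_eq diag_part_def mat_diag_def)

lemma entry_sum [simp]:
  "i < n \<Longrightarrow> j < n \<Longrightarrow> entry (\<Sum>x\<in>X. a x) n i j = (\<Sum>x\<in>X. entry (a x) n i j)"
  by (induction X rule: infinite_finite_induct) auto

lemma diagonals_iff: "a \<in> diagonals \<longleftrightarrow> (\<forall>n\<ge>2. \<forall>i<n. \<forall>j<n. i \<noteq> j \<longrightarrow> entry a n i j = 0)"
  by (simp add: diagonals_def diagonal_mat_def entry_def)

lemma norm_entry_le: "2 \<le> n \<Longrightarrow> i < n \<Longrightarrow> j < n \<Longrightarrow> cmod (entry a n i j) \<le> norm a"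
  using opnorm_entry[of i "coord a n" j] coord_le_norm[of n a] by (simp add: entry_def)

lemma adj_adj [simp]: "adj (adj a) = a"
  by (rule mseq_entryI) simp

lemma adj_add: "adj (a + b) = adj a + adj b"
  by (rule mseq_entryI) simp

lemma adj_diff: "adj (a - b) = adj a - adj b"
  by (rule mseq_entryI) simp

lemma adj_one [simp]: "adj 1 = 1"
  by (rule mseq_entryI) auto

lemma adj_mult: "adj (a * b) = adj b * adj a"
  by (rule mseq_entryI) (simp add: mult.commute)

lemma adj_cscale: "adj (cscale c a) = cscale (cnj c) (adj a)"
  by (rule mseq_entryI) simp

lemma cscale_mult_left: "cscale c a * b = cscale c (a * b)"
  by (rule mseq_entryI) (simp add: sum_distrib_left mult.assoc)

lemma cscale_mult_right: "a * cscale c b = cscale c (a * b)"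
  by (rule mseq_entryI) (simp add: sum_distrib_left mult_ac)

lemma cscale_cscale: "cscale c (cscale d a) = cscale (c * d) a"
  by (rule mseq_entryI) simp

lemma cscale_minus_one: "cscale (- 1) a = - a"
  by (rule mseq_entryI) simp

lemma cscale_add: "cscale c (a + b) = cscale c a + cscale c b"
  by (rule mseq_entryI) (simp add: distrib_left)

lemma cscale_diff: "cscale c (a - b) = cscale c a - cscale c b"
  by (rule mseq_entryI) (simp add: right_diff_distrib)

lemma cond_exp_adj: "cond_exp (adj a) = adj (cond_exp a)"
  by (rule mseq_entryI) auto

lemma cond_exp_add: "cond_exp (a + b) = cond_exp a + cond_exp b"
  by (rule mseq_entryI) auto

lemma cond_exp_cscale: "cond_exp (cscale c a) = cscale c (cond_exp a)"
  by (rule mseq_entryI) auto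

lemma cscale_zero [simp]: "cscale c 0 = 0"
  by (rule mseq_entryI) simp

lemma adj_zero [simp]: "adj 0 = 0"
  by (rule mseq_entryI) simp

lemma cond_exp_diff: "cond_exp (a - b) = cond_exp a - cond_exp b"
  by (rule mseq_entryI) auto

lemma cond_exp_diagonal: "a \<in> diagonals \<Longrightarrow> cond_exp a = a"
  by (rule mseq_entryI) (auto simp: diagonals_iff)

lemma cond_exp_in_diagonals: "cond_exp a \<in> diagonals"
  by (auto simp: diagonals_iff)

lemma diagonals_closed:
  "1 \<in> diagonals"
  "a \<in> diagonals \<Longrightarrow> b \<in> diagonals \<Longrightarrow> a + b \<in> diagonals"
  "a \<in> diagonals \<Longrightarrow> b \<in> diagonals \<Longrightarrow> a * b \<in> diagonals"
  "a \<in> diagonals \<Longrightarrow> cscale c a \<in> diagonals"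
  "a \<in> diagonals \<Longrightarrow> adj a \<in> diagonals"
proof -
  assume a: "a \<in> diagonals" and b: "b \<in> diagonals"
  have *: "entry a n i k * entry b n k j = 0" if "2 \<le> n" "i < n" "j < n" "i \<noteq> j" "k < n" for n i j k
    using a b that unfolding diagonals_iff by (cases "k = i") auto
  show "a * b \<in> diagonals"
    unfolding diagonals_iff
  proof (intro allI impI)
    fix n i j :: nat assume n: "2 \<le> n" "i < n" "j < n" "i \<noteq> j"
    then show "entry (a * b) n i j = 0"
      unfolding entry_mult[OF n(2,3)] by (intro sum.neutral ballI *) auto
  qed
qed (auto simp: diagonals_iff)

section \<open>Operator norms as Bessel bounds\<close>

lemma vnorm_vec_sq: "(vnorm (vec n y))\<^sup>2 = (\<Sum>i<n. (cmod (y i))\<^sup>2)"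
  by (simp add: vnorm_def L2_set_def sum_nonneg atLeast0LessThan)

lemma vnorm_mat_vec_sq:
  assumes "A \<in> carrier_mat n m"
  shows "(vnorm (A *\<^sub>v vec m y))\<^sup>2 = (\<Sum>i<n. (cmod (\<Sum>j<m. A $$ (i, j) * y j))\<^sup>2)"
proof -
  have "A *\<^sub>v vec m y = vec n (\<lambda>i. \<Sum>j<m. A $$ (i, j) * y j)"
    using assms by (intro eq_vecI) (auto simp: scalar_prod_def atLeast0LessThan)
  then show ?thesis by (simp add: vnorm_vec_sq)
qed

lemma opnorm_bessel:
  assumes "A \<in> carrier_mat n m"
  shows "bessel {..<m} {..<n} (\<lambda>i j. A $$ (i, j)) ((opnorm A)\<^sup>2)"
  unfolding bessel_def
proof
  fix y :: "nat \<Rightarrow> complex"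
  have "vnorm (A *\<^sub>v vec m y) \<le> opnorm A * vnorm (vec m y)"
    using assms by (intro vnorm_mult_le) auto
  then have "(vnorm (A *\<^sub>v vec m y))\<^sup>2 \<le> (opnorm A * vnorm (vec m y))\<^sup>2"
    by (rule power_mono) simp
  then show "(\<Sum>i<n. (cmod (\<Sum>j<m. A $$ (i, j) * y j))\<^sup>2) \<le> (opnorm A)\<^sup>2 * (\<Sum>j<m. (cmod (y j))\<^sup>2)"
    by (simp add: power_mult_distrib vnorm_vec_sq vnorm_mat_vec_sq[OF assms])
qed

lemma opnorm_le_bessel:
  assumes "A \<in> carrier_mat n m" "bessel {..<m} {..<n} (\<lambda>i j. A $$ (i, j)) (c\<^sup>2)" "0 \<le> c"
  shows "opnorm A \<le> c"
proof (rule opnorm_least)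
  fix v :: "complex vec" assume "v \<in> carrier_vec (dim_col A)"
  then have v: "v = vec m (\<lambda>i. vec_index v i)" using assms by auto
  have "(vnorm (A *\<^sub>v v))\<^sup>2 \<le> (c * vnorm v)\<^sup>2"
    using besselD[OF assms(2), of "\<lambda>i. vec_index v i"]
    by (subst (1 2) v) (simp add: power_mult_distrib vnorm_vec_sq vnorm_mat_vec_sq[OF assms(1)])
  then show "vnorm (A *\<^sub>v v) \<le> c * vnorm v"
    by (rule power2_le_imp_le) (simp add: assms(3))
qed (rule assms(3))

lemma entry_bessel:
  assumes "2 \<le> n"
  shows "bessel {..<n} {..<n} (entry a n) ((norm a)\<^sup>2)"
proof (rule bessel_mono)
  show "bessel {..<n} {..<n} (entry a n) ((opnorm (coord a n))\<^sup>2)"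
    unfolding entry_def[abs_def] by (rule opnorm_bessel) simp
  show "(opnorm (coord a n))\<^sup>2 \<le> (norm a)\<^sup>2"
    using assms by (intro power_mono coord_le_norm) auto
qed

text \<open>Elements of \<open>mseq\<close> are built from prescribed entries; the common Bessel
  bound supplies the boundedness that the type demands.\<close>

lemma ex_mseq_entry:
  assumes "\<And>n. 2 \<le> n \<Longrightarrow> bessel {..<n} {..<n} (f n) (c\<^sup>2)" "0 \<le> c"
  shows "\<exists>a. \<forall>n\<ge>2. \<forall>i<n. \<forall>j<n. entry a n i j = f n i j"
proof -
  \<comment> \<open>The coordinates 0 and 1 must be zero matrices for \<open>g\<close> to represent
    an element.\<close>
  define g where "g n = (if n < 2 then 0\<^sub>m n n else mat n n (\<lambda>(i, j). f n i j))" for n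
  have "opnorm (g n) \<le> c" if "2 \<le> n" for n
  proof (rule opnorm_le_bessel[of _ n n])
    show "bessel {..<n} {..<n} (\<lambda>i j. g n $$ (i, j)) (c\<^sup>2)"
      using assms(1)[OF that] that unfolding bessel_def g_def by simp
  qed (use that assms(2) in \<open>auto simp: g_def\<close>)
  then have "bdd_above ((\<lambda>n. opnorm (g n)) ` {2..})" by (intro bdd_aboveI2[where M = c]) auto
  then have "g \<in> {a. (\<forall>n\<ge>2. a n \<in> carrier_mat n n) \<and> (\<forall>n<2. a n = 0\<^sub>m n n) \<and>
      bdd_above ((\<lambda>n. opnorm (a n)) ` {2..})}" by (auto simp: g_def)
  then have "coord (Abs_mseq g) = g" by (rule Abs_mseq_inverse)
  then show ?thesis by (intro exI[of _ "Abs_mseq g"]) (auto simp: entry_def g_def)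
qed

lemma sum_diag_mult [simp]:
  fixes d :: "nat \<Rightarrow> complex"
  shows "i < n \<Longrightarrow> (\<Sum>k<n. (if i = k then d k else 0) * y k) = d i * y i"
    and "i < n \<Longrightarrow> (\<Sum>k<n. y k * (if k = i then d k else 0)) = y i * d i"
proof -
  assume i: "i < n"
  have "(\<Sum>k<n. (if i = k then d k else 0) * y k) = (\<Sum>k<n. if i = k then d k * y k else 0)"
    by (intro sum.cong) auto
  then show "(\<Sum>k<n. (if i = k then d k else 0) * y k) = d i * y i" using i by simp
  have "(\<Sum>k<n. y k * (if k = i then d k else 0)) = (\<Sum>k<n. if k = i then y k * d k else 0)"
    by (intro sum.cong) auto
  then show "(\<Sum>k<n. y k * (if k = i then d k else 0)) = y i * d i" using i by simp
qed

lemma bessel_diagonal: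
  fixes d :: "nat \<Rightarrow> complex"
  assumes "\<And>i. i < n \<Longrightarrow> cmod (d i) \<le> c"
  shows "bessel {..<n} {..<n} (\<lambda>i j. if i = j then d j else 0) (c\<^sup>2)"
  unfolding bessel_def
proof
  fix y :: "nat \<Rightarrow> complex"
  have "(\<Sum>i<n. (cmod (\<Sum>j<n. (if i = j then d j else 0) * y j))\<^sup>2) = (\<Sum>i<n. (cmod (d i))\<^sup>2 * (cmod (y i))\<^sup>2)"
    by (simp add: norm_mult power_mult_distrib)
  also have "\<dots> \<le> (\<Sum>i<n. c\<^sup>2 * (cmod (y i))\<^sup>2)"
    using assms by (intro sum_mono mult_right_mono power_mono) auto
  finally show "(\<Sum>i<n. (cmod (\<Sum>j<n. (if i = j then d j else 0) * y j))\<^sup>2) \<le> c\<^sup>2 * (\<Sum>i<n. (cmod (y i))\<^sup>2)"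
    by (simp add: sum_distrib_left)
qed

lemma ex_diagonal_entry:
  assumes "\<And>n i. 2 \<le> n \<Longrightarrow> i < n \<Longrightarrow> cmod (d n i) \<le> c" "0 \<le> c"
  shows "\<exists>a. \<forall>n\<ge>2. \<forall>i<n. \<forall>j<n. entry a n i j = (if i = j then d n j else 0)"
  by (rule ex_mseq_entry[OF bessel_diagonal assms(2)]) (rule assms(1))

lemma opnorm_coord_le_bessel:
  assumes "bessel {..<n} {..<n} (entry a n) (c\<^sup>2)" "0 \<le> c"
  shows "opnorm (coord a n) \<le> c"
  using assms unfolding entry_def[abs_def] by (intro opnorm_le_bessel[of _ n n]) auto

lemma norm_le_bessel:
  assumes "\<And>n. 2 \<le> n \<Longrightarrow> bessel {..<n} {..<n} (entry a n) (c\<^sup>2)" "0 \<le> c"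
  shows "norm a \<le> c"
  using assms by (intro norm_mseq_least opnorm_coord_le_bessel)

lemma opnorm_diagonal_le:
  assumes "a \<in> diagonals" "2 \<le> n" "\<And>i. i < n \<Longrightarrow> cmod (entry a n i i) \<le> c" "0 \<le> c"
  shows "opnorm (coord a n) \<le> c"
proof (rule opnorm_coord_le_bessel[OF _ assms(4)])
  have "bessel {..<n} {..<n} (\<lambda>i j. if i = j then entry a n j j else 0) (c\<^sup>2)"
    by (rule bessel_diagonal[OF assms(3)])
  also have "?this \<longleftrightarrow> bessel {..<n} {..<n} (entry a n) (c\<^sup>2)"
    using assms(1,2) by (intro bessel_cong) (auto simp: diagonals_iff)
  finally show "bessel {..<n} {..<n} (entry a n) (c\<^sup>2)" .
qed

lemma norm_diagonal_le:
  assumes "a \<in> diagonals" "\<And>n i. 2 \<le> n \<Longrightarrow> i < n \<Longrightarrow> cmod (entry a n i i) \<le> c" "0 \<le> c"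
  shows "norm a \<le> c"
  using assms by (intro norm_mseq_least opnorm_diagonal_le)

section \<open>Positive elements and their factors\<close>

lemma entry_gram:
  "i < n \<Longrightarrow> j < n \<Longrightarrow> entry (adj b * b) n i j = (\<Sum>k<n. cnj (entry b n k i) * entry b n k j)"
  by simp

lemma quad_form_opnorm_le:
  "cmod (quad_form {..<n} (entry a n) y) \<le> opnorm (coord a n) * (\<Sum>i<n. (cmod (y i))\<^sup>2)"
proof -
  define Y where "Y = (\<Sum>d<n. (cmod (y d))\<^sup>2)"
  have Y0: "0 \<le> Y" by (simp add: Y_def sum_nonneg)
  have "quad_form {..<n} (entry a n) y = (\<Sum>i<n. cnj (y i) * (\<Sum>j<n. entry a n i j * y j))"
    by (simp add: quad_form_def sum_distrib_left mult.assoc)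
  also have "cmod \<dots> \<le> (\<Sum>i<n. \<bar>cmod (y i)\<bar> * \<bar>cmod (\<Sum>j<n. entry a n i j * y j)\<bar>)"
    by (intro order.trans[OF norm_sum] sum_mono) (simp add: norm_mult)
  also have "\<dots> \<le> L2_set (\<lambda>i. cmod (y i)) {..<n} * L2_set (\<lambda>i. cmod (\<Sum>j<n. entry a n i j * y j)) {..<n}"
    by (rule L2_set_mult_ineq)
  also have "\<dots> \<le> L2_set (\<lambda>i. cmod (y i)) {..<n} * sqrt ((opnorm (coord a n))\<^sup>2 * Y)"
    using besselD[OF opnorm_bessel[of "coord a n" n n], of y]
    by (intro mult_left_mono) (simp_all add: L2_set_def Y_def sum_nonneg entry_def)
  also have "L2_set (\<lambda>i. cmod (y i)) {..<n} * sqrt ((opnorm (coord a n))\<^sup>2 * Y) = opnorm (coord a n) * Y"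
    using Y0 by (simp add: L2_set_def Y_def[symmetric] real_sqrt_mult)
  finally show ?thesis by (simp add: Y_def)
qed

lemma quad_form_norm_le:
  assumes "2 \<le> n"
  shows "cmod (quad_form {..<n} (entry a n) y) \<le> norm a * (\<Sum>i<n. (cmod (y i))\<^sup>2)"
proof -
  have "opnorm (coord a n) * (\<Sum>i<n. (cmod (y i))\<^sup>2) \<le> norm a * (\<Sum>i<n. (cmod (y i))\<^sup>2)"
    using coord_le_norm[OF assms] by (intro mult_right_mono sum_nonneg) auto
  with quad_form_opnorm_le[of n a y] show ?thesis by linarith
qed

text \<open>Each coordinate is factored separately. The factors are uniformly bounded, since the
  squared norm of the factor applied to \<open>y\<close> is the form of \<open>a\<close> at
  \<open>y\<close>, at most \<open>norm a\<close> times the squared norm of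
  \<open>y\<close>.\<close>

lemma positive_factor:
  assumes "\<And>n. 2 \<le> n \<Longrightarrow> psd_on {..<n} (entry a n)"
  shows "\<exists>b. a = adj b * b"
proof -
  have "\<exists>b. \<forall>i<n. \<forall>j<n. entry a n i j = (\<Sum>e<n. cnj (b e i) * b e j)" if "2 \<le> n" for n
    using psd_on_factor[OF finite_lessThan assms[OF that]] by (simp only: Ball_def lessThan_iff)
  then obtain b where b: "\<And>n i j. 2 \<le> n \<Longrightarrow> i < n \<Longrightarrow> j < n \<Longrightarrow>
      entry a n i j = (\<Sum>e<n. cnj (b n e i) * b n e j)" by metis
  have "bessel {..<n} {..<n} (b n) ((sqrt (norm a))\<^sup>2)" if n: "2 \<le> n" for n
    unfolding bessel_def
  proof
    fix y :: "nat \<Rightarrow> complex"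
    have "complex_of_real (\<Sum>e<n. (cmod (\<Sum>d<n. b n e d * y d))\<^sup>2) = quad_form {..<n} (entry a n) y"
      unfolding gram_quadratic_form[symmetric] quad_form_def using b[OF n] by simp
    then have "(\<Sum>e<n. (cmod (\<Sum>d<n. b n e d * y d))\<^sup>2) = cmod (quad_form {..<n} (entry a n) y)"
      by (metis (no_types, lifting) abs_of_nonneg norm_of_real sum_nonneg zero_le_power2)
    also have "\<dots> \<le> norm a * (\<Sum>i<n. (cmod (y i))\<^sup>2)" by (rule quad_form_norm_le[OF n])
    finally show "(\<Sum>e<n. (cmod (\<Sum>d<n. b n e d * y d))\<^sup>2) \<le> (sqrt (norm a))\<^sup>2 * (\<Sum>d<n. (cmod (y d))\<^sup>2)"
      by simp
  qed
  from ex_mseq_entry[OF this] obtain c where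
    "\<forall>n\<ge>2. \<forall>i<n. \<forall>j<n. entry c n i j = b n i j" by auto
  then have "a = adj c * c" using b by (intro mseq_entryI) (simp add: entry_gram del: entry_mult)
  then show ?thesis by blast
qed

text \<open>Entrywise square roots keep the factor diagonal. This matters because a state of the
  diagonal algebra is only known to be positive on squares formed inside that algebra.\<close>

lemma diagonal_positive_factor:
  assumes "a \<in> diagonals" "\<And>n i. 2 \<le> n \<Longrightarrow> i < n \<Longrightarrow> 0 \<le> entry a n i i"
  shows "\<exists>b\<in>diagonals. a = adj b * b"
proof -
  define d where "d n i = complex_of_real (sqrt (Re (entry a n i i)))" for n i
  have "cmod (d n i) \<le> sqrt (norm a)" if "2 \<le> n" "i < n" for n i
  proof -
    have "Re (entry a n i i) \<le> norm a"
      using complex_Re_le_cmod norm_entry_le[OF that that(2)] order.trans by blast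
    moreover have "0 \<le> Re (entry a n i i)" using assms(2)[OF that] by (simp add: less_eq_complex_def)
    ultimately show ?thesis by (simp add: d_def)
  qed
  then obtain b where b: "\<forall>n\<ge>2. \<forall>i<n. \<forall>j<n. entry b n i j = (if i = j then d n j else 0)"
    using ex_diagonal_entry[of d "sqrt (norm a)"] by auto
  have "a = adj b * b"
  proof (rule mseq_entryI)
    fix n i j :: nat assume n: "2 \<le> n" "i < n" "j < n"
    have "entry (adj b * b) n i j = (\<Sum>k<n. cnj (entry b n k i) * (if k = j then d n k else 0))"
      using n b by simp
    also have "\<dots> = (if i = j then d n j * d n j else 0)"
      using n b by (simp add: d_def)
    also have "d n j * d n j = entry a n j j"
    proof -
      have "0 \<le> Re (entry a n j j)" "Im (entry a n j j) = 0"
        using assms(2)[OF n(1,3)] by (auto simp: less_eq_complex_def)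
      then show ?thesis by (simp add: d_def complex_eq_iff)
    qed
    finally show "entry a n i j = entry (adj b * b) n i j"
      using assms(1) n by (auto simp: diagonals_iff)
  qed
  moreover have "b \<in> diagonals" using b by (auto simp: diagonals_iff)
  ultimately show ?thesis by blast
qed

section \<open>States and uniqueness of extensions\<close>

lemma psd_on_scalar_diff:
  assumes "finite S" "\<And>i j. i \<in> S \<Longrightarrow> j \<in> S \<Longrightarrow> X i j = (if i = j then of_real c else 0) - K i j"
    "\<And>i j. i \<in> S \<Longrightarrow> j \<in> S \<Longrightarrow> K j i = cnj (K i j)"
    "\<And>y. Re (quad_form S K y) \<le> c * (\<Sum>i\<in>S. (cmod (y i))\<^sup>2)"
  shows "psd_on S X"
  unfolding psd_on_iff_quad_form
proof (intro conjI ballI allI)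
  fix i j assume ij: "i \<in> S" "j \<in> S"
  have "cnj (K i j) = K j i" using assms(3)[OF ij] by simp
  then show "X j i = cnj (X i j)" using ij by (simp add: assms(2))
next
  fix y :: "'a \<Rightarrow> complex"
  have "quad_form S X y = (\<Sum>i\<in>S. \<Sum>j\<in>S. (if i = j then of_real c * (y i * cnj (y j)) else 0) - cnj (y i) * K i j * y j)"
    unfolding quad_form_def by (intro sum.cong) (auto simp: assms(2) algebra_simps)
  also have "\<dots> = of_real (c * (\<Sum>i\<in>S. (cmod (y i))\<^sup>2)) - quad_form S K y"
    using assms(1) unfolding quad_form_def
    by (simp add: sum_subtractf complex_norm_square sum_distrib_left del: of_real_power)
  finally show "0 \<le> Re (quad_form S X y)" using assms(4)[of y] by simp
qed

text \<open>The last clause is the C*-algebraic substitute for completeness: it places a square root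
  of the defect of \<open>a\<close> in \<open>A\<close> and so makes states on \<open>A\<close>
  contractive.\<close>

definition star_subalgebra :: "mseq set \<Rightarrow> bool" where
  "star_subalgebra A \<longleftrightarrow> 1 \<in> A \<and> (\<forall>a\<in>A. \<forall>b\<in>A. a + b \<in> A \<and> a * b \<in> A) \<and>
     (\<forall>a\<in>A. adj a \<in> A \<and> (\<forall>c. cscale c a \<in> A)) \<and>
     (\<forall>a\<in>A. \<exists>b\<in>A. cscale (of_real ((norm a)\<^sup>2)) 1 - adj a * a = adj b * b)"

lemma star_subalgebra_UNIV: "star_subalgebra UNIV"
proof -
  have "\<exists>b. cscale (of_real ((norm a)\<^sup>2)) 1 - adj a * a = adj b * b" for a :: mseq
  proof (rule positive_factor, rule psd_on_scalar_diff)
    fix n :: nat assume n: "2 \<le> n"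
    show "entry (cscale (of_real ((norm a)\<^sup>2)) 1 - adj a * a) n i j
       = (if i = j then of_real ((norm a)\<^sup>2) else 0) - (\<Sum>k<n. cnj (entry a n k i) * entry a n k j)"
      if "i \<in> {..<n}" "j \<in> {..<n}" for i j using that n by auto
    fix y
    have "Re (quad_form {..<n} (\<lambda>i j. \<Sum>k<n. cnj (entry a n k i) * entry a n k j) y)
       = (\<Sum>e<n. (cmod (\<Sum>d<n. entry a n e d * y d))\<^sup>2)"
      unfolding quad_form_def gram_quadratic_form by simp
    then show "Re (quad_form {..<n} (\<lambda>i j. \<Sum>k<n. cnj (entry a n k i) * entry a n k j) y)
       \<le> (norm a)\<^sup>2 * (\<Sum>i<n. (cmod (y i))\<^sup>2)"
      using besselD[OF entry_bessel[OF n], of a y] by simp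
  qed (auto simp: cnj_sum mult.commute)
  then show ?thesis unfolding star_subalgebra_def by auto
qed

lemma entry_mult_diagonal:
  assumes "a \<in> diagonals" "2 \<le> n" "i < n" "j < n"
  shows "entry (a * b) n i j = entry a n i i * entry b n i j"
    and "entry (b * a) n i j = entry b n i j * entry a n j j"
proof -
  have "(\<Sum>k<n. entry a n i k * entry b n k j) = (\<Sum>k<n. if k = i then entry a n i i * entry b n i j else 0)"
    using assms by (intro sum.cong) (auto simp: diagonals_iff)
  then show "entry (a * b) n i j = entry a n i i * entry b n i j" using assms by simp
  have "(\<Sum>k<n. entry b n i k * entry a n k j) = (\<Sum>k<n. if k = j then entry b n i j * entry a n j j else 0)"
    using assms by (intro sum.cong) (auto simp: diagonals_iff)
  then show "entry (b * a) n i j = entry b n i j * entry a n j j" using assms by simp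
qed

lemma diagonals_commute:
  assumes "a \<in> diagonals" "b \<in> diagonals"
  shows "a * b = b * a"
proof (rule mseq_entryI)
  fix n i j :: nat assume n: "2 \<le> n" "i < n" "j < n"
  show "entry (a * b) n i j = entry (b * a) n i j"
    unfolding entry_mult_diagonal[OF assms(1) n]
    using assms(2) n by (cases "i = j") (auto simp: diagonals_iff)
qed

lemma star_subalgebra_diagonals: "star_subalgebra diagonals"
proof -
  have "\<exists>b\<in>diagonals. cscale (of_real ((norm a)\<^sup>2)) 1 - adj a * a = adj b * b" if a: "a \<in> diagonals" for a
  proof (rule diagonal_positive_factor)
    have "- (adj a * a) \<in> diagonals"
      using a diagonals_closed by (simp flip: cscale_minus_one)
    then show "cscale (of_real ((norm a)\<^sup>2)) 1 - adj a * a \<in> diagonals"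
      using diagonals_closed by (metis diff_conv_add_uminus)
    fix n i :: nat assume n: "2 \<le> n" "i < n"
    have "entry (cscale (of_real ((norm a)\<^sup>2)) 1 - adj a * a) n i i
        = of_real ((norm a)\<^sup>2) - cnj (entry a n i i) * entry a n i i"
      using n a entry_mult_diagonal(2)[OF a n n(2), of "adj a"] by (simp del: entry_mult)
    also have "cnj (entry a n i i) * entry a n i i = of_real ((cmod (entry a n i i))\<^sup>2)"
      by (simp only: complex_norm_square mult.commute)
    finally have e: "entry (cscale (of_real ((norm a)\<^sup>2)) 1 - adj a * a) n i i
        = of_real ((norm a)\<^sup>2 - (cmod (entry a n i i))\<^sup>2)" by (simp only: of_real_diff)
    have "(cmod (entry a n i i))\<^sup>2 \<le> (norm a)\<^sup>2"
      using norm_entry_le[OF n n(2)] by (intro power_mono) auto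
    then show "0 \<le> entry (cscale (of_real ((norm a)\<^sup>2)) 1 - adj a * a) n i i"
      unfolding e by (simp add: less_eq_complex_def del: of_real_diff of_real_power)
  qed
  then show ?thesis unfolding star_subalgebra_def using diagonals_closed by simp
qed

lemma star_subalgebra_closed:
  assumes "star_subalgebra A"
  shows "1 \<in> A" "0 \<in> A" "a \<in> A \<Longrightarrow> b \<in> A \<Longrightarrow> a + b \<in> A" "a \<in> A \<Longrightarrow> b \<in> A \<Longrightarrow> a * b \<in> A"
    "a \<in> A \<Longrightarrow> adj a \<in> A" "a \<in> A \<Longrightarrow> cscale c a \<in> A" "a \<in> A \<Longrightarrow> - a \<in> A"
    "a \<in> A \<Longrightarrow> b \<in> A \<Longrightarrow> a - b \<in> A"
proof -
  show *: "1 \<in> A" "a \<in> A \<Longrightarrow> b \<in> A \<Longrightarrow> a + b \<in> A" "a \<in> A \<Longrightarrow> b \<in> A \<Longrightarrow> a * b \<in> A"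
    "a \<in> A \<Longrightarrow> adj a \<in> A" "a \<in> A \<Longrightarrow> cscale c a \<in> A" for a b c
    using assms unfolding star_subalgebra_def by auto
  show neg: "a \<in> A \<Longrightarrow> - a \<in> A" for a using *(5)[of a "-1"] by (simp add: cscale_minus_one)
  show "a \<in> A \<Longrightarrow> b \<in> A \<Longrightarrow> a - b \<in> A" using *(2)[of a "- b"] neg[of b] by simp
  have "0 = cscale 0 1" by (rule mseq_entryI) simp
  then show "0 \<in> A" using * by metis
qed

section \<open>Basic inequalities for states\<close>

locale state_on =
  fixes A :: "mseq set" and f :: "mseq \<Rightarrow> complex"
  assumes alg: "star_subalgebra A" and st: "state A f"
begin

lemmas closed = star_subalgebra_closed[OF alg]

lemma add: "a \<in> A \<Longrightarrow> b \<in> A \<Longrightarrow> f (a + b) = f a + f b"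
  using st unfolding state_def by blast

lemma scale: "a \<in> A \<Longrightarrow> f (cscale c a) = c * f a"
  using st unfolding state_def by blast

lemma pos: "a \<in> A \<Longrightarrow> 0 \<le> f (adj a * a)"
  using st unfolding state_def by blast

lemma one: "f 1 = 1"
  using st unfolding state_def by blast

lemma uminus: "a \<in> A \<Longrightarrow> f (- a) = - f a"
  using scale[of a "-1"] by (simp add: cscale_minus_one)

lemma diff: "a \<in> A \<Longrightarrow> b \<in> A \<Longrightarrow> f (a - b) = f a - f b"
  using add[of a "- b"] uminus[of b] closed by simp

lemma zero: "f 0 = 0"
  using diff[of 1 1] closed by simp

lemma sum: "(\<And>x. x \<in> X \<Longrightarrow> a x \<in> A) \<Longrightarrow> f (\<Sum>x\<in>X. a x) = (\<Sum>x\<in>X. f (a x))"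
proof -
  assume "\<And>x. x \<in> X \<Longrightarrow> a x \<in> A"
  then have "(\<Sum>x\<in>X. a x) \<in> A \<and> f (\<Sum>x\<in>X. a x) = (\<Sum>x\<in>X. f (a x))"
    by (induction X rule: infinite_finite_induct) (auto simp: zero add closed)
  then show ?thesis by blast
qed

text \<open>Polarisation with the scalars \<open>1\<close> and \<open>\<i>\<close>.\<close>

lemma hermitian:
  assumes a: "a \<in> A"
  shows "f (adj a) = cnj (f a)"
proof -
  have exp: "f (adj (1 + cscale c a) * (1 + cscale c a))
      = 1 + c * f a + cnj c * f (adj a) + cnj c * c * f (adj a * a)" for c
  proof -
    have "adj (1 + cscale c a) * (1 + cscale c a)
       = 1 + cscale c a + (cscale (cnj c) (adj a) + cscale (cnj c * c) (adj a * a))"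
      by (simp add: adj_add adj_cscale ring_distribs cscale_mult_left cscale_mult_right cscale_cscale mult.commute[of c "cnj c"] cscale_add add_ac)
    then show ?thesis using a by (simp add: add scale one closed)
  qed
  have im: "Im (f (adj a * a)) = 0" using pos[OF a] by (simp add: less_eq_complex_def)
  have "Im (c * f a + cnj c * f (adj a) + cnj c * c * f (adj a * a)) = 0" for c
  proof -
    have "0 \<le> f (adj (1 + cscale c a) * (1 + cscale c a))" using a by (intro pos closed)
    then have "Im (1 + c * f a + cnj c * f (adj a) + cnj c * c * f (adj a * a)) = 0"
      unfolding exp less_eq_complex_def by simp
    then show ?thesis by simp
  qed
  from this[of 1] this[of \<i>] show ?thesis using im by (simp add: complex_eq_iff)
qed

text \<open>The difference of the two sides is the variance of \<open>a\<close>, the value of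
  \<open>f\<close> on the square of \<open>a\<close> minus the scalar \<open>f a\<close>.\<close>

lemma cauchy_schwarz: 
  assumes a: "a \<in> A"
  shows "(cmod (f a))\<^sup>2 \<le> Re (f (adj a * a))"
proof -
  define c where "c = f a"
  have "adj (a - cscale c 1) * (a - cscale c 1)
      = adj a * a - cscale c (adj a) - (cscale (cnj c) a - cscale (cnj c * c) 1)"
    by (simp add: adj_diff adj_cscale left_diff_distrib right_diff_distrib
        cscale_mult_left cscale_mult_right cscale_cscale mult.commute[of c "cnj c"] cscale_diff)
  then have "f (adj (a - cscale c 1) * (a - cscale c 1)) = f (adj a * a) - of_real ((cmod c)\<^sup>2)"
    using a by (simp add: diff scale one closed hermitian complex_norm_square c_def del: of_real_power)
  moreover have "0 \<le> f (adj (a - cscale c 1) * (a - cscale c 1))"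
    using a by (intro pos closed)
  ultimately show ?thesis by (simp add: less_eq_complex_def c_def)
qed

lemma norm_le:
  assumes a: "a \<in> A"
  shows "cmod (f a) \<le> norm a"
proof -
  obtain b where b: "b \<in> A" "cscale (of_real ((norm a)\<^sup>2)) 1 - adj a * a = adj b * b"
    using alg a unfolding star_subalgebra_def by blast
  have "0 \<le> f (adj b * b)" by (rule pos[OF b(1)])
  then have "0 \<le> f (cscale (of_real ((norm a)\<^sup>2)) 1 - adj a * a)" unfolding b(2) .
  then have "Re (f (adj a * a)) \<le> (norm a)\<^sup>2"
    using a by (simp add: diff scale closed one less_eq_complex_def del: of_real_power)
  then have "(cmod (f a))\<^sup>2 \<le> (norm a)\<^sup>2" using cauchy_schwarz[OF a] by linarith
  then show ?thesis by (rule power2_le_imp_le) simp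
qed

text \<open>Adding a multiple of the null element \<open>b\<close> to \<open>a\<close> changes the
  value on the square only linearly, and a linear function bounded below has slope zero.\<close>

lemma null_mult:
  assumes "a \<in> A" "b \<in> A" "f (adj b * b) = 0"
  shows "f (adj b * a) = 0"
proof -
  define z where "z = f (adj b * a)"
  have z': "f (adj a * b) = cnj z"
    using hermitian[of "adj b * a"] assms closed by (simp add: z_def adj_mult)
  have quad: "0 \<le> Re (f (adj a * a)) - 2 * t * (cmod z)\<^sup>2" for t :: real
  proof -
    define c where "c = - of_real t * z"
    have "adj (a + cscale c b) * (a + cscale c b)
       = adj a * a + cscale c (adj a * b) + (cscale (cnj c) (adj b * a) + cscale (cnj c * c) (adj b * b))"
      by (simp add: adj_add adj_cscale ring_distribs cscale_mult_left cscale_mult_right cscale_cscale mult.commute[of c "cnj c"] cscale_add add_ac)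
    then have "f (adj (a + cscale c b) * (a + cscale c b)) = f (adj a * a) + (c * cnj z + cnj c * z)"
      using assms by (simp add: add scale closed z' z_def)
    also have "c * cnj z + cnj c * z = of_real (- 2 * t * (cmod z)\<^sup>2)"
      by (simp add: c_def complex_norm_square mult_ac del: of_real_power)
    finally have "f (adj (a + cscale c b) * (a + cscale c b)) = f (adj a * a) + of_real (- 2 * t * (cmod z)\<^sup>2)" .
    moreover have "0 \<le> f (adj (a + cscale c b) * (a + cscale c b))"
      using assms by (intro pos closed)
    ultimately show ?thesis by (simp add: less_eq_complex_def)
  qed
  have "z = 0"
  proof (rule ccontr)
    assume "z \<noteq> 0"
    then have p: "(cmod z)\<^sup>2 > 0" by simp
    \<comment> \<open>At this value of \<open>t\<close> the lower bound in \<open>quad\<close>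
      equals - 1.\<close>
    show False using quad[of "(Re (f (adj a * a)) + 1) / (2 * (cmod z)\<^sup>2)"]
        pos[OF assms(1)] p by (simp add: field_simps less_eq_complex_def)
  qed
  then show ?thesis by (simp add: z_def)
qed

text \<open>The complement \<open>1 - q\<close> is a null element, so \<open>f\<close> cannot
  distinguish multiplication by \<open>q\<close> from multiplication by 1.\<close>

lemma projection_compress:
  assumes "a \<in> A" "q \<in> A" "is_projection q" "f q = 1"
  shows "f (q * a) = f a" "f (a * q) = f a" "f (q * a * q) = f a"
proof -
  have q: "adj q = q" "q * q = q" using assms(3) by (auto simp: is_projection_def)
  define b where "b = 1 - q"
  have b: "b \<in> A" "adj b = b" "b * b = b" using assms q closed
    by (auto simp: b_def adj_diff algebra_simps)
  have "f (adj b * b) = 0" using b assms closed by (simp add: b_def diff one)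
  then have null: "f (b * x) = 0" if "x \<in> A" for x using null_mult[OF that b(1)] b by simp
  have l: "f (q * x) = f x" if "x \<in> A" for x
    using null[OF that] that assms closed by (simp add: b_def left_diff_distrib diff)
  have r: "f (x * q) = f x" if "x \<in> A" for x
  proof -
    have "f (x * q) = cnj (f (adj (x * q)))" using hermitian[of "x * q"] that assms closed by simp
    also have "\<dots> = cnj (f (adj x))" using l[of "adj x"] that closed by (simp add: adj_mult q)
    finally show ?thesis using hermitian[OF that] by simp
  qed
  show "f (q * a) = f a" "f (a * q) = f a" using l r assms(1) by auto
  show "f (q * a * q) = f a" using l[of "a * q"] r[of a] assms closed by (simp add: mult.assoc)
qed

lemma projection_range:
  assumes "q \<in> A" "is_projection q"
  shows "Im (f q) = 0" "0 \<le> Re (f q)" "Re (f q) \<le> 1"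
proof -
  have q: "adj q = q" "q * q = q" using assms(2) by (auto simp: is_projection_def)
  have "adj (1 - q) * (1 - q) = 1 - q" by (simp add: adj_diff q algebra_simps)
  then have "0 \<le> f (1 - q)" using pos[of "1 - q"] assms closed by simp
  moreover have "0 \<le> f q" using pos[of q] assms q by simp
  ultimately show "Im (f q) = 0" "0 \<le> Re (f q)" "Re (f q) \<le> 1"
    using assms closed by (auto simp: diff one less_eq_complex_def)
qed

end

section \<open>Diagonal projections and pure states of the diagonal algebra\<close>

definition dproj :: "(nat \<times> nat) set \<Rightarrow> mseq" where
  "dproj Q = (SOME a. \<forall>n\<ge>2. \<forall>i<n. \<forall>j<n. entry a n i j = (if i = j then if (n, j) \<in> Q then 1 else 0 else 0))"

lemma entry_dproj [simp]:
  assumes "2 \<le> n" "i < n" "j < n"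
  shows "entry (dproj Q) n i j = (if i = j then if (n, j) \<in> Q then 1 else 0 else 0)"
proof -
  have "\<exists>a. \<forall>n\<ge>2. \<forall>i<n. \<forall>j<n. entry a n i j = (if i = j then if (n, j) \<in> Q then 1 else 0 else 0)"
    by (rule ex_diagonal_entry[of _ 1]) auto
  from someI_ex[OF this] show ?thesis using assms unfolding dproj_def by blast
qed

lemma dproj_diagonal [simp]: "dproj Q \<in> diagonals"
  by (simp add: diagonals_iff)

lemma dproj_mult: "dproj Q * dproj R = dproj (Q \<inter> R)"
  by (rule mseq_entryI) (auto simp: entry_mult_diagonal(1)[OF dproj_diagonal] simp del: entry_mult)

lemma dproj_projection [simp]: "is_projection (dproj Q)"
  unfolding is_projection_def dproj_mult by (auto intro!: mseq_entryI)

lemma dproj_UNIV [simp]: "dproj UNIV = 1"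
  by (rule mseq_entryI) auto

lemma sum_dproj_partition:
  assumes "finite J" "\<And>n i. 2 \<le> n \<Longrightarrow> i < n \<Longrightarrow> k (n, i) \<in> J"
  shows "(\<Sum>j\<in>J. dproj {p. k p = j}) = 1"
proof (rule mseq_entryI)
  fix n i j :: nat assume n: "2 \<le> n" "i < n" "j < n"
  have "(\<Sum>l\<in>J. entry (dproj {p. k p = l}) n i j) = (\<Sum>l\<in>J. if l = k (n, j) then (if i = j then 1 else 0) else 0)"
    using n by (intro sum.cong) auto
  then show "entry (\<Sum>l\<in>J. dproj {p. k p = l}) n i j = entry 1 n i j"
    using n assms(1) assms(2)[OF n(1,3)] by simp
qed

text \<open>Projections in the diagonal algebra are thus sets of positions \<open>(n, i)\<close>,
  and pavings are partitions of the positions.\<close>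

lemma diagonal_projection_eq_dproj:
  assumes "q \<in> diagonals" "is_projection q"
  shows "q = dproj {(n, i). entry q n i i = 1}"
proof (rule mseq_entryI)
  fix n i j :: nat assume n: "2 \<le> n" "i < n" "j < n"
  have "entry (q * q) n i i = entry q n i i * entry q n i i"
    using n by (simp add: entry_mult_diagonal(1)[OF assms(1)] del: entry_mult)
  then have "entry q n i i = 0 \<or> entry q n i i = 1"
    using assms(2) unfolding is_projection_def by (metis mult_cancel_right1)
  then show "entry q n i j = entry (dproj {(n, i). entry q n i i = 1}) n i j"
    using n assms(1) by (auto simp: diagonals_iff)
qed

text \<open>An intermediate value \<open>t\<close> would split \<open>f\<close> into its normalised
  cut-downs by \<open>q\<close> and \<open>1 - q\<close>. They are states because the diagonal
  algebra is commutative; purity makes the first equal to \<open>f\<close>, yet it takes the value 1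
  at \<open>q\<close>.\<close>

lemma pure_state_dproj:
  assumes "pure_state diagonals f"
  shows "f (dproj Q) = 0 \<or> f (dproj Q) = 1"
proof (rule ccontr)
  assume neg: "\<not> ?thesis"
  interpret state_on diagonals f
    using assms star_subalgebra_diagonals by unfold_locales (auto simp: pure_state_def)
  define q where "q = dproj Q"
  have q: "q \<in> diagonals" "is_projection q" "adj q = q" "q * q = q"
    using dproj_projection[of Q] by (auto simp: q_def is_projection_def simp del: dproj_projection)
  define t where "t = Re (f q)"
  have fq: "f q = of_real t" using projection_range(1)[OF q(1,2)] by (simp add: t_def complex_eq_iff)
  have t: "0 < t" "t < 1"
    using projection_range[OF q(1,2)] neg fq unfolding t_def q_def
    by (auto simp: complex_eq_iff less_le)
  have state: "state diagonals (restrict (\<lambda>a. f (p * a) / of_real s) diagonals)"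
    if p: "p \<in> diagonals" "adj p = p" "p * p = p" "f p = of_real s" "0 < s" for p s
    unfolding state_def
  proof (intro conjI ballI allI)
    fix a b c assume a: "a \<in> diagonals" and b: "b \<in> diagonals"
    show "restrict (\<lambda>a. f (p * a) / of_real s) diagonals (a + b)
        = restrict (\<lambda>a. f (p * a) / of_real s) diagonals a + restrict (\<lambda>a. f (p * a) / of_real s) diagonals b"
      using a b p by (simp add: closed distrib_left add add_divide_distrib)
  next
    fix a c assume a: "a \<in> diagonals"
    show "restrict (\<lambda>a. f (p * a) / of_real s) diagonals (cscale c a)
        = c * restrict (\<lambda>a. f (p * a) / of_real s) diagonals a"
      using a p by (simp add: closed cscale_mult_right scale)
  next
    fix a assume a: "a \<in> diagonals"
    have "adj (p * a) * (p * a) = adj a * (p * p) * a" by (simp only: adj_mult p(2) mult.assoc)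
    also have "\<dots> = p * (adj a * a)"
      using diagonals_commute[of "adj a" p] a p(1) closed by (simp add: p(3) flip: mult.assoc)
    finally have "0 \<le> f (p * (adj a * a))" using pos[of "p * a"] a p closed by simp
    then show "0 \<le> restrict (\<lambda>a. f (p * a) / of_real s) diagonals (adj a * a)"
      using a p closed by (simp add: less_eq_complex_def)
  qed (use p closed in auto)
  define g where "g = restrict (\<lambda>a. f (q * a) / of_real t) diagonals"
  define h where "h = restrict (\<lambda>a. f ((1 - q) * a) / of_real (1 - t)) diagonals"
  have "state diagonals g" unfolding g_def using q fq t by (intro state) auto
  moreover have "state diagonals h"
    unfolding h_def using q fq t closed
    by (intro state) (auto simp: adj_diff algebra_simps diff one)
  moreover have "f a = of_real t * g a + of_real (1 - t) * h a" if a: "a \<in> diagonals" for a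
    using a q t closed by (simp add: g_def h_def left_diff_distrib diff flip: of_real_diff)
  ultimately have "g = f" using assms t unfolding pure_state_def by blast
  then have "f q = g q" by simp
  also have "\<dots> = 1" using q fq t by (simp add: g_def)
  finally show False using neg q_def by simp
qed

text \<open>On diagonal projections \<open>f\<close> acts as an ultrafilter on the
  positions.\<close>

lemma pure_state_partition:
  assumes "pure_state diagonals f" "finite J" "(\<Sum>j\<in>J. dproj (Q j)) = 1"
  shows "\<exists>j\<in>J. f (dproj (Q j)) = 1"
proof (rule ccontr)
  assume "\<not> ?thesis"
  then have "f (dproj (Q j)) = 0" if "j \<in> J" for j using pure_state_dproj[OF assms(1)] that by blast
  interpret state_on diagonals f
    using assms star_subalgebra_diagonals by unfold_locales (auto simp: pure_state_def)
  have "f (\<Sum>j\<in>J. dproj (Q j)) = (\<Sum>j\<in>J. f (dproj (Q j)))" by (rule sum) simp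
  also have "\<dots> = 0" using \<open>\<And>j. j \<in> J \<Longrightarrow> f (dproj (Q j)) = 0\<close> by simp
  finally show False using assms(3) one by simp
qed

text \<open>The diagonal entries of \<open>adj a * a\<close> are sums of squared moduli, so its
  diagonal part is a square within the diagonal algebra.\<close>

lemma state_cond_exp:
  assumes "state diagonals f"
  shows "state UNIV (\<lambda>a. f (cond_exp a))"
proof -
  interpret state_on diagonals f
    using assms star_subalgebra_diagonals by unfold_locales
  have "0 \<le> f (cond_exp (adj a * a))" for a
  proof -
    have "\<exists>b\<in>diagonals. cond_exp (adj a * a) = adj b * b"
    proof (rule diagonal_positive_factor[OF cond_exp_in_diagonals])
      fix n i :: nat assume "2 \<le> n" "i < n"
      then have "entry (cond_exp (adj a * a)) n i i = (\<Sum>k<n. of_real ((cmod (entry a n k i))\<^sup>2))"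
        by (simp add: complex_norm_square mult.commute del: of_real_power)
      then show "0 \<le> entry (cond_exp (adj a * a)) n i i"
        by (simp add: less_eq_complex_def sum_nonneg del: of_real_power)
    qed
    then show ?thesis using pos by metis
  qed
  then show ?thesis
    unfolding state_def
    by (auto simp: cond_exp_add cond_exp_cscale add scale one cond_exp_in_diagonals cond_exp_diagonal closed)
qed

section \<open>Uniqueness of extensions from paving\<close>

lemma entry_compress:
  assumes "2 \<le> n" "i < n" "j < n"
  shows "entry (dproj Q * a * dproj Q) n i j = (if (n, i) \<in> Q \<and> (n, j) \<in> Q then entry a n i j else 0)"
  using assms by (simp add: entry_mult_diagonal[OF dproj_diagonal] del: entry_mult)

lemma quad_form_compress:
  assumes "finite S" "T \<subseteq> S" "\<And>i j. i \<in> S \<Longrightarrow> j \<in> S \<Longrightarrow> K' i j = (if i \<in> T \<and> j \<in> T then K i j else 0)"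
  shows "quad_form S K' y = quad_form T K y"
  unfolding quad_form_subset[OF assms(1,2)]
  unfolding quad_form_def by (intro sum.cong refl) (auto simp: assms(3))

text \<open>Both \<open>c - a\<close> and \<open>c + a\<close> are positive, hence factor as
  squares; \<open>s\<close> runs over the two signs.\<close>

lemma state_norm_le_quad_form:
  assumes "adj a = a" "state UNIV g" "0 \<le> c"
    "\<And>n y. 2 \<le> n \<Longrightarrow> \<bar>Re (quad_form {..<n} (entry a n) y)\<bar> \<le> c * (\<Sum>i<n. (cmod (y i))\<^sup>2)"
  shows "cmod (g a) \<le> c"
proof -
  interpret state_on UNIV g
    using assms(2) star_subalgebra_UNIV by unfold_locales
  have herm: "cnj (entry a n i j) = entry a n j i" if "i < n" "j < n" for n i j
    using entry_adj[OF that(2,1), of a] assms(1) by simp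
  have "0 \<le> c - Re (of_real s * g a)" if s: "\<bar>s\<bar> = 1" for s :: real
  proof -
    have "\<exists>b. cscale (of_real c) 1 - cscale (of_real s) a = adj b * b"
    proof (rule positive_factor, rule psd_on_scalar_diff)
      fix n :: nat assume n: "2 \<le> n"
      show "entry (cscale (of_real c) 1 - cscale (of_real s) a) n i j
          = (if i = j then of_real c else 0) - of_real s * entry a n i j"
        if "i \<in> {..<n}" "j \<in> {..<n}" for i j
        using that n by auto
      show "of_real s * entry a n j i = cnj (of_real s * entry a n i j)"
        if "i \<in> {..<n}" "j \<in> {..<n}" for i j
        using that herm by simp
      fix y :: "nat \<Rightarrow> complex"
      have "quad_form {..<n} (\<lambda>i j. of_real s * entry a n i j) y = of_real s * quad_form {..<n} (entry a n) y"
        by (simp add: quad_form_def sum_distrib_left mult_ac)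
      then have "Re (quad_form {..<n} (\<lambda>i j. of_real s * entry a n i j) y)
          \<le> \<bar>s\<bar> * \<bar>Re (quad_form {..<n} (entry a n) y)\<bar>"
        by (simp flip: abs_mult)
      also have "\<dots> \<le> c * (\<Sum>i<n. (cmod (y i))\<^sup>2)" using assms(4)[OF n, of y] s by simp
      finally show "Re (quad_form {..<n} (\<lambda>i j. of_real s * entry a n i j) y) \<le> c * (\<Sum>i<n. (cmod (y i))\<^sup>2)" .
    qed auto
    then obtain b where "cscale (of_real c) 1 - cscale (of_real s) a = adj b * b" by blast
    then have "0 \<le> g (cscale (of_real c) 1 - cscale (of_real s) a)" using pos[of b] by simp
    then show ?thesis by (simp add: diff scale one less_eq_complex_def)
  qed
  from this[of 1] this[of "-1"] have "\<bar>Re (g a)\<bar> \<le> c" by simp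
  moreover have "Im (g a) = 0" using hermitian[of a] assms(1) by (simp add: complex_eq_iff)
  ultimately show ?thesis by (simp add: cmod_eq_Re)
qed

text \<open>Since \<open>r\<close> is the same for all coordinates, the colourings glue to
  \<open>r\<close> diagonal projections with sum 1. On the one where \<open>f\<close> is 1,
  \<open>g\<close> is 1 as well, so \<open>g\<close> sees only the corresponding small compression
  of \<open>a\<close>.\<close>

lemma pure_state_extension_eq_0:
  assumes uc: "\<And>\<eta>. 0 < \<eta> \<Longrightarrow> uniformly_colourable (1 + \<eta>)"
    and f: "pure_state diagonals f" and g: "state UNIV g" and ext: "\<forall>d\<in>diagonals. g d = f d"
    and a: "adj a = a" "cond_exp a = 0" "norm a \<le> 1"
  shows "g a = 0"
proof -
  interpret state_on UNIV g
    using g star_subalgebra_UNIV by unfold_locales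
  have "cmod (g a) \<le> \<eta>" if \<eta>: "0 < \<eta>" for \<eta>
  proof -
    obtain r where r: "\<And>(S :: nat set) K. zero_diag_contraction S K \<Longrightarrow> paved r S K \<eta>"
      using quad_form_paving[OF uc[OF \<eta>] \<eta>] by blast
    have "zero_diag_contraction {..<n} (entry a n)" if n: "2 \<le> n" for n
      unfolding zero_diag_contraction_def
    proof (intro conjI ballI allI)
      fix i j assume "i \<in> {..<n}" "j \<in> {..<n}"
      then show "entry a n j i = cnj (entry a n i j)"
        using entry_adj[of j n i a] a(1) by simp
    next
      fix i assume "i \<in> {..<n}"
      then show "entry a n i i = 0" using entry_cond_exp[of i n i a] a(2) by simp
    next
      fix y :: "nat \<Rightarrow> complex"
      have "\<bar>Re (quad_form {..<n} (entry a n) y)\<bar> \<le> norm a * (\<Sum>i<n. (cmod (y i))\<^sup>2)"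
        using quad_form_norm_le[OF n] abs_Re_le_cmod order.trans by blast
      also have "\<dots> \<le> 1 * (\<Sum>i<n. (cmod (y i))\<^sup>2)"
        using a(3) by (intro mult_right_mono) (auto simp: sum_nonneg)
      finally show "\<bar>Re (quad_form {..<n} (entry a n) y)\<bar> \<le> (\<Sum>i\<in>{..<n}. (cmod (y i))\<^sup>2)" by simp
    qed simp
    then have paved: "paved r {..<n} (entry a n) \<eta>" if "2 \<le> n" for n using r that by blast
    have "\<forall>n. \<exists>\<kappa>::nat \<Rightarrow> nat. 2 \<le> n \<longrightarrow> (\<forall>i\<in>{..<n}. \<kappa> i < r) \<and> (\<forall>j<r. \<forall>y. \<bar>Re (quad_form {i\<in>{..<n}. \<kappa> i = j} (entry a n) y)\<bar>
        \<le> \<eta> * (\<Sum>i\<in>{i\<in>{..<n}. \<kappa> i = j}. (cmod (y i))\<^sup>2))"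
    proof
      fix n show "\<exists>\<kappa>::nat \<Rightarrow> nat. 2 \<le> n \<longrightarrow> (\<forall>i\<in>{..<n}. \<kappa> i < r) \<and> (\<forall>j<r. \<forall>y. \<bar>Re (quad_form {i\<in>{..<n}. \<kappa> i = j} (entry a n) y)\<bar>
        \<le> \<eta> * (\<Sum>i\<in>{i\<in>{..<n}. \<kappa> i = j}. (cmod (y i))\<^sup>2))"
      proof (cases "2 \<le> n")
        case True
        from paved[OF this] show ?thesis unfolding paved_def by iprover
      qed simp
    qed
    from choice[OF this] obtain \<kappa> :: "nat \<Rightarrow> nat \<Rightarrow> nat" where
      *: "\<forall>n. 2 \<le> n \<longrightarrow> (\<forall>i\<in>{..<n}. \<kappa> n i < r) \<and> (\<forall>j<r. \<forall>y. \<bar>Re (quad_form {i\<in>{..<n}. \<kappa> n i = j} (entry a n) y)\<bar>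
        \<le> \<eta> * (\<Sum>i\<in>{i\<in>{..<n}. \<kappa> n i = j}. (cmod (y i))\<^sup>2))" ..
    have \<kappa>: "\<kappa> n i < r" if "2 \<le> n" "i < n" for n i using * that by blast
    have \<kappa>': "\<bar>Re (quad_form {i\<in>{..<n}. \<kappa> n i = j} (entry a n) y)\<bar>
        \<le> \<eta> * (\<Sum>i\<in>{i\<in>{..<n}. \<kappa> n i = j}. (cmod (y i))\<^sup>2)" if "2 \<le> n" "j < r" for n j y
      using * that by blast
    define Q where "Q j = {(n, i). \<kappa> n i = j}" for j
    have "(\<Sum>j<r. dproj (Q j)) = (\<Sum>j<r. dproj {p. \<kappa> (fst p) (snd p) = j})"
      by (simp add: Q_def split_def)
    also have "\<dots> = 1" using \<kappa> by (intro sum_dproj_partition) auto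
    finally have "(\<Sum>j<r. dproj (Q j)) = 1" .
    then obtain j where j: "j < r" "f (dproj (Q j)) = 1"
      using pure_state_partition[OF f, of "{..<r}" Q] by auto
    define q where "q = dproj (Q j)"
    have q: "g q = 1" "is_projection q" using j ext by (auto simp: q_def)
    have "cmod (g (q * a * q)) \<le> \<eta>"
    proof (rule state_norm_le_quad_form[OF _ g])
      show "adj (q * a * q) = q * a * q"
        using q(2) a(1) by (simp add: adj_mult is_projection_def mult.assoc)
      show "0 \<le> \<eta>" using \<eta> by simp
      fix n :: nat and y :: "nat \<Rightarrow> complex" assume n: "2 \<le> n"
      let ?T = "{i\<in>{..<n}. \<kappa> n i = j}"
      have "quad_form {..<n} (entry (q * a * q) n) y = quad_form ?T (entry a n) y"
        using n by (intro quad_form_compress) (auto simp: q_def Q_def entry_compress)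
      moreover have "(\<Sum>i\<in>?T. (cmod (y i))\<^sup>2) \<le> (\<Sum>i<n. (cmod (y i))\<^sup>2)"
        by (intro sum_mono2) auto
      then have "\<eta> * (\<Sum>i\<in>?T. (cmod (y i))\<^sup>2) \<le> \<eta> * (\<Sum>i<n. (cmod (y i))\<^sup>2)"
        using \<eta> by (intro mult_left_mono) auto
      ultimately show "\<bar>Re (quad_form {..<n} (entry (q * a * q) n) y)\<bar> \<le> \<eta> * (\<Sum>i<n. (cmod (y i))\<^sup>2)"
        using \<kappa>'[OF n j(1), of y] by simp
    qed
    then show ?thesis using projection_compress(3)[of a q] q by simp
  qed
  then have "cmod (g a) \<le> 0" by (rule field_le_epsilon[of _ 0, simplified]) 
  then show ?thesis by simp
qed

text \<open>The off-diagonal part \<open>y\<close> of \<open>x\<close> is recovered from the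
  self-adjoint elements \<open>y1\<close> and \<open>y2\<close>, which have zero diagonal and are
  rescaled to norm at most 1.\<close>

lemma unique_extension:
  assumes uc: "\<And>\<eta>. 0 < \<eta> \<Longrightarrow> uniformly_colourable (1 + \<eta>)"
    and f: "pure_state diagonals f" and g: "state UNIV g" and ext: "\<forall>d\<in>diagonals. g d = f d"
  shows "g = (\<lambda>a. f (cond_exp a))"
proof
  fix x
  interpret state_on UNIV g
    using g star_subalgebra_UNIV by unfold_locales
  have herm0: "g a = 0" if a: "adj a = a" "cond_exp a = 0" for a
  proof (cases "norm a = 0")
    case False
    define t where "t = complex_of_real (1 / norm a)"
    have "norm (cscale t a) \<le> 1"
    proof (rule norm_mseq_least)
      fix n :: nat assume "2 \<le> n"
      then have "opnorm (coord a n) \<le> norm a" by (rule coord_le_norm)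
      then show "opnorm (coord (cscale t a) n) \<le> 1"
        using False by (simp add: cscale.rep_eq opnorm_smult t_def norm_divide field_simps)
    qed
    moreover have "adj (cscale t a) = cscale t a" using a by (simp add: adj_cscale t_def)
    moreover have "cond_exp (cscale t a) = 0"
      using a by (simp add: cond_exp_cscale)
    ultimately have "g (cscale t a) = 0" by (intro pure_state_extension_eq_0[OF uc f g ext]) auto
    then show ?thesis using False by (simp add: scale t_def)
  qed (simp add: zero)
  define y where "y = x - cond_exp x"
  define y1 where "y1 = y + adj y"
  define y2 where "y2 = cscale \<i> (y - adj y)"
  have y0: "cond_exp y = 0" by (rule mseq_entryI) (simp add: y_def)
  have "cond_exp y1 = 0" "cond_exp y2 = 0"
    using y0 by (simp_all add: y1_def y2_def cond_exp_add cond_exp_diff cond_exp_cscale cond_exp_adj)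
  moreover have "adj y1 = y1" "adj y2 = y2"
    by (auto simp: y1_def y2_def adj_add adj_cscale adj_diff intro!: mseq_entryI simp: algebra_simps)
  ultimately have "g y1 = 0" "g y2 = 0" using herm0 by auto
  then have "g y + g (adj y) = 0" "g y - g (adj y) = 0"
    by (simp_all add: y1_def y2_def add diff scale)
  then have "g y = 0" by (simp add: complex_eq_iff)
  then have "g x = g (cond_exp x)" by (simp add: y_def diff)
  then show "g x = f (cond_exp x)" using ext cond_exp_in_diagonals by simp
qed

text \<open>Purity of \<open>f\<close> is applied to the restrictions. This is the reason why the
  extensions of a pure state form a face.\<close>

lemma pure_state_decomposition:
  assumes f: "pure_state diagonals f" and gh: "state UNIV g" "state UNIV h" and t: "0 < t" "t < 1"
    and comb: "\<forall>d\<in>diagonals. f d = complex_of_real t * g d + complex_of_real (1 - t) * h d"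
  shows "(\<forall>d\<in>diagonals. g d = f d) \<and> (\<forall>d\<in>diagonals. h d = f d)"
proof -
  have restr: "state diagonals (restrict u diagonals)" if "state UNIV u" for u
    using that diagonals_closed unfolding state_def by auto
  have "\<forall>a\<in>diagonals. f a = complex_of_real t * restrict g diagonals a + complex_of_real (1 - t) * restrict h diagonals a"
    using comb by simp
  then have "restrict g diagonals = f \<and> restrict h diagonals = f"
    using f gh t restr unfolding pure_state_def by blast
  then show ?thesis by (metis restrict_apply)
qed

text \<open>Uniqueness among all states, not only pure ones, makes the extension pure: the parts of
  any decomposition extend \<open>f\<close> themselves.\<close>

lemma pure_state_cond_exp:
  assumes f: "pure_state diagonals f"
    and uniq: "\<And>g. state UNIV g \<Longrightarrow> \<forall>d\<in>diagonals. g d = f d \<Longrightarrow> g = (\<lambda>a. f (cond_exp a))"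
  shows "pure_state UNIV (\<lambda>a. f (cond_exp a))"
  unfolding pure_state_def
proof (intro conjI allI impI)
  show "state UNIV (\<lambda>a. f (cond_exp a))"
    using f by (intro state_cond_exp) (simp add: pure_state_def)
  fix g h and t :: real
  assume *: "state UNIV g \<and> state UNIV h \<and> 0 < t \<and> t < 1 \<and>
    (\<forall>a\<in>UNIV. f (cond_exp a) = complex_of_real t * g a + complex_of_real (1 - t) * h a)"
  then have "\<forall>d\<in>diagonals. f d = complex_of_real t * g d + complex_of_real (1 - t) * h d"
    using cond_exp_diagonal by (metis UNIV_I)
  then have "(\<forall>d\<in>diagonals. g d = f d) \<and> (\<forall>d\<in>diagonals. h d = f d)"
    using pure_state_decomposition[OF f, of g h t] * by blast
  then show "g = (\<lambda>a. f (cond_exp a))" "h = (\<lambda>a. f (cond_exp a))"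
    using * uniq by blast+
qed

lemma unique_pure_extension:
  assumes uc: "\<And>\<eta>. 0 < \<eta> \<Longrightarrow> uniformly_colourable (1 + \<eta>)" and f: "pure_state diagonals f"
  shows "\<exists>!g. pure_state UNIV g \<and> (\<forall>d\<in>diagonals. g d = f d)"
proof (rule ex1I)
  have uniq: "g = (\<lambda>a. f (cond_exp a))" if "state UNIV g" "\<forall>d\<in>diagonals. g d = f d" for g
    using unique_extension[OF uc f that] .
  have "pure_state UNIV (\<lambda>a. f (cond_exp a))"
    by (rule pure_state_cond_exp[OF f]) (rule uniq)
  moreover have "\<forall>d\<in>diagonals. f (cond_exp d) = f d" by (simp add: cond_exp_diagonal)
  ultimately show "pure_state UNIV (\<lambda>a. f (cond_exp a)) \<and> (\<forall>d\<in>diagonals. f (cond_exp d) = f d)"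
    by blast
  fix g assume g: "pure_state UNIV g \<and> (\<forall>d\<in>diagonals. g d = f d)"
  then have "state UNIV g" unfolding pure_state_def by blast
  then show "g = (\<lambda>a. f (cond_exp a))" by (rule uniq) (use g in blast)
qed

section \<open>Pure states in faces\<close>

lemma continuous_eval [continuous_intros]: "continuous_on S (\<lambda>f :: mseq \<Rightarrow> complex. f a)"
  by (rule continuous_on_product_then_coordinatewise[OF continuous_on_id])

text \<open>In the topology of pointwise convergence each clause constrains finitely many values and
  is closed.\<close>

lemma closed_states: "closed {f. state A f}"
proof -
  have "{f. state A f} = (\<Inter>a\<in>-A. {f. f a = undefined}) \<inter> (\<Inter>a\<in>A. \<Inter>b\<in>A. {f. f (a + b) = f a + f b}) \<inter>
      (\<Inter>c. \<Inter>a\<in>A. {f. f (cscale c a) = c * f a}) \<inter>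
      (\<Inter>a\<in>A. {f. 0 \<le> Re (f (adj a * a))} \<inter> {f. Im (f (adj a * a)) = 0}) \<inter> {f. f 1 = 1}"
    unfolding state_def extensional_def less_eq_complex_def by auto
  moreover have "closed \<dots>"
    by (intro closed_Int closed_INT ballI closed_Collect_eq closed_Collect_le continuous_intros)
  ultimately show ?thesis by simp
qed

text \<open>The Banach-Alaoglu argument: states lie in a product of discs of radius
  \<open>norm a\<close>, compact by Tychonoff. Outside \<open>A\<close> the factor is the single
  value required by \<open>extensional\<close>.\<close>

lemma compact_states:
  assumes "star_subalgebra A"
  shows "compact {f. state A f}"
proof -
  let ?S = "\<lambda>a. if a \<in> A then cball 0 (norm a) else {undefined :: complex}"
  have "compactin (product_topology (\<lambda>_. euclidean) UNIV) (PiE UNIV ?S)"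
    unfolding compactin_PiE by (simp add: compactin_euclidean_iff)
  then have "compact (PiE UNIV ?S)"
    by (simp add: euclidean_product_topology compactin_euclidean_iff)
  then have "compact (PiE UNIV ?S \<inter> {f. state A f})"
    by (rule compact_Int_closed) (rule closed_states)
  moreover have "{f. state A f} \<subseteq> PiE UNIV ?S"
  proof clarify
    fix f assume f: "state A f"
    interpret state_on A f using assms f by unfold_locales
    show "f \<in> PiE UNIV ?S"
      using norm_le f by (auto simp: state_def extensional_def)
  qed
  ultimately show ?thesis by (simp add: Int_absorb1)
qed

section \<open>Closed faces of the state space\<close>

definition state_face :: "mseq set \<Rightarrow> (mseq \<Rightarrow> complex) set \<Rightarrow> bool" where
  "state_face A F \<longleftrightarrow> F \<subseteq> {f. state A f} \<and> closed F \<and> F \<noteq> {} \<and>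
     (\<forall>f\<in>F. \<forall>g h t. state A g \<and> state A h \<and> 0 < t \<and> t < 1 \<and>
        (\<forall>a\<in>A. f a = complex_of_real t * g a + complex_of_real (1 - t) * h a) \<longrightarrow> g \<in> F \<and> h \<in> F)"

lemma state_faceD:
  assumes "state_face A F"
  shows "F \<subseteq> {f. state A f}" "closed F" "F \<noteq> {}"
    "f \<in> F \<Longrightarrow> state A g \<Longrightarrow> state A h \<Longrightarrow> 0 < t \<Longrightarrow> t < 1 \<Longrightarrow>
       (\<forall>a\<in>A. f a = complex_of_real t * g a + complex_of_real (1 - t) * h a) \<Longrightarrow> g \<in> F \<and> h \<in> F"
  using assms unfolding state_face_def by blast+

text \<open>If a proper convex combination attains the maximum of a real linear functional on
  \<open>F\<close>, both of its parts attain it.\<close>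

lemma state_face_maximum:
  assumes alg: "star_subalgebra A" and F: "state_face A F" and a: "a \<in> A"
  shows "state_face A {h\<in>F. \<forall>k\<in>F. Re (c * k a) \<le> Re (c * h a)}" (is "state_face A ?M")
proof -
  note FD = state_faceD[OF F]
  have "compact F" using compact_Int_closed[OF compact_states[OF alg] FD(2)] FD(1) by (simp add: Int_absorb1)
  moreover have "continuous_on F (\<lambda>h. Re (c * h a))" by (intro continuous_intros)
  ultimately obtain m where m: "m \<in> F" "\<And>k. k \<in> F \<Longrightarrow> Re (c * k a) \<le> Re (c * m a)"
    using continuous_attains_sup[OF _ FD(3)] by blast
  have M: "?M = F \<inter> {h. Re (c * m a) \<le> Re (c * h a)}"
    using m order.trans by blast
  have "closed ?M"
    unfolding M by (intro closed_Int FD(2) closed_Collect_le continuous_intros)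
  moreover have "g \<in> ?M \<and> h \<in> ?M"
    if f: "f \<in> ?M" and gh: "state A g" "state A h" and t: "0 < t" "t < 1"
      and comb: "\<forall>a\<in>A. f a = complex_of_real t * g a + complex_of_real (1 - t) * h a" for f g h t
  proof -
    have gF: "g \<in> F" "h \<in> F" using FD(4)[OF _ gh t comb] f by auto
    have le: "Re (c * g a) \<le> Re (c * m a)" "Re (c * h a) \<le> Re (c * m a)" using m(2) gF by auto
    have "c * f a = of_real t * (c * g a) + of_real (1 - t) * (c * h a)"
      using bspec[OF comb a] by (simp only: distrib_left mult.left_commute)
    then have "Re (c * f a) = t * Re (c * g a) + (1 - t) * Re (c * h a)"
      by (simp only: plus_complex.sel times_complex.sel Re_complex_of_real Im_complex_of_real
          mult_zero_left diff_zero)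
    moreover have "Re (c * m a) \<le> Re (c * f a)" using f unfolding M by auto
    ultimately have *: "t * (Re (c * m a) - Re (c * g a)) + (1 - t) * (Re (c * m a) - Re (c * h a)) \<le> 0"
      by (simp add: algebra_simps)
    have "0 \<le> t * (Re (c * m a) - Re (c * g a))" "0 \<le> (1 - t) * (Re (c * m a) - Re (c * h a))"
      using t le by auto
    then have "t * (Re (c * m a) - Re (c * g a)) \<le> 0" "(1 - t) * (Re (c * m a) - Re (c * h a)) \<le> 0"
      using * by linarith+
    then have "Re (c * m a) \<le> Re (c * g a)" "Re (c * m a) \<le> Re (c * h a)"
      using t by (auto simp: mult_le_0_iff)
    then show ?thesis unfolding M using gF by auto
  qed
  moreover have "?M \<noteq> {}" using m by blast
  moreover have "?M \<subseteq> {f. state A f}" using FD(1) by blast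
  ultimately show ?thesis unfolding state_face_def by blast
qed

text \<open>A finite nonempty subchain contains its own intersection, so the finite intersection
  property holds and compactness gives a common point.\<close>

lemma state_face_Inter_chain:
  assumes alg: "star_subalgebra A" and C: "C \<noteq> {}" "\<And>F. F \<in> C \<Longrightarrow> state_face A F"
    "\<And>F G. F \<in> C \<Longrightarrow> G \<in> C \<Longrightarrow> F \<subseteq> G \<or> G \<subseteq> F"
  shows "state_face A (\<Inter>C)"
proof -
  have "{f. state A f} \<inter> \<Inter>C \<noteq> {}"
  proof (rule compact_imp_fip[OF compact_states[OF alg]])
    show "closed T" if "T \<in> C" for T using state_faceD(2)[OF C(2)[OF that]] .
    fix B assume B: "finite B" "B \<subseteq> C"
    show "{f. state A f} \<inter> \<Inter>B \<noteq> {}"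
    proof (cases "B = {}")
      case True
      obtain F0 where "F0 \<in> C" using C(1) by blast
      then show ?thesis using True state_faceD(1,3)[OF C(2), of F0] by auto
    next
      case False
      from B(1) False B(2) have "\<Inter>B \<in> B"
      proof (induction B rule: finite_ne_induct)
        case (insert F B)
        then have "\<Inter>B \<in> B" by simp
        then have "F \<subseteq> \<Inter>B \<or> \<Inter>B \<subseteq> F" using C(3) insert.prems by auto
        then have "\<Inter>(insert F B) = F \<or> \<Inter>(insert F B) = \<Inter>B" by auto
        then show ?case using \<open>\<Inter>B \<in> B\<close> by (elim disjE) (simp_all only: insert_iff simp_thms)
      qed simp
      then have "\<Inter>B \<in> C" using B(2) by (rule subsetD[rotated])
      then show ?thesis using state_faceD(1,3)[OF C(2), of "\<Inter>B"] by blast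
    qed
  qed
  then have "\<Inter>C \<noteq> {}" by blast
  moreover obtain F0 where "F0 \<in> C" using C(1) by blast
  then have "\<Inter>C \<subseteq> {f. state A f}" using state_faceD(1)[OF C(2), of F0] by blast
  moreover have "closed (\<Inter>C)" by (intro closed_Inter ballI state_faceD(2)[OF C(2)])
  moreover have "g \<in> \<Inter>C \<and> h \<in> \<Inter>C"
    if "f \<in> \<Inter>C" "state A g" "state A h" "0 < t" "t < 1"
      "\<forall>a\<in>A. f a = complex_of_real t * g a + complex_of_real (1 - t) * h a" for f g h t
  proof -
    have "g \<in> F \<and> h \<in> F" if "F \<in> C" for F
      by (rule state_faceD(4)[OF C(2)[OF that], of f g h t]) (use \<open>f \<in> \<Inter>C\<close> that in blast, fact+)
    then show ?thesis by blast
  qed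
  ultimately show ?thesis unfolding state_face_def by blast
qed

text \<open>The Krein--Milman argument: a minimal closed face is a single pure state.\<close>

lemma state_face_contains_pure:
  assumes alg: "star_subalgebra A" and F: "state_face A F"
  shows "\<exists>f\<in>F. pure_state A f"
proof -
  \<comment> \<open>Complements are used because the available form of Zorn's lemma yields maximal
    sets.\<close>
  define \<F> where "\<F> = {- G | G. state_face A G \<and> G \<subseteq> F}"
  have "\<exists>M\<in>\<F>. \<forall>X\<in>\<F>. M \<subseteq> X \<longrightarrow> X = M"
  proof (rule subset_Zorn_nonempty)
    show "\<F> \<noteq> {}" using F by (auto simp: \<F>_def)
    fix C assume C: "C \<noteq> {}" "subset.chain \<F> C"
    have "state_face A (\<Inter>(uminus ` C))"
    proof (rule state_face_Inter_chain[OF alg])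
      show "uminus ` C \<noteq> {}" using C by auto
      have "C \<subseteq> \<F>" and chain: "\<forall>x\<in>C. \<forall>y\<in>C. x \<subseteq> y \<or> y \<subseteq> x"
        using C(2) by (auto simp: subset_chain_def)
      then show "state_face A G" if "G \<in> uminus ` C" for G
        using that unfolding \<F>_def by auto
      show "G \<subseteq> H \<or> H \<subseteq> G" if "G \<in> uminus ` C" "H \<in> uminus ` C" for G H
        using that chain by auto
    qed
    moreover have "\<Inter>(uminus ` C) \<subseteq> F"
    proof -
      obtain X where X: "X \<in> C" using C(1) by blast
      moreover have "C \<subseteq> \<F>" using C(2) by (simp add: subset_chain_def)
      ultimately obtain G where "X = - G" "G \<subseteq> F" unfolding \<F>_def by blast
      then show ?thesis using X by auto
    qed
    moreover have "\<Union>C = - \<Inter>(uminus ` C)" by auto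
    ultimately show "\<Union>C \<in> \<F>" unfolding \<F>_def by blast
  qed
  then obtain M' where M': "M' \<in> \<F>" "\<forall>X\<in>\<F>. M' \<subseteq> X \<longrightarrow> X = M'" by (rule bexE)
  then obtain M where M: "state_face A M" "M \<subseteq> F" "M' = - M" unfolding \<F>_def by blast
  have min: "X = M" if X: "state_face A X" "X \<subseteq> M" for X
  proof -
    have "- X \<in> \<F>" unfolding \<F>_def using X M(2) by blast
    moreover have "M' \<subseteq> - X" using X(2) M(3) by blast
    ultimately have "- X = - M" using M'(2) M(3) by blast
    then show ?thesis by blast
  qed
  obtain f where f: "f \<in> M" using state_faceD(3)[OF M(1)] by blast
  have single: "g = f" if g: "g \<in> M" for g
  proof (rule ccontr)
    assume "g \<noteq> f"
    then obtain a where a: "g a \<noteq> f a" by blast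
    have "state A f" "state A g" using state_faceD(1)[OF M(1)] f g by auto
    then have "a \<in> A" using a unfolding state_def extensional_def by force
    \<comment> \<open>With this factor the values of the functional at \<open>f\<close> and
      \<open>g\<close> differ by the squared modulus of \<open>f a - g a\<close>, while minimality
      of \<open>M\<close> makes every point of \<open>M\<close> a maximum.\<close>
    define c where "c = cnj (f a - g a)"
    have "{h\<in>M. \<forall>k\<in>M. Re (c * k a) \<le> Re (c * h a)} = M"
      by (rule min[OF state_face_maximum[OF alg M(1) \<open>a \<in> A\<close>]]) auto
    then have "Re (c * f a) \<le> Re (c * g a)" using f g by blast
    then have "Re (c * (f a - g a)) \<le> 0" by (simp add: right_diff_distrib)
    moreover have "c * (f a - g a) = of_real ((cmod (f a - g a))\<^sup>2)"
      unfolding c_def complex_norm_square by (rule mult.commute)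
    ultimately show False using a by simp
  qed
  have "pure_state A f"
    unfolding pure_state_def
  proof (intro conjI allI impI)
    show "state A f" using state_faceD(1)[OF M(1)] f by auto
    fix g h t
    assume "state A g \<and> state A h \<and> 0 < t \<and> t < 1 \<and>
      (\<forall>a\<in>A. f a = complex_of_real t * g a + complex_of_real (1 - t) * h a)"
    then have "g \<in> M \<and> h \<in> M" using state_faceD(4)[OF M(1) f, of g h t] by blast
    then show "g = f" "h = f" using single by auto
  qed
  then show ?thesis using f M(2) by blast
qed

section \<open>Paving from unique extensions\<close>

lemma norm_dproj_le: "norm (dproj Q) \<le> 1"
  by (rule norm_diagonal_le) auto

section \<open>From quadratic forms to norms\<close>

lemma quad_form_polarization:
  "quad_form S K (\<lambda>i. y i + of_real s * z i) - quad_form S K (\<lambda>i. y i - of_real s * z i)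
     = 2 * of_real s * ((\<Sum>i\<in>S. \<Sum>j\<in>S. cnj (y i) * K i j * z j) + (\<Sum>i\<in>S. \<Sum>j\<in>S. cnj (z i) * K i j * y j))"
  unfolding quad_form_def sum_subtractf[symmetric] sum.distrib[symmetric] sum_distrib_left
  by (intro sum.cong refl) (simp add: algebra_simps)

lemma sum_parallelogram:
  fixes y z :: "'a \<Rightarrow> complex"
  shows "(\<Sum>i\<in>S. (cmod (y i + of_real s * z i))\<^sup>2) + (\<Sum>i\<in>S. (cmod (y i - of_real s * z i))\<^sup>2)
    = 2 * (\<Sum>i\<in>S. (cmod (y i))\<^sup>2) + 2 * s\<^sup>2 * (\<Sum>i\<in>S. (cmod (z i))\<^sup>2)"
  unfolding sum.distrib[symmetric] sum_distrib_left
  by (intro sum.cong refl) (simp only: cmod_power2 plus_complex.sel minus_complex.sel times_complex.sel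
      Re_complex_of_real Im_complex_of_real, simp add: power2_eq_square algebra_simps)

text \<open>The numerical radius of a Hermitian matrix bounds its norm. For \<open>z = K y\<close>,
  polarisation and the parallelogram law give
  \<open>4 * s * Z \<le> c * (2 * Y + 2 * s\<^sup>2 * Z)\<close>; the choice
  \<open>s = 1 / c\<close> lets half of the left side absorb the term in \<open>Z\<close>.\<close>

lemma hermitian_bessel:
  assumes herm: "\<And>i j. i \<in> S \<Longrightarrow> j \<in> S \<Longrightarrow> K j i = cnj (K i j)" and c: "0 < c"
    and bd: "\<And>y. \<bar>Re (quad_form S K y)\<bar> \<le> c * (\<Sum>i\<in>S. (cmod (y i))\<^sup>2)"
  shows "bessel S S K (c\<^sup>2)"
  unfolding bessel_def
proof
  fix y
  define z where "z i = (\<Sum>j\<in>S. K i j * y j)" for i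
  define s where "s = 1 / c"
  define Y where "Y = (\<Sum>i\<in>S. (cmod (y i))\<^sup>2)"
  define Z where "Z = (\<Sum>i\<in>S. (cmod (z i))\<^sup>2)"
  have 1: "(\<Sum>i\<in>S. \<Sum>j\<in>S. cnj (z i) * K i j * y j) = of_real Z"
  proof -
    have "(\<Sum>i\<in>S. \<Sum>j\<in>S. cnj (z i) * K i j * y j) = (\<Sum>i\<in>S. z i * cnj (z i))"
      by (intro sum.cong refl, subst (2) z_def) (simp add: sum_distrib_left sum_distrib_right mult_ac)
    then show ?thesis by (simp only: Z_def of_real_sum complex_norm_square)
  qed
  have 2: "(\<Sum>i\<in>S. \<Sum>j\<in>S. cnj (y i) * K i j * z j) = of_real Z"
  proof -
    have "(\<Sum>i\<in>S. \<Sum>j\<in>S. cnj (y i) * K i j * z j) = (\<Sum>i\<in>S. \<Sum>j\<in>S. z j * cnj (K j i * y i))"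
      by (intro sum.cong refl) (use herm in \<open>metis complex_cnj_mult mult.commute mult.left_commute\<close>)
    also have "\<dots> = (\<Sum>j\<in>S. z j * cnj (z j))"
    proof -
      have "cnj (z j) = (\<Sum>i\<in>S. cnj (K j i * y i))" for j by (simp only: z_def cnj_sum)
      then show ?thesis unfolding sum_distrib_left by (simp only: sum_distrib_left) (rule sum.swap)
    qed
    finally show ?thesis by (simp only: Z_def of_real_sum complex_norm_square)
  qed
  have "quad_form S K (\<lambda>i. y i + of_real s * z i) - quad_form S K (\<lambda>i. y i - of_real s * z i)
     = of_real (4 * s * Z)"
    unfolding quad_form_polarization 1 2 by simp
  from arg_cong[OF this, of Re]
  have "4 * s * Z = Re (quad_form S K (\<lambda>i. y i + of_real s * z i)) - Re (quad_form S K (\<lambda>i. y i - of_real s * z i))"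
    by simp
  also have "\<dots> \<le> c * (\<Sum>i\<in>S. (cmod (y i + of_real s * z i))\<^sup>2) + c * (\<Sum>i\<in>S. (cmod (y i - of_real s * z i))\<^sup>2)"
    using bd[of "\<lambda>i. y i + of_real s * z i"] bd[of "\<lambda>i. y i - of_real s * z i"] by linarith
  also have "\<dots> = c * (2 * Y + 2 * s\<^sup>2 * Z)"
    unfolding distrib_left[symmetric] sum_parallelogram Y_def Z_def ..
  finally have "Z \<le> c\<^sup>2 * Y" using c by (simp add: s_def power2_eq_square field_simps)
  then show "(\<Sum>i\<in>S. (cmod (\<Sum>j\<in>S. K i j * y j))\<^sup>2) \<le> c\<^sup>2 * (\<Sum>j\<in>S. (cmod (y j))\<^sup>2)"
    by (simp add: Z_def Y_def z_def)
qed

section \<open>Extensions that detect a large compression\<close>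

lemma vector_state:
  assumes n: "2 \<le> n" and y: "0 < (\<Sum>i<n. (cmod (y i))\<^sup>2)"
  shows "state UNIV (\<lambda>a. quad_form {..<n} (entry a n) y / of_real (\<Sum>i<n. (cmod (y i))\<^sup>2))"
  unfolding state_def
proof (intro conjI ballI allI)
  fix a b :: mseq and c :: complex
  let ?N = "complex_of_real (\<Sum>i<n. (cmod (y i))\<^sup>2)"
  show "quad_form {..<n} (entry (a + b) n) y / ?N = quad_form {..<n} (entry a n) y / ?N + quad_form {..<n} (entry b n) y / ?N"
    unfolding add_divide_distrib[symmetric] quad_form_def sum.distrib[symmetric]
    by (intro arg_cong[where f = "\<lambda>x. x / ?N"] sum.cong refl) (simp add: algebra_simps)
  have "quad_form {..<n} (entry (cscale c a) n) y = c * quad_form {..<n} (entry a n) y"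
    unfolding quad_form_def sum_distrib_left by (intro sum.cong refl) simp
  then show "quad_form {..<n} (entry (cscale c a) n) y / ?N = c * (quad_form {..<n} (entry a n) y / ?N)" by simp
  have "quad_form {..<n} (entry (adj a * a) n) y = of_real (\<Sum>e<n. (cmod (\<Sum>d<n. entry a n e d * y d))\<^sup>2)"
    unfolding gram_quadratic_form[symmetric] quad_form_def by (intro sum.cong refl) simp
  then have "quad_form {..<n} (entry (adj a * a) n) y / ?N
      = of_real ((\<Sum>e<n. (cmod (\<Sum>d<n. entry a n e d * y d))\<^sup>2) / (\<Sum>i<n. (cmod (y i))\<^sup>2))"
    by (simp only: of_real_divide)
  moreover have "0 \<le> (\<Sum>e<n. (cmod (\<Sum>d<n. entry a n e d * y d))\<^sup>2) / (\<Sum>i<n. (cmod (y i))\<^sup>2)"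
    by (intro divide_nonneg_nonneg sum_nonneg) auto
  ultimately show "0 \<le> quad_form {..<n} (entry (adj a * a) n) y / ?N"
    by (simp only: less_eq_complex_def Re_complex_of_real Im_complex_of_real zero_complex.sel)
  have "quad_form {..<n} (entry 1 n) y = (\<Sum>i<n. y i * cnj (y i))"
    unfolding quad_form_def
  proof (intro sum.cong refl)
    fix i assume i: "i \<in> {..<n}"
    have "(\<Sum>j<n. cnj (y i) * entry 1 n i j * y j) = (\<Sum>j<n. if j = i then y i * cnj (y i) else 0)"
      using i n by (intro sum.cong) auto
    then show "(\<Sum>j<n. cnj (y i) * entry 1 n i j * y j) = y i * cnj (y i)" using i by simp
  qed
  also have "\<dots> = ?N" by (simp only: of_real_sum complex_norm_square)
  finally have "quad_form {..<n} (entry 1 n) y = ?N" .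
  moreover have "?N \<noteq> 0" using y unfolding of_real_eq_0_iff by linarith
  ultimately show "quad_form {..<n} (entry 1 n) y / ?N = 1" by (metis divide_self)
qed simp

text \<open>Some vector detects the norm of the compression through its quadratic form. Cut off to
  \<open>Q\<close> it yields a vector state that is 1 on the projection and still has a large value
  at \<open>x\<close>.\<close>

lemma state_of_large_compression:
  assumes x: "adj x = x" and c: "0 < c" and large: "c < norm (dproj Q * x * dproj Q)"
  shows "\<exists>g. state UNIV g \<and> g (dproj Q) = 1 \<and> c \<le> cmod (g x)"
proof -
  let ?z = "dproj Q * x * dproj Q"
  have q: "adj (dproj Q) = dproj Q" using dproj_projection[of Q] unfolding is_projection_def by blast
  have z: "adj ?z = ?z" by (simp add: adj_mult x q mult.assoc)
  have "\<exists>n\<ge>2. \<exists>y. c * (\<Sum>i<n. (cmod (y i))\<^sup>2) < \<bar>Re (quad_form {..<n} (entry ?z n) y)\<bar>"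
  proof (rule ccontr)
    assume "\<not> ?thesis"
    then have bd: "\<bar>Re (quad_form {..<n} (entry ?z n) y)\<bar> \<le> c * (\<Sum>i<n. (cmod (y i))\<^sup>2)" if "2 \<le> n" for n y
      using that not_le by blast
    have "norm ?z \<le> c"
    proof (rule norm_le_bessel)
      fix n :: nat assume n: "2 \<le> n"
      show "bessel {..<n} {..<n} (entry ?z n) (c\<^sup>2)"
      proof (rule hermitian_bessel[OF _ c bd[OF n]])
        fix i j assume "i \<in> {..<n}" "j \<in> {..<n}"
        then show "entry ?z n j i = cnj (entry ?z n i j)"
          using entry_adj[of j n i ?z] unfolding z by simp
      qed
    qed (use c in simp)
    then show False using large by simp
  qed
  then obtain n y where n: "2 \<le> n" and y: "c * (\<Sum>i<n. (cmod (y i))\<^sup>2) < \<bar>Re (quad_form {..<n} (entry ?z n) y)\<bar>"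
    by blast
  define T where "T = {i\<in>{..<n}. (n, i) \<in> Q}"
  have T: "T \<subseteq> {..<n}" by (auto simp: T_def)
  \<comment> \<open>The cut-off keeps the form of the compression and can only decrease the norm;
    the strict inequality rules out \<open>w = 0\<close>.\<close>
  define w where "w i = (if i \<in> T then y i else 0)" for i
  define N where "N = (\<Sum>i<n. (cmod (w i))\<^sup>2)"
  have N0: "0 \<le> N" by (simp add: N_def sum_nonneg)
  have "quad_form {..<n} (entry ?z n) y = quad_form T (entry x n) y"
    using n by (intro quad_form_compress T) (auto simp: entry_compress T_def)
  also have "\<dots> = quad_form {..<n} (entry x n) w"
    unfolding w_def by (rule quad_form_subset[OF _ T]) simp
  finally have qf: "quad_form {..<n} (entry ?z n) y = quad_form {..<n} (entry x n) w" .
  have "N = (\<Sum>i\<in>T. (cmod (y i))\<^sup>2)"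
    unfolding N_def w_def by (rule sum_norm_subset[OF _ T]) simp
  also have "\<dots> \<le> (\<Sum>i<n. (cmod (y i))\<^sup>2)" using T by (intro sum_mono2) auto
  finally have "c * N \<le> c * (\<Sum>i<n. (cmod (y i))\<^sup>2)" using c by (intro mult_left_mono) auto
  then have big: "c * N < \<bar>Re (quad_form {..<n} (entry x n) w)\<bar>" using y unfolding qf by linarith
  have Npos: "0 < N"
  proof (rule ccontr)
    assume "\<not> 0 < N"
    then have "N = 0" using N0 by simp
    then have "w i = 0" if "i < n" for i using that unfolding N_def by (simp add: sum_nonneg_eq_0_iff)
    then have "quad_form {..<n} (entry x n) w = 0" unfolding quad_form_def by simp
    then show False using big \<open>N = 0\<close> by simp
  qed
  define g where "g a = quad_form {..<n} (entry a n) w / of_real N" for a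
  have "state UNIV g" unfolding g_def[abs_def] N_def by (rule vector_state[OF n]) (use Npos N_def in simp)
  moreover have "g (dproj Q) = 1"
  proof -
    have "quad_form {..<n} (entry (dproj Q) n) w = (\<Sum>i<n. w i * cnj (w i))"
      unfolding quad_form_def
    proof (intro sum.cong refl)
      fix i assume i: "i \<in> {..<n}"
      have "(\<Sum>j<n. cnj (w i) * entry (dproj Q) n i j * w j) = (\<Sum>j<n. if j = i then w i * cnj (w i) else 0)"
        using i n by (intro sum.cong) (auto simp: w_def T_def)
      then show "(\<Sum>j<n. cnj (w i) * entry (dproj Q) n i j * w j) = w i * cnj (w i)" using i by simp
    qed
    also have "\<dots> = of_real N" by (simp only: N_def of_real_sum complex_norm_square)
    finally show ?thesis using Npos by (simp add: g_def)
  qed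
  moreover have "c \<le> cmod (g x)"
  proof -
    have "c * N \<le> cmod (quad_form {..<n} (entry x n) w)"
      using big abs_Re_le_cmod[of "quad_form {..<n} (entry x n) w"] by linarith
    then show ?thesis using Npos by (simp add: g_def norm_divide field_simps)
  qed
  ultimately show ?thesis by blast
qed

text \<open>A finite cover of a disc by \<epsilon>-balls sorts the positions by the value of
  \<open>d\<close>, and \<open>f\<close> takes the value 1 on one class.\<close>

lemma pure_state_locally_constant:
  assumes f: "pure_state diagonals f" and \<epsilon>: "0 < \<epsilon>"
  shows "\<exists>Q c. f (dproj Q) = 1 \<and> (\<forall>n\<ge>2. \<forall>i<n. (n, i) \<in> Q \<longrightarrow> cmod (entry d n i i - c) \<le> \<epsilon>)"
proof -
  have "\<exists>C. finite C \<and> cball (0::complex) (norm d) \<subseteq> (\<Union>c\<in>C. ball c \<epsilon>)"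
  proof (rule compactE_image[of "cball (0::complex) (norm d)" UNIV "\<lambda>c. ball c \<epsilon>"])
    have "z \<in> ball z \<epsilon>" for z :: complex using \<epsilon> by (simp only: centre_in_ball)
    then show "cball (0::complex) (norm d) \<subseteq> (\<Union>c\<in>UNIV. ball c \<epsilon>)" by blast
    fix C assume "finite C" "cball (0::complex) (norm d) \<subseteq> (\<Union>c\<in>C. ball c \<epsilon>)"
    then show ?thesis by (intro exI[of _ C] conjI)
  qed (rule compact_cball, rule open_ball)
  then obtain C where C: "finite C" "cball (0::complex) (norm d) \<subseteq> (\<Union>c\<in>C. ball c \<epsilon>)"
    by blast
  define k where "k p = (SOME c. c \<in> C \<and> dist c (entry d (fst p) (snd p) (snd p)) < \<epsilon>)" for p
  have k: "k (n, i) \<in> C \<and> dist (k (n, i)) (entry d n i i) < \<epsilon>" if "2 \<le> n" "i < n" for n i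
  proof -
    have "entry d n i i \<in> cball 0 (norm d)" using norm_entry_le[OF that that(2)] by simp
    then have "entry d n i i \<in> (\<Union>c\<in>C. ball c \<epsilon>)" using C(2) by (rule subsetD[rotated])
    then have "\<exists>c. c \<in> C \<and> dist c (entry d n i i) < \<epsilon>" unfolding UN_iff mem_ball by (elim bexE) (intro exI conjI)
    from someI_ex[OF this] show ?thesis unfolding k_def by simp
  qed
  have "(\<Sum>c\<in>C. dproj {p. k p = c}) = 1" using k by (intro sum_dproj_partition C) auto
  from pure_state_partition[OF f C(1) this] obtain c where c: "c \<in> C" "f (dproj {p. k p = c}) = 1" by blast
  have "cmod (entry d n i i - c) \<le> \<epsilon>" if "2 \<le> n" "i < n" "(n, i) \<in> {p. k p = c}" for n i
    using k[OF that(1,2)] that(3) by (simp add: dist_norm norm_minus_commute)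
  then show ?thesis using c by blast
qed

text \<open>Compressing \<open>d - c\<close> by the projection does not change its value under
  \<open>f\<close>, but reduces its norm to at most \<epsilon>.\<close>

lemma (in state_on) near_constant:
  assumes "dproj Q \<in> A" "f (dproj Q) = 1" "d \<in> A" "d \<in> diagonals" "0 \<le> \<epsilon>"
    "\<And>n i. 2 \<le> n \<Longrightarrow> i < n \<Longrightarrow> (n, i) \<in> Q \<Longrightarrow> cmod (entry d n i i - c) \<le> \<epsilon>"
  shows "cmod (f d - c) \<le> \<epsilon>"
proof -
  define e where "e = d - cscale c 1"
  have e: "e \<in> A" "e \<in> diagonals"
    using assms closed star_subalgebra_closed[OF star_subalgebra_diagonals] by (auto simp: e_def)
  have "norm (dproj Q * e) \<le> \<epsilon>"
  proof (rule norm_diagonal_le)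
    show "dproj Q * e \<in> diagonals" using e diagonals_closed by simp
    fix n i :: nat assume n: "2 \<le> n" "i < n"
    show "cmod (entry (dproj Q * e) n i i) \<le> \<epsilon>"
      using n assms(5,6) by (auto simp: entry_mult_diagonal(1)[OF dproj_diagonal] e_def simp del: entry_mult)
  qed (rule assms(5))
  moreover have "f e = f (dproj Q * e)"
    using projection_compress(1)[OF e(1) assms(1) dproj_projection assms(2)] by simp
  ultimately have "cmod (f e) \<le> \<epsilon>" using norm_le[of "dproj Q * e"] e assms closed by simp
  then show ?thesis using assms closed by (simp add: e_def diff scale one)
qed

text \<open>Both states are close to the same constant on a set where \<open>f\<close> is 1, so a
  pure state is determined by the projections on which it is 1.\<close>

lemma extension_if_eq_1_on_dproj:
  assumes f: "pure_state diagonals f" and g: "state UNIV g"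
    and eq: "\<And>Q. f (dproj Q) = 1 \<Longrightarrow> g (dproj Q) = 1" and d: "d \<in> diagonals"
  shows "g d = f d"
proof -
  interpret f: state_on diagonals f
    using f star_subalgebra_diagonals by unfold_locales (auto simp: pure_state_def)
  interpret g: state_on UNIV g
    using g star_subalgebra_UNIV by unfold_locales
  have "dist (g d) (f d) \<le> 0 + \<epsilon>" if \<epsilon>: "0 < \<epsilon>" for \<epsilon>
  proof -
    have "0 < \<epsilon> / 2" using \<epsilon> by simp
    from pure_state_locally_constant[OF f this] obtain Q c where Q: "f (dproj Q) = 1"
      "\<And>n i. 2 \<le> n \<Longrightarrow> i < n \<Longrightarrow> (n, i) \<in> Q \<Longrightarrow> cmod (entry d n i i - c) \<le> \<epsilon> / 2" by blast
    have "cmod (f d - c) \<le> \<epsilon> / 2" using \<epsilon> Q d by (intro f.near_constant[of Q]) auto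
    moreover have "cmod (g d - c) \<le> \<epsilon> / 2" using \<epsilon> Q d eq by (intro g.near_constant[of Q]) auto
    ultimately show ?thesis
      using dist_triangle2[of "g d" "f d" c] by (simp add: dist_norm)
  qed
  then have "dist (g d) (f d) \<le> 0" by (rule field_le_epsilon)
  then show ?thesis by simp
qed

lemma pure_state_dproj_Inter:
  assumes f: "pure_state diagonals f" and "finite \<Q>" "\<And>Q. Q \<in> \<Q> \<Longrightarrow> f (dproj Q) = 1"
  shows "f (dproj (\<Inter>\<Q>)) = 1"
proof -
  interpret state_on diagonals f
    using f star_subalgebra_diagonals by unfold_locales (auto simp: pure_state_def)
  show ?thesis
    using assms(2,3)
  proof (induction \<Q> rule: finite_induct)
    case (insert Q \<Q>)
    then show ?case
      using projection_compress(1)[of "dproj (\<Inter>\<Q>)" "dproj Q"] by (simp add: dproj_mult)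
  qed (simp add: one)
qed

text \<open>Finitely many sets on which \<open>f\<close> is 1 reduce to their intersection, where a
  vector state is available. The lower bound at \<open>x\<close> is a closed condition and survives
  the compactness argument.\<close>

lemma large_extension:
  assumes f: "pure_state diagonals f" and x: "adj x = x" and c: "0 < c"
    and large: "\<And>Q. f (dproj Q) = 1 \<Longrightarrow> c < norm (dproj Q * x * dproj Q)"
  shows "\<exists>g. state UNIV g \<and> (\<forall>d\<in>diagonals. g d = f d) \<and> c \<le> cmod (g x)"
proof -
  define \<U> where "\<U> = {Q. f (dproj Q) = 1}"
  define T where "T Q = {g :: mseq \<Rightarrow> complex. g (dproj Q) = 1} \<inter> {g. c \<le> cmod (g x)}" for Q
  have "{g. state UNIV g} \<inter> \<Inter>(T ` \<U>) \<noteq> {}"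
  proof (rule compact_imp_fip_image[OF compact_states[OF star_subalgebra_UNIV]])
    show "closed (T Q)" for Q
      unfolding T_def by (intro closed_Int closed_Collect_eq closed_Collect_le continuous_intros)
    fix \<Q> assume \<Q>: "finite \<Q>" "\<Q> \<subseteq> \<U>"
    have "f (dproj Q) = 1" if "Q \<in> \<Q>" for Q using that \<Q>(2) unfolding \<U>_def by blast
    then have "f (dproj (\<Inter>\<Q>)) = 1" by (rule pure_state_dproj_Inter[OF f \<Q>(1)])
    from state_of_large_compression[OF x c large[OF this]] obtain g
      where g: "state UNIV g" "g (dproj (\<Inter>\<Q>)) = 1" "c \<le> cmod (g x)" by blast
    interpret state_on UNIV g using g(1) star_subalgebra_UNIV by unfold_locales
    have "g (dproj Q) = 1" if "Q \<in> \<Q>" for Q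
    proof -
      have "\<Inter>\<Q> \<inter> Q = \<Inter>\<Q>" using that by blast
      then show ?thesis
        using projection_compress(1)[of "dproj Q" "dproj (\<Inter>\<Q>)"] g(2) by (simp add: dproj_mult)
    qed
    then have "g \<in> {g. state UNIV g} \<inter> \<Inter>(T ` \<Q>)" using g by (auto simp: T_def)
    then show "{g. state UNIV g} \<inter> \<Inter>(T ` \<Q>) \<noteq> {}" by blast
  qed
  then obtain g where g: "state UNIV g" "\<And>Q. f (dproj Q) = 1 \<Longrightarrow> g \<in> T Q" by (auto simp: \<U>_def)
  \<comment> \<open>\<open>T UNIV\<close> is used only to extract the bound at
    \<open>x\<close>.\<close>
  have "f (dproj UNIV) = 1" using f by (simp add: pure_state_def state_def)
  then have "g \<in> T UNIV" by (rule g(2))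
  then have "c \<le> cmod (g x)" by (simp add: T_def)
  moreover have "\<forall>d\<in>diagonals. g d = f d"
    using extension_if_eq_1_on_dproj[OF f g(1)] g(2) by (auto simp: T_def)
  ultimately show ?thesis using g(1) by blast
qed

section \<open>Non-uniqueness and paving\<close>

lemma state_face_extensions:
  assumes f: "pure_state diagonals f" and g: "state UNIV g" "\<forall>d\<in>diagonals. g d = f d"
  shows "state_face UNIV {u. state UNIV u \<and> (\<forall>d\<in>diagonals. u d = f d)}" (is "state_face UNIV ?F")
  unfolding state_face_def
proof (intro conjI ballI allI impI)
  have "?F = {u. state UNIV u} \<inter> (\<Inter>d\<in>diagonals. {u. u d = f d})" by auto
  moreover have "closed \<dots>"
    by (intro closed_Int closed_states closed_INT ballI closed_Collect_eq continuous_intros)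
  ultimately show "closed ?F" by simp
  show "?F \<noteq> {}" using g by blast
  fix u v w t assume u: "u \<in> ?F"
    and *: "state UNIV v \<and> state UNIV w \<and> 0 < t \<and> t < 1 \<and>
      (\<forall>a\<in>UNIV. u a = complex_of_real t * v a + complex_of_real (1 - t) * w a)"
  have "\<forall>d\<in>diagonals. f d = complex_of_real t * v d + complex_of_real (1 - t) * w d"
    using u * by (metis (mono_tags, lifting) UNIV_I mem_Collect_eq)
  then have "(\<forall>d\<in>diagonals. v d = f d) \<and> (\<forall>d\<in>diagonals. w d = f d)"
    using pure_state_decomposition[OF f, of v w t] * by blast
  then show "v \<in> ?F" "w \<in> ?F" using * by auto
qed auto

text \<open>The face of extensions contains \<open>g\<close> with value \<open>r \<noteq> 0\<close>
  at \<open>x\<close>, and the composition \<open>e\<close> with the conditional expectation, with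
  value 0. Pure states in the subfaces maximising \<open>r * k x\<close> and
  \<open>- r * k x\<close> are separated by these two values.\<close>

lemma not_unique_if_large_extension:
  assumes f: "pure_state diagonals f" and x: "adj x = x" "cond_exp x = 0"
    and g: "state UNIV g" "\<forall>d\<in>diagonals. g d = f d" "g x \<noteq> 0"
  shows "\<not> (\<exists>!g. pure_state UNIV g \<and> (\<forall>d\<in>diagonals. g d = f d))"
proof -
  let ?F = "{u. state UNIV u \<and> (\<forall>d\<in>diagonals. u d = f d)}"
  have F: "state_face UNIV ?F" by (rule state_face_extensions[OF f g(1,2)])
  interpret g: state_on UNIV g using g(1) star_subalgebra_UNIV by unfold_locales
  define r where "r = Re (g x)"
  have "Im (g x) = 0" using g.hermitian[of x] x(1) by (simp add: complex_eq_iff)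
  then have r: "g x = of_real r" "r \<noteq> 0" using g(3) by (auto simp: r_def complex_eq_iff)
  have "f 0 = 0"
  proof -
    interpret state_on diagonals f
      using f star_subalgebra_diagonals by unfold_locales (auto simp: pure_state_def)
    show ?thesis by (rule zero)
  qed
  define e where "e a = f (cond_exp a)" for a
  have e: "e \<in> ?F" "e x = 0"
    using state_cond_exp f x(2) \<open>f 0 = 0\<close>
    by (auto simp: e_def[abs_def] pure_state_def cond_exp_diagonal)
  obtain u where u: "u \<in> ?F" "\<forall>k\<in>?F. Re (of_real r * k x) \<le> Re (of_real r * u x)" "pure_state UNIV u"
    using state_face_contains_pure[OF star_subalgebra_UNIV
        state_face_maximum[OF star_subalgebra_UNIV F UNIV_I, of "of_real r" x]] by blast
  obtain v where v: "v \<in> ?F" "\<forall>k\<in>?F. Re (of_real (- r) * k x) \<le> Re (of_real (- r) * v x)" "pure_state UNIV v"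
    using state_face_contains_pure[OF star_subalgebra_UNIV
        state_face_maximum[OF star_subalgebra_UNIV F UNIV_I, of "of_real (- r)" x]] by blast
  have "Re (of_real r * g x) \<le> Re (of_real r * u x)" using u(2) g by blast
  then have "r * r \<le> r * Re (u x)" by (simp add: r)
  moreover have "Re (of_real (- r) * e x) \<le> Re (of_real (- r) * v x)" using v(2) e by blast
  then have "r * Re (v x) \<le> 0" by (simp add: e)
  moreover have "0 < r * r" using r(2) by (simp add: zero_less_mult_iff) linarith
  ultimately have "u \<noteq> v" by auto
  then show ?thesis using u v by blast
qed

lemma state_entry:
  assumes "2 \<le> n" "i < n"
  shows "state diagonals (restrict (\<lambda>a. entry a n i i) diagonals)"
proof -
  have "0 \<le> entry (adj a * a) n i i" for a
  proof -
    have "entry (adj a * a) n i i = (\<Sum>k<n. of_real ((cmod (entry a n k i))\<^sup>2))"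
      using assms by (simp add: complex_norm_square mult.commute del: of_real_power)
    then show ?thesis by (simp add: less_eq_complex_def sum_nonneg del: of_real_power)
  qed
  then show ?thesis
    unfolding state_def using assms diagonals_closed by (simp del: entry_mult)
qed

text \<open>Evaluation at an uncovered diagonal position kills any finite subfamily, so compactness
  gives a state killing all of it. Since states are nonnegative on projections, a vanishing proper
  convex combination has vanishing parts.\<close>

lemma state_face_vanishing:
  assumes "\<And>\<Q>. finite \<Q> \<Longrightarrow> \<Q> \<subseteq> \<G> \<Longrightarrow> \<exists>n\<ge>2. \<exists>i<n. (n, i) \<notin> \<Union>\<Q>"
  shows "state_face diagonals {u. state diagonals u \<and> (\<forall>Q\<in>\<G>. u (dproj Q) = 0)}"
    (is "state_face diagonals ?F")
  unfolding state_face_def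
proof (intro conjI ballI allI impI)
  define T where "T Q = {u :: mseq \<Rightarrow> complex. u (dproj Q) = 0}" for Q
  have F: "?F = {u. state diagonals u} \<inter> \<Inter>(T ` \<G>)" by (auto simp: T_def)
  have T: "closed (T Q)" for Q
    unfolding T_def by (intro closed_Collect_eq continuous_intros)
  then show "closed ?F" unfolding F by (intro closed_Int closed_states closed_INT ballI)
  show "?F \<noteq> {}"
    unfolding F
  proof (rule compact_imp_fip_image[OF compact_states[OF star_subalgebra_diagonals]])
    fix \<Q> assume "finite \<Q>" "\<Q> \<subseteq> \<G>"
    from assms[OF this] obtain n i where n: "2 \<le> n" "i < n" "(n, i) \<notin> \<Union>\<Q>" by blast
    then have "restrict (\<lambda>a. entry a n i i) diagonals \<in> {u. state diagonals u} \<inter> \<Inter>(T ` \<Q>)"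
      using state_entry[OF n(1,2)] by (auto simp: T_def)
    then show "{u. state diagonals u} \<inter> \<Inter>(T ` \<Q>) \<noteq> {}" by blast
  qed (rule T)
  fix u v w t assume u: "u \<in> ?F"
    and *: "state diagonals v \<and> state diagonals w \<and> 0 < t \<and> t < 1 \<and>
      (\<forall>a\<in>diagonals. u a = complex_of_real t * v a + complex_of_real (1 - t) * w a)"
  interpret v: state_on diagonals v using * star_subalgebra_diagonals by unfold_locales auto
  interpret w: state_on diagonals w using * star_subalgebra_diagonals by unfold_locales auto
  have "v (dproj Q) = 0 \<and> w (dproj Q) = 0" if "Q \<in> \<G>" for Q
  proof -
    note rv = v.projection_range[OF dproj_diagonal dproj_projection, of Q]
    note rw = w.projection_range[OF dproj_diagonal dproj_projection, of Q]
    have "u (dproj Q) = 0" using u that by auto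
    then have "complex_of_real t * v (dproj Q) + complex_of_real (1 - t) * w (dproj Q) = 0"
      using * dproj_diagonal by metis
    then have "t * Re (v (dproj Q)) + (1 - t) * Re (w (dproj Q)) = 0"
      by (simp add: complex_eq_iff)
    moreover have "0 \<le> t * Re (v (dproj Q))" "0 \<le> (1 - t) * Re (w (dproj Q))"
      using * rv rw by auto
    ultimately have "t * Re (v (dproj Q)) = 0" "(1 - t) * Re (w (dproj Q)) = 0" by linarith+
    then show ?thesis using * rv rw by (auto simp: complex_eq_iff)
  qed
  then show "v \<in> ?F" "w \<in> ?F" using * by auto
qed auto

lemma norm_compress_subset_le:
  assumes "\<And>n i. 2 \<le> n \<Longrightarrow> i < n \<Longrightarrow> (n, i) \<in> R \<Longrightarrow> (n, i) \<in> Q"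
  shows "norm (dproj R * x * dproj R) \<le> norm (dproj Q * x * dproj Q)"
proof -
  have "dproj R * x * dproj R = dproj R * (dproj Q * x * dproj Q) * dproj R"
    using assms by (intro mseq_entryI) (auto simp: entry_compress simp del: entry_mult)
  also have "norm \<dots> \<le> norm (dproj R) * norm (dproj Q * x * dproj Q) * norm (dproj R)"
    by (meson norm_mult_ineq order_trans mult_right_mono norm_ge_zero)
  also have "\<dots> \<le> 1 * norm (dproj Q * x * dproj Q) * 1"
    by (intro mult_mono norm_dproj_le) auto
  finally show ?thesis by simp
qed

text \<open>The sets compressing \<open>x\<close> to norm at most \<open>c\<close> have a finite
  subfamily covering all positions; otherwise \<open>state_face_vanishing\<close> leads to a second
  pure extension.\<close>

lemma paving_if_unique_pure_extension:
  assumes uniq: "\<And>f. pure_state diagonals f \<Longrightarrow> \<exists>!g. pure_state UNIV g \<and> (\<forall>d\<in>diagonals. g d = f d)"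
    and x: "adj x = x" "cond_exp x = 0" and c: "0 < c"
  shows "\<exists>(m::nat) p. (\<forall>j\<in>{1..m}. p j \<in> diagonals \<and> is_projection (p j)) \<and> (\<Sum>j=1..m. p j) = 1 \<and>
     (\<forall>j\<in>{1..m}. norm (p j * x * p j) \<le> c)"
proof -
  define \<G> where "\<G> = {Q. norm (dproj Q * x * dproj Q) \<le> c}"
  have "\<exists>\<Q>. finite \<Q> \<and> \<Q> \<subseteq> \<G> \<and> (\<forall>n\<ge>2. \<forall>i<n. (n, i) \<in> \<Union>\<Q>)"
  proof (rule ccontr)
    assume "\<not> ?thesis"
    then have "\<And>\<Q>. finite \<Q> \<Longrightarrow> \<Q> \<subseteq> \<G> \<Longrightarrow> \<exists>n\<ge>2. \<exists>i<n. (n, i) \<notin> \<Union>\<Q>" by blast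
    from state_face_contains_pure[OF star_subalgebra_diagonals state_face_vanishing[OF this]]
    obtain f where f: "pure_state diagonals f" "\<And>Q. Q \<in> \<G> \<Longrightarrow> f (dproj Q) = 0" by blast
    have "c < norm (dproj Q * x * dproj Q)" if "f (dproj Q) = 1" for Q
      using f(2)[of Q] that by (force simp: \<G>_def)
    from large_extension[OF f(1) x(1) c this] obtain g
      where g: "state UNIV g" "\<forall>d\<in>diagonals. g d = f d" "c \<le> cmod (g x)" by blast
    then have "g x \<noteq> 0" using c by auto
    from not_unique_if_large_extension[OF f(1) x g(1,2) this] uniq[OF f(1)] show False by blast
  qed
  then obtain \<Q> where \<Q>: "finite \<Q>" "\<Q> \<subseteq> \<G>" and cover: "\<forall>n\<ge>2. \<forall>i<n. (n, i) \<in> \<Union>\<Q>"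
    by (elim exE conjE) (rule that)
  obtain h where h: "bij_betw h {1..card \<Q>} \<Q>" using ex_bij_betw_nat_finite_1[OF \<Q>(1)] by blast
  then have h_im: "h ` {1..card \<Q>} = \<Q>" by (simp add: bij_betw_def)
  \<comment> \<open>Selecting one member of the cover for each position makes the pieces disjoint;
    shrinking a piece does not enlarge the norm of the compression.\<close>
  define k where "k p = (SOME j. j \<in> {1..card \<Q>} \<and> p \<in> h j)" for p
  have k: "k (n, i) \<in> {1..card \<Q>} \<and> (n, i) \<in> h (k (n, i))" if "2 \<le> n" "i < n" for n i
  proof -
    have "(n, i) \<in> \<Union>\<Q>" using cover that by simp
    then obtain Q where "Q \<in> \<Q>" "(n, i) \<in> Q" by (rule UnionE)
    then have "Q \<in> h ` {1..card \<Q>}" by (simp only: h_im)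
    then have "\<exists>j. j \<in> {1..card \<Q>} \<and> (n, i) \<in> h j" using \<open>(n, i) \<in> Q\<close> by blast
    from someI_ex[OF this] show ?thesis unfolding k_def .
  qed
  define p where "p j = dproj {p. k p = j}" for j
  have "(\<Sum>j=1..card \<Q>. p j) = 1"
    unfolding p_def using k by (intro sum_dproj_partition) auto
  moreover have "norm (p j * x * p j) \<le> c" if "j \<in> {1..card \<Q>}" for j
  proof -
    have "h j \<in> \<Q>" using imageI[OF that, of h] by (simp only: h_im)
    then have "norm (dproj (h j) * x * dproj (h j)) \<le> c" using \<Q>(2) by (auto simp: \<G>_def)
    moreover have "norm (p j * x * p j) \<le> norm (dproj (h j) * x * dproj (h j))"
      unfolding p_def by (rule norm_compress_subset_le) (use k in auto)
    ultimately show ?thesis by simp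
  qed
  ultimately show ?thesis by (intro exI[of _ "card \<Q>"] exI[of _ p]) (auto simp: p_def)
qed

section \<open>Weak paveability and the quotient\<close>

lemma norm_summand_unit_mult:
  assumes "2 \<le> n"
  shows "norm (summand_unit n * a) = opnorm (coord a n)"
proof (rule antisym)
  have c: "coord (summand_unit n * a) k = (if k = n then coord a n else 0\<^sub>m k k)" for k
    using assms by (auto simp: times_mseq.rep_eq summand_unit.rep_eq)
  show "norm (summand_unit n * a) \<le> opnorm (coord a n)"
    by (rule norm_mseq_least) (simp add: c)
  show "opnorm (coord a n) \<le> norm (summand_unit n * a)"
    using coord_le_norm[OF assms, of "summand_unit n * a"] by (simp add: c)
qed

lemma compacts_iff: "a \<in> compacts \<longleftrightarrow> (\<lambda>n. opnorm (coord a n)) \<longlonglongrightarrow> 0"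
proof -
  have "eventually (\<lambda>n. norm (summand_unit n * a) = opnorm (coord a n)) sequentially"
    using eventually_ge_at_top[of 2] by eventually_elim (rule norm_summand_unit_mult)
  then show ?thesis unfolding compacts_def by (auto dest: tendsto_cong)
qed

lemma zero_compact: "0 \<in> compacts"
  by (simp add: compacts_iff zero_mseq.rep_eq)

lemma quotient_norm_le_norm: "quotient_norm (quotient_map a) \<le> norm a"
  unfolding quotient_norm_def
proof (rule cINF_lower)
  show "bdd_below (norm ` quotient_map a)" by (rule bdd_belowI2[of _ 0]) simp
  show "a \<in> quotient_map a" unfolding quotient_map_def using zero_compact by force
qed

lemma quotient_norm_lessD:
  assumes "quotient_norm (quotient_map a) < c"
  shows "\<exists>k\<in>compacts. norm (a + k) < c"
proof -
  have "norm ` quotient_map a \<noteq> {}" unfolding quotient_map_def using zero_compact by blast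
  from cInf_lessD[OF this] assms obtain x where "x \<in> quotient_map a" "norm x < c"
    unfolding quotient_norm_def by blast
  then show ?thesis unfolding quotient_map_def by blast
qed

lemma opnorm_coord_triangle: "opnorm (coord (a + b) n) \<le> opnorm (coord a n) + opnorm (coord b n)"
  unfolding plus_mseq.rep_eq by (rule opnorm_add[of _ n n]) auto

lemma opnorm_coord_uminus: "opnorm (coord (- a) n) = opnorm (coord a n)"
  by (simp add: uminus_mseq.rep_eq opnorm_smult)

lemma opnorm_coord_mult: "opnorm (coord (a * b) n) \<le> opnorm (coord a n) * opnorm (coord b n)"
  unfolding times_mseq.rep_eq by (rule opnorm_mult[of _ n n _ n]) auto

text \<open>The norm \<open>t\<close> of an idempotent satisfies \<open>t \<le> t * t\<close>. This
  gap between 0 and 1 makes non-compactness of a projection quantitative.\<close>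

lemma projection_opnorm:
  assumes "is_projection p"
  shows "opnorm (coord p n) = 0 \<or> 1 \<le> opnorm (coord p n)"
proof -
  have "opnorm (coord p n) \<le> opnorm (coord p n) * opnorm (coord p n)"
    using opnorm_coord_mult[of p p n] assms by (simp add: is_projection_def)
  then show ?thesis using opnorm_nonneg[of "coord p n"] by (cases "opnorm (coord p n) = 0") auto
qed

text \<open>Arbitrarily late coordinates of \<open>p\<close> have norm at least 1, whereas a compact
  perturbation is eventually below every \<epsilon>.\<close>

lemma quotient_norm_projection:
  assumes p: "is_projection p" "p \<notin> compacts"
  shows "1 \<le> quotient_norm (quotient_map p)"
  unfolding quotient_norm_def
proof (rule cINF_greatest)
  show "quotient_map p \<noteq> {}" unfolding quotient_map_def using zero_compact by blast
  fix x assume "x \<in> quotient_map p"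
  then obtain k where k: "x = p + k" "k \<in> compacts" unfolding quotient_map_def by blast
  have "1 \<le> norm x + \<epsilon>" if \<epsilon>: "0 < \<epsilon>" for \<epsilon>
  proof -
    have ev: "eventually (\<lambda>n. opnorm (coord k n) < \<epsilon> \<and> 2 \<le> n) sequentially"
      using order_tendstoD(2)[OF k(2)[unfolded compacts_iff] \<epsilon>] eventually_ge_at_top by (rule eventually_conj)
    have "\<exists>n\<ge>2. opnorm (coord p n) \<noteq> 0 \<and> opnorm (coord k n) < \<epsilon>"
    proof (rule ccontr)
      assume neg: "\<not> ?thesis"
      have "eventually (\<lambda>n. opnorm (coord p n) = 0) sequentially"
        using ev by eventually_elim (use neg in blast)
      then have "(\<lambda>n. opnorm (coord p n)) \<longlonglongrightarrow> 0" by (rule tendsto_eventually)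
      then show False using p(2) by (simp add: compacts_iff)
    qed
    then obtain n where n: "opnorm (coord p n) \<noteq> 0" "opnorm (coord k n) < \<epsilon>" "2 \<le> n" by blast
    have "p = x + - k" by (simp add: k)
    have "1 \<le> opnorm (coord p n)" using projection_opnorm[OF p(1), of n] n(1) by simp
    also have "\<dots> \<le> opnorm (coord x n) + opnorm (coord k n)"
      using opnorm_coord_triangle[of x "- k" n] opnorm_coord_uminus[of k n] \<open>p = x + - k\<close> by simp
    also have "\<dots> \<le> norm x + \<epsilon>" using coord_le_norm[OF n(3)] n(2) by (intro add_mono) auto
    finally show ?thesis .
  qed
  then show "1 \<le> norm x" by (rule field_le_epsilon)
qed

lemma weakly_paveable_if_unique_pure_extension:
  assumes uniq: "\<And>f. pure_state diagonals f \<Longrightarrow> \<exists>!g. pure_state UNIV g \<and> (\<forall>d\<in>diagonals. g d = f d)"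
    and p: "is_projection p" "p \<notin> compacts"
  shows "weakly_paveable p"
proof -
  have p': "adj p = p" "p * p = p" using p by (auto simp: is_projection_def)
  define x where "x = p - cond_exp p"
  have "cond_exp x = 0" by (rule mseq_entryI) (simp add: x_def)
  moreover have "adj x = x" by (simp add: x_def adj_diff p' flip: cond_exp_adj)
  \<comment> \<open>Any bound below 1 would do here, since the quotient norm of \<open>p\<close> is
    at least 1.\<close>
  ultimately obtain m :: nat and q where q: "\<forall>j\<in>{1..m}. q j \<in> diagonals \<and> is_projection (q j)"
    "(\<Sum>j=1..m. q j) = 1" "\<forall>j\<in>{1..m}. norm (q j * x * q j) \<le> 1 / 2"
    using paving_if_unique_pure_extension[OF uniq, of x "1 / 2"] by auto
  have "quotient_norm (quotient_map (q j * (p - cond_exp p) * q j)) < quotient_norm (quotient_map p)"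
    if "j \<in> {1..m}" for j
    using quotient_norm_le_norm[of "q j * x * q j"] q(3) that quotient_norm_projection[OF p]
    unfolding x_def by fastforce
  moreover have "p = adj p * p" using p' by simp
  then have "p \<in> positive" unfolding positive_def by blast
  ultimately show ?thesis unfolding weakly_paveable_def using q p(2) by blast
qed

section \<open>Range projections of isometries\<close>

lemma isometric_bessel: "isometric D I w \<Longrightarrow> bessel D I w 1"
  by (simp add: isometric_def bessel_def)

text \<open>The difference \<open>K\<close> of the Gram matrix of the columns and the identity has
  zero quadratic form, so \<open>hermitian_bessel\<close> bounds it by every positive
  number.\<close>

lemma isometric_gram:
  assumes fin: "finite D" "finite I" and w: "isometric D I w" and d: "d \<in> D" "d' \<in> D"
  shows "(\<Sum>i\<in>I. cnj (w i d) * w i d') = (if d = d' then 1 else 0)"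
proof -
  define K where "K d d' = (\<Sum>i\<in>I. cnj (w i d) * w i d') - (if d = d' then 1 else 0)" for d d'
  have herm: "K d' d = cnj (K d d')" for d d' by (simp add: K_def mult.commute)
  have quad: "quad_form D K y = 0" for y
  proof -
    have "(\<Sum>e\<in>D. cnj (y d) * (if d = e then 1 else 0) * y e) = y d * cnj (y d)" if "d \<in> D" for d
    proof -
      have "(\<Sum>e\<in>D. cnj (y d) * (if d = e then 1 else 0) * y e) = (\<Sum>e\<in>D. if d = e then y d * cnj (y d) else 0)"
        by (intro sum.cong) auto
      then show ?thesis using that fin by simp
    qed
    then have "(\<Sum>d\<in>D. \<Sum>e\<in>D. cnj (y d) * (if d = e then 1 else 0) * y e) = of_real (\<Sum>d\<in>D. (cmod (y d))\<^sup>2)"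
      by (simp only: of_real_sum complex_norm_square cong: sum.cong)
    moreover have "quad_form D K y = (\<Sum>d\<in>D. \<Sum>e\<in>D. cnj (y d) * (\<Sum>i\<in>I. cnj (w i d) * w i e) * y e)
        - (\<Sum>d\<in>D. \<Sum>e\<in>D. cnj (y d) * (if d = e then 1 else 0) * y e)"
      unfolding quad_form_def K_def sum_subtractf[symmetric]
      by (intro sum.cong refl) (simp only: right_diff_distrib left_diff_distrib)
    ultimately show ?thesis
      using w unfolding gram_quadratic_form isometric_def by simp
  qed
  have "bessel D D K (c\<^sup>2)" if "0 < c" for c
    by (rule hermitian_bessel[OF herm that]) (use that in \<open>simp add: quad sum_nonneg\<close>)
  then have row: "(\<Sum>e\<in>D. (cmod (K d e))\<^sup>2) \<le> c\<^sup>2" if "0 < c" for c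
    using bessel_row[of D D K "c\<^sup>2" d] that fin d by simp
  have "(\<Sum>e\<in>D. (cmod (K d e))\<^sup>2) \<le> 0 + \<epsilon>" if "0 < \<epsilon>" for \<epsilon>
    using row[of "sqrt \<epsilon>"] that by simp
  then have "(\<Sum>e\<in>D. (cmod (K d e))\<^sup>2) \<le> 0" by (rule field_le_epsilon)
  then have "(\<Sum>e\<in>D. (cmod (K d e))\<^sup>2) = 0" by (intro antisym sum_nonneg) auto
  then have "K d d' = 0" using fin d by (simp add: sum_nonneg_eq_0_iff)
  then show ?thesis by (simp add: K_def)
qed

definition uncolourable :: "nat \<Rightarrow> nat \<Rightarrow> nat \<Rightarrow> (nat \<Rightarrow> nat \<Rightarrow> complex) \<Rightarrow> bool" where
  "uncolourable k n m w \<longleftrightarrow> isometric {..<m} {..<n} w \<and>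
     (\<forall>i<n. (\<Sum>d<m. (cmod (w i d))\<^sup>2) \<le> 1 / real k) \<and>
     \<not> colourable k {..<m} {..<n} w (1 - 1 / real k)"

text \<open>Appended zero rows let one counterexample serve in every later coordinate.\<close>

lemma uncolourable_pad:
  assumes "uncolourable k n m w" "n \<le> n'"
  shows "uncolourable k n' m (\<lambda>i d. if i < n then w i d else 0)"
proof -
  let ?w = "\<lambda>i d. if i < n then w i d else 0"
  have "(\<Sum>i<n'. (cmod (\<Sum>d<m. ?w i d * y d))\<^sup>2) = (\<Sum>i<n. (cmod (\<Sum>d<m. w i d * y d))\<^sup>2)" for y
    using assms(2) by (intro sum.mono_neutral_cong_right) auto
  then have "isometric {..<m} {..<n'} ?w"
    using assms(1) unfolding uncolourable_def isometric_def by simp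
  moreover have "(\<Sum>d<m. (cmod (?w i d))\<^sup>2) \<le> 1 / real k" if "i < n'" for i
    using assms(1) unfolding uncolourable_def by (cases "i < n") auto
  moreover have "colourable k {..<m} {..<n} w (1 - 1 / real k)"
    if "colourable k {..<m} {..<n'} ?w (1 - 1 / real k)"
  proof -
    have "colourable k {..<m} {..<n} ?w (1 - 1 / real k)"
      by (rule colourable_subset[OF that]) (use assms(2) in auto)
    moreover have "bessel {..<m} {i\<in>{..<n}. \<kappa> i = j} ?w c \<longleftrightarrow> bessel {..<m} {i\<in>{..<n}. \<kappa> i = j} w c"
      for \<kappa> :: "nat \<Rightarrow> nat" and j c by (rule bessel_cong) simp
    ultimately show ?thesis unfolding colourable_def by simp
  qed
  ultimately show ?thesis using assms(1) unfolding uncolourable_def by blast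
qed

text \<open>The zero matrix is colourable with one colour. The nonzero entry will prevent the
  assembled projection from being compact.\<close>

lemma uncolourable_nonzero:
  assumes "uncolourable k n m w" "0 < k"
  shows "\<exists>i<n. \<exists>d<m. w i d \<noteq> 0"
proof (rule ccontr)
  assume "\<not> ?thesis"
  then have zero: "\<And>i d. i < n \<Longrightarrow> d < m \<Longrightarrow> w i d = 0" by blast
  have "0 \<le> 1 - 1 / real k" using assms(2) by simp
  then have b: "bessel {..<m} S w (1 - 1 / real k)" if "S \<subseteq> {..<n}" for S
    using that zero unfolding bessel_def by (auto intro!: mult_nonneg_nonneg sum_nonneg simp: subset_iff)
  have "colourable k {..<m} {..<n} w (1 - 1 / real k)"
    unfolding colourable_def using assms(2) by (intro exI[of _ "\<lambda>_. 0"]) (auto intro!: b)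
  then show False using assms(1) unfolding uncolourable_def by blast
qed

lemma range_projection_bessel:
  fixes w :: "nat \<Rightarrow> nat \<Rightarrow> complex"
  assumes w: "isometric {..<m} {..<n} w"
  shows "bessel {..<n} {..<n} (\<lambda>i j. \<Sum>d<m. w i d * cnj (w j d)) (1\<^sup>2)"
  unfolding bessel_def
proof
  fix y :: "nat \<Rightarrow> complex"
  define z where "z d = (\<Sum>j<n. cnj (w j d) * y j)" for d
  have "(\<Sum>j<n. (\<Sum>d<m. w i d * cnj (w j d)) * y j) = (\<Sum>d<m. w i d * z d)" for i
    unfolding z_def sum_distrib_left sum_distrib_right by (subst sum.swap) (simp add: mult_ac)
  then have "(\<Sum>i<n. (cmod (\<Sum>j<n. (\<Sum>d<m. w i d * cnj (w j d)) * y j))\<^sup>2) = (\<Sum>d<m. (cmod (z d))\<^sup>2)"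
    using w unfolding isometric_def by simp
  also have "\<dots> \<le> 1 * (\<Sum>j<n. (cmod (y j))\<^sup>2)"
    unfolding z_def by (rule besselD[OF bessel_dual[OF isometric_bessel[OF w]]]) simp
  finally show "(\<Sum>i<n. (cmod (\<Sum>j<n. (\<Sum>d<m. w i d * cnj (w j d)) * y j))\<^sup>2) \<le> 1\<^sup>2 * (\<Sum>j<n. (cmod (y j))\<^sup>2)"
    by simp
qed

text \<open>Summing over \<open>k\<close> first produces the Gram matrix of the columns, which is
  the identity.\<close>

lemma range_projection_idempotent:
  fixes w :: "nat \<Rightarrow> nat \<Rightarrow> complex"
  assumes w: "isometric {..<m} {..<n} w"
  shows "(\<Sum>k<n. (\<Sum>d<m. w i d * cnj (w k d)) * (\<Sum>d<m. w k d * cnj (w j d))) = (\<Sum>d<m. w i d * cnj (w j d))"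
proof -
  have "(\<Sum>k<n. (\<Sum>d<m. w i d * cnj (w k d)) * (\<Sum>d<m. w k d * cnj (w j d)))
      = (\<Sum>k<n. \<Sum>d<m. \<Sum>e<m. w i d * (cnj (w k d) * w k e) * cnj (w j e))"
    unfolding sum_product by (simp add: mult.assoc)
  also have "\<dots> = (\<Sum>d<m. \<Sum>k<n. \<Sum>e<m. w i d * (cnj (w k d) * w k e) * cnj (w j e))"
    by (rule sum.swap)
  also have "\<dots> = (\<Sum>d<m. \<Sum>e<m. \<Sum>k<n. w i d * (cnj (w k d) * w k e) * cnj (w j e))"
    by (intro sum.cong refl sum.swap)
  also have "\<dots> = (\<Sum>d<m. \<Sum>e<m. w i d * (\<Sum>k<n. cnj (w k d) * w k e) * cnj (w j e))"
    by (simp add: sum_distrib_left sum_distrib_right)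
  also have "\<dots> = (\<Sum>d<m. \<Sum>e<m. if d = e then w i d * cnj (w j d) else 0)"
    by (intro sum.cong refl) (simp add: isometric_gram[OF finite_lessThan finite_lessThan w])
  also have "\<dots> = (\<Sum>d<m. w i d * cnj (w j d))" by (intro sum.cong refl) simp
  finally show ?thesis .
qed

text \<open>The compression is the Gram matrix of the selected rows, so its norm bounds the adjoint
  of the row family; \<open>bessel_dual\<close> returns to the rows.\<close>

lemma bessel_of_compression:
  fixes w :: "nat \<Rightarrow> nat \<Rightarrow> complex"
  assumes p: "\<And>i j. i < n \<Longrightarrow> j < n \<Longrightarrow> entry p n i j = (\<Sum>d<m. w i d * cnj (w j d))"
    and n: "2 \<le> n" and c: "opnorm (coord (dproj Q * p * dproj Q) n) \<le> c"
  shows "bessel {..<m} {i\<in>{..<n}. (n, i) \<in> Q} w c"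
proof -
  define T where "T = {i\<in>{..<n}. (n, i) \<in> Q}"
  have T: "T \<subseteq> {..<n}" by (auto simp: T_def)
  have c0: "0 \<le> c" using c opnorm_nonneg order.trans by blast
  have "bessel T {..<m} (\<lambda>d i. cnj (w i d)) c"
    unfolding bessel_def
  proof
    fix y :: "nat \<Rightarrow> complex"
    let ?z = "dproj Q * p * dproj Q"
    define y' where "y' i = (if i \<in> T then y i else 0)" for i
    have yy: "(\<Sum>i<n. (cmod (y' i))\<^sup>2) = (\<Sum>i\<in>T. (cmod (y i))\<^sup>2)"
      unfolding y'_def by (rule sum_norm_subset[OF _ T]) simp
    have "complex_of_real (\<Sum>d<m. (cmod (\<Sum>i\<in>T. cnj (w i d) * y i))\<^sup>2)
        = (\<Sum>i\<in>T. \<Sum>j\<in>T. cnj (y i) * (\<Sum>d<m. w i d * cnj (w j d)) * y j)"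
      using gram_quadratic_form[where b = "\<lambda>d i. cnj (w i d)" and S = "{..<m}" and D = T and y = y] by simp
    also have "\<dots> = quad_form T (entry p n) y"
      unfolding quad_form_def using p T by (intro sum.cong refl) (simp add: subset_iff)
    also have "\<dots> = quad_form T (entry p n) y'"
      unfolding quad_form_def y'_def by (intro sum.cong refl) auto
    also have "\<dots> = quad_form {..<n} (entry ?z n) y'"
      by (rule quad_form_compress[symmetric, OF _ T]) (use n in \<open>auto simp: entry_compress T_def\<close>)
    finally have "(\<Sum>d<m. (cmod (\<Sum>i\<in>T. cnj (w i d) * y i))\<^sup>2) = cmod (quad_form {..<n} (entry ?z n) y')"
      by (metis (no_types, lifting) abs_of_nonneg norm_of_real sum_nonneg zero_le_power2)
    also have "\<dots> \<le> opnorm (coord ?z n) * (\<Sum>i<n. (cmod (y' i))\<^sup>2)" by (rule quad_form_opnorm_le)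
    also have "\<dots> \<le> c * (\<Sum>i\<in>T. (cmod (y i))\<^sup>2)"
      unfolding yy using c by (intro mult_right_mono sum_nonneg) auto
    finally show "(\<Sum>d<m. (cmod (\<Sum>i\<in>T. cnj (w i d) * y i))\<^sup>2) \<le> c * (\<Sum>i\<in>T. (cmod (y i))\<^sup>2)" .
  qed
  from bessel_dual[OF this c0] show ?thesis by (simp add: T_def)
qed

lemma colourable_of_compressions:
  fixes w :: "nat \<Rightarrow> nat \<Rightarrow> complex"
  assumes p: "\<And>i j. i < n \<Longrightarrow> j < n \<Longrightarrow> entry p n i j = (\<Sum>d<m. w i d * cnj (w j d))"
    and n: "2 \<le> n" and Q: "(\<Sum>j=1..r. dproj (Q j)) = 1" and r: "r \<le> k" and c0: "0 \<le> c"
    and c: "\<And>j. j \<in> {1..r} \<Longrightarrow> opnorm (coord (dproj (Q j) * p * dproj (Q j)) n) \<le> c"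
  shows "colourable k {..<m} {..<n} w c"
proof -
  have ex: "\<exists>j. j \<in> {1..r} \<and> (n, i) \<in> Q j" if "i < n" for i
  proof (rule ccontr)
    assume "\<not> ?thesis"
    then have "(\<Sum>j=1..r. entry (dproj (Q j)) n i i) = 0" using n that by (intro sum.neutral) auto
    then have "entry 1 n i i = 0" using that unfolding Q[symmetric] by simp
    then show False using n that by simp
  qed
  \<comment> \<open>Projections are numbered from 1 and colours from 0. The colours from
    \<open>r\<close> on have empty classes, for which \<open>0 \<le> c\<close> gives the
    bound.\<close>
  define \<kappa> where "\<kappa> i = (SOME j. j \<in> {1..r} \<and> (n, i) \<in> Q j) - 1" for i
  have \<kappa>: "Suc (\<kappa> i) \<in> {1..r} \<and> (n, i) \<in> Q (Suc (\<kappa> i))" if "i < n" for i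
  proof -
    have s: "(SOME j. j \<in> {1..r} \<and> (n, i) \<in> Q j) \<in> {1..r} \<and> (n, i) \<in> Q (SOME j. j \<in> {1..r} \<and> (n, i) \<in> Q j)"
      by (rule someI_ex[OF ex[OF that]])
    then have "Suc (\<kappa> i) = (SOME j. j \<in> {1..r} \<and> (n, i) \<in> Q j)" unfolding \<kappa>_def by auto
    then show ?thesis using s by simp
  qed
  show ?thesis
    unfolding colourable_def
  proof (intro exI[of _ \<kappa>] conjI ballI allI impI)
    show "\<kappa> i < k" if "i \<in> {..<n}" for i using \<kappa>[of i] that r by auto
    fix j assume "j < k"
    show "bessel {..<m} {i\<in>{..<n}. \<kappa> i = j} w c"
    proof (cases "Suc j \<in> {1..r}")
      case True
      have "{i\<in>{..<n}. \<kappa> i = j} \<subseteq> {i\<in>{..<n}. (n, i) \<in> Q (Suc j)}" using \<kappa> by auto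
      from bessel_subset[OF bessel_of_compression[OF p n c[OF True]] this] show ?thesis by simp
    next
      case False
      then have e: "{i\<in>{..<n}. \<kappa> i = j} = {}" using \<kappa> by auto
      show ?thesis unfolding e bessel_def using c0 by (simp add: sum_nonneg)
    qed
  qed
qed

text \<open>Coordinate \<open>n\<close> of the assembled projection is the range projection of a
  counterexample for the largest parameter \<open>K n\<close> that occurs in size \<open>n\<close>.
  Since \<open>K n\<close> tends to infinity, the diagonal tends to zero, while a paving with fixed
  number of pieces and fixed gain eventually contradicts the choice of \<open>K n\<close>.\<close>

lemma small_rows_colourable_if_weakly_paveable:
  assumes wp: "\<And>p. is_projection p \<Longrightarrow> p \<notin> compacts \<Longrightarrow> cond_exp p \<in> compacts \<Longrightarrow> weakly_paveable p"
  shows "\<exists>k\<ge>2. small_rows_colourable k"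
proof (rule ccontr)
  assume neg: "\<not> ?thesis"
  have bad: "\<exists>n m w. uncolourable k n m w" if "2 \<le> k" for k
  proof -
    have "\<not> small_rows_colourable k" using neg that by blast
    then show ?thesis unfolding small_rows_colourable_def uncolourable_def by blast
  qed
  \<comment> \<open>The restriction \<open>k \<le> n\<close> makes \<open>B n\<close> finite, so
    that its maximum exists.\<close>
  define B where "B n = {k. 2 \<le> k \<and> k \<le> n \<and> (\<exists>m w. uncolourable k n m w)}" for n
  define K where "K n = Max (B n)" for n
  have finB: "finite (B n)" for n unfolding B_def by simp
  have K: "K n \<in> B n" if "B n \<noteq> {}" for n using Max_in[OF finB that] by (simp add: K_def)
  have large: "eventually (\<lambda>n. B n \<noteq> {} \<and> k \<le> K n) sequentially" if k: "2 \<le> k" for k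
  proof -
    obtain n0 m w where w: "uncolourable k n0 m w" using bad[OF k] by blast
    have "B n \<noteq> {} \<and> k \<le> K n" if "max k n0 \<le> n" for n
    proof -
      have "k \<in> B n" using uncolourable_pad[OF w, of n] that k unfolding B_def by auto
      then show ?thesis using Max_ge[OF finB] by (auto simp: K_def)
    qed
    then show ?thesis unfolding eventually_sequentially by blast
  qed
  have "\<forall>n. \<exists>m w. B n \<noteq> {} \<longrightarrow> uncolourable (K n) n m w"
    using K unfolding B_def by blast
  then obtain m w where w: "\<And>n. B n \<noteq> {} \<Longrightarrow> uncolourable (K n) n (m n) (w n)" by metis
  have iso: "isometric {..<m n} {..<n} (w n)" if "B n \<noteq> {}" for n
    using w[OF that] unfolding uncolourable_def by blast
  have "\<exists>p. \<forall>n\<ge>2. \<forall>i<n. \<forall>j<n. entry p n i j =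
      (if B n = {} then 0 else \<Sum>d<m n. w n i d * cnj (w n j d))"
  proof (rule ex_mseq_entry)
    fix n :: nat
    show "bessel {..<n} {..<n} (\<lambda>i j. if B n = {} then 0 else \<Sum>d<m n. w n i d * cnj (w n j d)) (1\<^sup>2)"
    proof (cases "B n = {}")
      case True
      then show ?thesis by (simp add: bessel_def sum_nonneg)
    next
      case False
      then show ?thesis using range_projection_bessel[OF iso[OF False]] by simp
    qed
  qed simp
  then obtain p where p: "\<And>n i j. 2 \<le> n \<Longrightarrow> i < n \<Longrightarrow> j < n \<Longrightarrow> entry p n i j =
      (if B n = {} then 0 else \<Sum>d<m n. w n i d * cnj (w n j d))" by blast
  have "adj p = p" by (rule mseq_entryI) (simp add: p mult.commute)
  moreover have "p * p = p"
  proof (rule mseq_entryI)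
    fix n i j :: nat assume n: "2 \<le> n" "i < n" "j < n"
    show "entry (p * p) n i j = entry p n i j"
      using n p range_projection_idempotent[OF iso, of n i j] by (cases "B n = {}") simp_all
  qed
  ultimately have proj: "is_projection p" by (simp add: is_projection_def)
  have diag: "opnorm (coord (cond_exp p) n) \<le> 1 / real (K n)" if n: "2 \<le> n" "B n \<noteq> {}" for n
  proof (rule opnorm_diagonal_le[OF cond_exp_in_diagonals n(1)])
    fix i assume i: "i < n"
    have "entry (cond_exp p) n i i = of_real (\<Sum>d<m n. (cmod (w n i d))\<^sup>2)"
      using n i by (simp add: p complex_norm_square del: of_real_power)
    moreover have "(\<Sum>d<m n. (cmod (w n i d))\<^sup>2) \<le> 1 / real (K n)"
      using w[OF n(2)] i unfolding uncolourable_def by blast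
    moreover have "0 \<le> (\<Sum>d<m n. (cmod (w n i d))\<^sup>2)" by (simp add: sum_nonneg)
    ultimately show "cmod (entry (cond_exp p) n i i) \<le> 1 / real (K n)"
      by (simp only: norm_of_real abs_of_nonneg)
  qed simp
  have small: "eventually (\<lambda>n. 1 / real (K n) \<le> \<epsilon> \<and> r \<le> K n \<and> B n \<noteq> {} \<and> 2 \<le> n) sequentially"
    if "0 < \<epsilon>" for \<epsilon> r
  proof -
    obtain k :: nat where k: "1 / \<epsilon> < real k" using reals_Archimedean2 by blast
    have "eventually (\<lambda>n. (B n \<noteq> {} \<and> max 2 (max r k) \<le> K n) \<and> 2 \<le> n) sequentially"
      by (intro eventually_conj large eventually_ge_at_top) simp
    then show ?thesis
    proof eventually_elim
      case (elim n)
      then have "1 / \<epsilon> < real (K n)" "0 < real (K n)" using k by auto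
      then have "1 / real (K n) \<le> \<epsilon>" using that by (simp add: field_simps)
      then show ?case using elim by auto
    qed
  qed
  have "(\<lambda>n. opnorm (coord (cond_exp p) n)) \<longlonglongrightarrow> 0"
  proof (rule order_tendstoI)
    fix e :: real assume "e < 0"
    then show "eventually (\<lambda>n. e < opnorm (coord (cond_exp p) n)) sequentially"
      by (intro always_eventually allI) (meson less_le_trans opnorm_nonneg)
  next
    fix e :: real assume "0 < e"
    then have "0 < e / 2" by simp
    from small[OF this, of 0] show "eventually (\<lambda>n. opnorm (coord (cond_exp p) n) < e) sequentially"
    proof eventually_elim
      case (elim n)
      then have "opnorm (coord (cond_exp p) n) \<le> e / 2" using diag[of n] by linarith
      then show ?case using \<open>0 < e\<close> by linarith
    qed
  qed
  then have cpt: "cond_exp p \<in> compacts" by (simp add: compacts_iff)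
  have "p \<notin> compacts"
  proof
    assume "p \<in> compacts"
    then have "eventually (\<lambda>n. opnorm (coord p n) < 1) sequentially"
      unfolding compacts_iff by (rule order_tendstoD) simp
    moreover have "eventually (\<lambda>n. 1 \<le> opnorm (coord p n)) sequentially"
      using small[of 1 0, simplified]
    proof eventually_elim
      case (elim n)
      then have "0 < K n" using K[of n] by (auto simp: B_def)
      with elim obtain i d where id: "i < n" "d < m n" "w n i d \<noteq> 0"
        using uncolourable_nonzero[OF w] by blast
      have "0 < (\<Sum>d<m n. (cmod (w n i d))\<^sup>2)" using id by (intro sum_pos2[of _ d]) auto
      moreover have "entry p n i i = of_real (\<Sum>d<m n. (cmod (w n i d))\<^sup>2)"
        using elim id by (simp add: p complex_norm_square del: of_real_power)
      ultimately have "entry p n i i \<noteq> 0" by (simp only: of_real_eq_0_iff)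
      moreover have "cmod (entry p n i i) \<le> opnorm (coord p n)"
        using opnorm_entry[of i "coord p n" i] id by (simp add: entry_def)
      ultimately have "opnorm (coord p n) \<noteq> 0" by auto
      then show ?case using projection_opnorm[OF proj, of n] by simp
    qed
    ultimately have "eventually (\<lambda>n. False) sequentially" by eventually_elim simp
    then show False by simp
  qed
  from wp[OF proj this cpt] obtain r :: nat and q where
    q: "\<forall>j\<in>{1..r}. q j \<in> diagonals \<and> is_projection (q j)" "(\<Sum>j=1..r. q j) = 1"
      "\<forall>j\<in>{1..r}. quotient_norm (quotient_map (q j * (p - cond_exp p) * q j)) < quotient_norm (quotient_map p)"
    unfolding weakly_paveable_def by blast
  \<comment> \<open>This turns the comparison with the quotient norm of \<open>p\<close> into a
    comparison with 1.\<close>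
  have "norm p \<le> 1"
  proof (rule norm_le_bessel)
    fix n :: nat assume n: "2 \<le> n"
    show "bessel {..<n} {..<n} (entry p n) (1\<^sup>2)"
    proof (cases "B n = {}")
      case True
      then have "bessel {..<n} {..<n} (\<lambda>i j. 0) (1\<^sup>2) \<longleftrightarrow> bessel {..<n} {..<n} (entry p n) (1\<^sup>2)"
        using n by (intro bessel_cong) (simp add: p)
      then show ?thesis by (simp add: bessel_def sum_nonneg)
    next
      case False
      then have "bessel {..<n} {..<n} (\<lambda>i j. \<Sum>d<m n. w n i d * cnj (w n j d)) (1\<^sup>2)
          \<longleftrightarrow> bessel {..<n} {..<n} (entry p n) (1\<^sup>2)"
        using n by (intro bessel_cong) (simp add: p)
      then show ?thesis using range_projection_bessel[OF iso[OF False]] by blast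
    qed
  qed simp
  then have "quotient_norm (quotient_map (q j * (p - cond_exp p) * q j)) < 1" if "j \<in> {1..r}" for j
    using q(3) that quotient_norm_le_norm[of p] by fastforce
  then have "\<exists>k\<in>compacts. norm (q j * (p - cond_exp p) * q j + k) < 1" if "j \<in> {1..r}" for j
    using quotient_norm_lessD that by blast
  then obtain k where k: "\<And>j. j \<in> {1..r} \<Longrightarrow> k j \<in> compacts"
      "\<And>j. j \<in> {1..r} \<Longrightarrow> norm (q j * (p - cond_exp p) * q j + k j) < 1"
    by metis
  define Q where "Q j = {(n, i). entry (q j) n i i = 1}" for j
  have qQ: "q j = dproj (Q j)" if "j \<in> {1..r}" for j
    using q(1) that unfolding Q_def by (intro diagonal_projection_eq_dproj) auto
  \<comment> \<open>Of the three parts of the margin, one pays for the compact perturbation, one for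
    the diagonal, and one for the final gain \<open>1 / real (K n)\<close>.\<close>
  have "\<exists>\<epsilon>>0. \<forall>j\<in>{1..r}. norm (q j * (p - cond_exp p) * q j + k j) \<le> 1 - 3 * \<epsilon>"
  proof -
    \<comment> \<open>Inserting 0 keeps the maximum defined when there are no pieces.\<close>
    define \<beta> where "\<beta> = Max (insert 0 ((\<lambda>j. norm (q j * (p - cond_exp p) * q j + k j)) ` {1..r}))"
    have "\<beta> < 1" unfolding \<beta>_def using k(2) by (subst Max_less_iff) auto
    then have \<epsilon>: "0 < (1 - \<beta>) / 3" "\<beta> = 1 - 3 * ((1 - \<beta>) / 3)" by (simp_all add: field_simps)
    have "norm (q j * (p - cond_exp p) * q j + k j) \<le> \<beta>" if "j \<in> {1..r}" for j
      unfolding \<beta>_def using that by (intro Max_ge) auto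
    then have "\<forall>j\<in>{1..r}. norm (q j * (p - cond_exp p) * q j + k j) \<le> 1 - 3 * ((1 - \<beta>) / 3)"
      using \<epsilon>(2) by metis
    then show ?thesis using \<epsilon>(1) by blast
  qed
  then obtain \<epsilon> where \<epsilon>: "0 < \<epsilon>"
    "\<And>j. j \<in> {1..r} \<Longrightarrow> norm (q j * (p - cond_exp p) * q j + k j) \<le> 1 - 3 * \<epsilon>" by blast
  have "eventually (\<lambda>n. \<forall>j\<in>{1..r}. opnorm (coord (k j) n) < \<epsilon>) sequentially"
    by (intro eventually_ball_finite ballI order_tendstoD(2)[OF _ \<epsilon>(1)])
      (use k(1) in \<open>auto simp: compacts_iff\<close>)
  then have "eventually (\<lambda>n. (\<forall>j\<in>{1..r}. opnorm (coord (k j) n) < \<epsilon>) \<and>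
      (1 / real (K n) \<le> \<epsilon> \<and> r \<le> K n \<and> B n \<noteq> {} \<and> 2 \<le> n)) sequentially"
    using small[OF \<epsilon>(1), of r] by (rule eventually_conj)
  then obtain n where n: "\<forall>j\<in>{1..r}. opnorm (coord (k j) n) < \<epsilon>" "1 / real (K n) \<le> \<epsilon>" "r \<le> K n"
      "B n \<noteq> {}" "2 \<le> n"
    using eventually_happens' sequentially_bot by blast
  have "colourable (K n) {..<m n} {..<n} (w n) (1 - 1 / real (K n))"
  proof (rule colourable_of_compressions[OF _ n(5) _ n(3)])
    show "entry p n i j = (\<Sum>d<m n. w n i d * cnj (w n j d))" if "i < n" "j < n" for i j
      using that n by (simp add: p)
    show "(\<Sum>j=1..r. dproj (Q j)) = 1" using q(2) qQ by simp
    have "2 \<le> K n" using K[OF n(4)] by (simp add: B_def)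
    then show "0 \<le> 1 - 1 / real (K n)" by simp
    fix j assume j: "j \<in> {1..r}"
    let ?y = "q j * (p - cond_exp p) * q j + k j"
    have "q j * p * q j = ?y + (- k j + q j * cond_exp p * q j)"
      by (simp add: left_diff_distrib right_diff_distrib)
    then have "opnorm (coord (q j * p * q j) n)
        \<le> opnorm (coord ?y n) + (opnorm (coord (k j) n) + opnorm (coord (q j * cond_exp p * q j) n))"
      using opnorm_coord_triangle[of ?y "- k j + q j * cond_exp p * q j" n]
        opnorm_coord_triangle[of "- k j" "q j * cond_exp p * q j" n] by (simp add: opnorm_coord_uminus)
    moreover have "opnorm (coord ?y n) \<le> 1 - 3 * \<epsilon>"
      using coord_le_norm[OF n(5), of ?y] \<epsilon>(2)[OF j] by linarith
    moreover have "opnorm (coord (k j) n) < \<epsilon>" using n(1) j by blast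
    moreover have "opnorm (coord (q j * cond_exp p * q j) n) \<le> \<epsilon>"
    proof -
      have q1: "opnorm (coord (q j) n) \<le> 1"
        using coord_le_norm[OF n(5), of "q j"] norm_dproj_le[of "Q j"] qQ[OF j] by simp
      have "opnorm (coord (q j * cond_exp p * q j) n)
          \<le> opnorm (coord (q j) n) * opnorm (coord (cond_exp p) n) * opnorm (coord (q j) n)"
        using opnorm_coord_mult[of "q j * cond_exp p" "q j" n] opnorm_coord_mult[of "q j" "cond_exp p" n]
        by (meson mult_right_mono opnorm_nonneg order_trans)
      also have "\<dots> \<le> 1 * opnorm (coord (cond_exp p) n) * 1"
        by (intro mult_mono q1) auto
      also have "\<dots> \<le> \<epsilon>" using diag[OF n(5,4)] n(2) by simp
      finally show ?thesis .
    qed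
    ultimately show "opnorm (coord (dproj (Q j) * p * dproj (Q j)) n) \<le> 1 - 1 / real (K n)"
      using n(2) qQ[OF j] by simp
  qed
  then show False using w[OF n(4)] unfolding uncolourable_def by blast
qed

theorem theorem4p3:
  shows "((\<forall>p. is_projection p \<and> p \<notin> compacts \<and> cond_exp p \<in> compacts \<longrightarrow> weakly_paveable p)
            \<longleftrightarrow> (\<forall>p. is_projection p \<and> p \<notin> compacts \<longrightarrow> weakly_paveable p))
       \<and> ((\<forall>p. is_projection p \<and> p \<notin> compacts \<longrightarrow> weakly_paveable p)
            \<longleftrightarrow> (\<forall>f. pure_state diagonals f
                  \<longrightarrow> (\<exists>!g. pure_state UNIV g \<and> (\<forall>d\<in>diagonals. g d = f d))))"
    (is "(?S1 \<longleftrightarrow> ?S2) \<and> (_ \<longleftrightarrow> ?S3)")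
proof -
  \<comment> \<open>The implications are closed in the order \<open>?S1\<close>, \<open>?S3\<close>,
    \<open>?S2\<close>, \<open>?S1\<close>.\<close>
  have 12: ?S3 if s1: ?S1
  proof -
    obtain k where k: "2 \<le> k" "small_rows_colourable k"
      using small_rows_colourable_if_weakly_paveable s1 by blast
    have uc: "uniformly_colourable (1 + \<eta>)" if "0 < \<eta>" for \<eta>
      using uniformly_colourable_near_1[OF small_rows_imp_uniformly_colourable[OF k(2,1)] _ that] k(1) by simp
    show ?S3 using unique_pure_extension[OF uc] by blast
  qed
  moreover have ?S2 if s3: ?S3
    using weakly_paveable_if_unique_pure_extension s3 by blast
  moreover have "?S2 \<Longrightarrow> ?S1" by blast
  ultimately show ?thesis by blast
qed

end
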